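(* Let $T>0$, let $N$ be a positive integer, $\tau=T/N$, and let $\{\vec P^n\}_{n=0}^N\subset[H^1_0(\Omega)]^d$ satisfy $\vec P^0=\vec P_0$ and, for $0\le n\le N-1$, $$\frac{\rho_v}{\tau}(\vec P^{n+1}-\vec P^n,\vec Q)+g(\nabla\vec P^{n+1},\nabla\vec Q)+(\mathbf{D}F^+(\vec P^{n+1}),\vec Q)+(\nabla V^{n+1},\vec Q)=(\mathbf{D}F^-(\vec P^n),\vec Q)\qquad\forall\,\vec Q\in[H^1_0(\Omega)]^d,$$ where $V^{n}=V_{\vec P^n}=\Phi(\rho-\operatorname{div}\vec P^n)$. Then this time discretization scheme is energy stable, i.e. $$I(\vec P^{n+1})\le I(\vec P^n)\qquad\text{for } 0\le n\le N-1.$$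
   Context: $\Omega\subset\mathbb R^d$ ($d\le 3$) is a bounded domain with Lipschitz boundary; $\partial\Omega=\Gamma_D\cup\Gamma_N$ with $\Gamma_D,\Gamma_N$ disjoint and $\Gamma_D$ of positive surface measure. $\mathcal V_D=\{w\in H^1(\Omega): w=0\text{ on }\Gamma_D\}$. $(\cdot,\cdot)$ is the $L^2(\Omega)$ inner product (extended to a duality product where needed) and $(\nabla\vec P,\nabla\vec Q)=\sum_{i=1}^d(\nabla P_i,\nabla Q_i)$. $\epsilon>0$ and $\rho_v>0$ are constants, $\rho\in L^2(\Omega)$ is a charge distribution independent of time, and $\vec P_0\in[H^1_0(\Omega)]^d$ is the initial polarization. $\Phi:L^2(\Omega)\to\mathcal V_D$ is the solution operator: for $h\in L^2(\Omega)$, $\Phi h\in\mathcal V_D$ is the unique solution of $(\epsilon\nabla\Phi h,\nabla w)=(h,w)$ for all $w\in\mathcal V_D$. For $\vec P\in[H^1_0(\Omega)]^d$, $V_{\vec P}=\Phi(\rho-\operatorname{div}\vec P)$. All components of the polarization follow the ferroelectric property with common real constants $\alpha,\beta,\gamma,g$, where either $\gamma,g>0$, or $\gamma=0$ and $\beta,g>0$. For a real number $\lambda$, $\lambda^+=\max\{\lambda,0\}$ and $\lambda^-=\max\{-\lambda,0\}$. Set $$F^\pm(\vec P)=\sum_{i=1}^d\big(\alpha^\pm P_i^2+\beta^\pm P_i^4+\gamma^\pm P_i^6\big),\qquad \mathbf{D}F^\pm(\vec P)=\big(2\alpha^\pm P_i+4\beta^\pm P_i^3+6\gamma^\pm P_i^5\big)_{i=1}^d,$$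 and $F=F^+-F^-$. The energy is $$I(\vec P)=\int_\Omega\Big(\frac{\epsilon}{2}|\nabla V_{\vec P}|^2+F(\vec P)+\sum_{i=1}^d\frac{g}{2}|\nabla P_i|^2\Big)\,dx .$$ *)

theory Defs
  imports "HOL-Analysis.Analysis"
begin

section \<open>Surface measure\<close>

text \<open>
  The surface measure on \<open>\<partial>\<Omega>\<close> is the \<open>(d - 1)\<close>-dimensional Hausdorff measure, normalised to agree
  with Lebesgue measure on hyperplanes, on its Caratheodory-measurable sets.  The gauge of the empty
  set has to be set to 0 explicitly because of \<open>0 ^ 0 = 1\<close>; for \<open>s = 0\<close> one gets counting measure.
\<close>

definition hausdorff_gauge :: "nat \<Rightarrow> 'a::metric_space set \<Rightarrow> ennreal" where
  "hausdorff_gauge s C =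
     (if C = {} then 0 else ennreal (unit_ball_vol (real s) * (diameter C / 2) ^ s))"

definition hausdorff_pre :: "real \<Rightarrow> nat \<Rightarrow> 'a::metric_space set \<Rightarrow> ennreal" where
  "hausdorff_pre \<delta> s A =
     (INF C\<in>{C :: nat \<Rightarrow> 'a set. A \<subseteq> (\<Union>i. C i) \<and> (\<forall>i. bounded (C i) \<and> diameter (C i) \<le> \<delta>)}.
        \<Sum>i. hausdorff_gauge s (C i))"

definition hausdorff_outer :: "nat \<Rightarrow> 'a::metric_space set \<Rightarrow> ennreal" where
  "hausdorff_outer s A = (SUP \<delta>\<in>{0<..}. hausdorff_pre \<delta> s A)"

definition hausdorff_measure :: "nat \<Rightarrow> 'a::metric_space measure" where
  "hausdorff_measure s =
     measure_of UNIV (lambda_system UNIV UNIV (hausdorff_outer s)) (hausdorff_outer s)"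

lemma hausdorff_pre_empty: "\<delta> > 0 \<Longrightarrow> hausdorff_pre \<delta> s {} = 0"
proof -
  assume "\<delta> > 0"
  then have "hausdorff_pre \<delta> s ({} :: 'a set) \<le> (\<Sum>i::nat. hausdorff_gauge s ({} :: 'a set))"
    unfolding hausdorff_pre_def
    by (intro INF_lower2[where i = "\<lambda>_. {}"]) (auto simp: diameter_def)
  then show ?thesis
    by (simp add: hausdorff_gauge_def)
qed

lemma hausdorff_pre_mono: "A \<subseteq> B \<Longrightarrow> hausdorff_pre \<delta> s A \<le> hausdorff_pre \<delta> s B"
  unfolding hausdorff_pre_def by (rule INF_superset_mono) auto

lemma hausdorff_pre_subadditive:
  "hausdorff_pre \<delta> s (\<Union>i::nat. A i) \<le> (\<Sum>i. hausdorff_pre \<delta> s (A i))"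
proof (rule ennreal_le_epsilon)
  fix e :: real
  assume e: "0 < e" and fin: "(\<Sum>n. hausdorff_pre \<delta> s (A n)) < top"
  have *: "hausdorff_pre \<delta> s (A n) < hausdorff_pre \<delta> s (A n) + e * (1/2) ^ Suc n" for n
  proof -
    have "hausdorff_pre \<delta> s (A n) < top"
      using fin by (rule ennreal_suminf_lessD)
    then show ?thesis
      using e by (simp add: ennreal_zero_less_mult_iff)
  qed
  have "\<exists>C :: nat \<Rightarrow> 'a set. A n \<subseteq> (\<Union>i. C i) \<and> (\<forall>i. bounded (C i) \<and> diameter (C i) \<le> \<delta>) \<and>
      (\<Sum>i. hausdorff_gauge s (C i)) \<le> hausdorff_pre \<delta> s (A n) + e * (1/2) ^ Suc n" for n
    using *[of n] unfolding hausdorff_pre_def INF_less_iff by (force intro: less_imp_le)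
  then obtain C :: "nat \<Rightarrow> nat \<Rightarrow> 'a set" where
    C: "\<And>n. A n \<subseteq> (\<Union>i. C n i)" "\<And>n i. bounded (C n i)" "\<And>n i. diameter (C n i) \<le> \<delta>"
      and le: "\<And>n. (\<Sum>i. hausdorff_gauge s (C n i))
                     \<le> hausdorff_pre \<delta> s (A n) + e * (1/2) ^ Suc n"
    by metis
  let ?D = "(\<lambda>(n, i). C n i) \<circ> prod_decode"
  have "A n \<subseteq> (\<Union>k. ?D k)" for n
  proof
    fix x assume "x \<in> A n"
    then obtain i where "x \<in> C n i" using C(1)[of n] by auto
    then have "x \<in> ?D (prod_encode (n, i))" by simp
    then show "x \<in> (\<Union>k. ?D k)" by blast
  qed
  then have "hausdorff_pre \<delta> s (\<Union>i. A i) \<le> (\<Sum>k. hausdorff_gauge s (?D k))"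
    unfolding hausdorff_pre_def
    by (intro INF_lower) (auto simp: C split: prod.split)
  also have "\<dots> = (\<Sum>n. \<Sum>i. hausdorff_gauge s (C n i))"
    using suminf_ennreal_2dimen[where f = "\<lambda>(n, i). hausdorff_gauge s (C n i)"
        and g = "\<lambda>n. \<Sum>i. hausdorff_gauge s (C n i)"]
    by (simp add: case_prod_beta comp_def)
  also have "\<dots> \<le> (\<Sum>n. hausdorff_pre \<delta> s (A n) + e * (1/2) ^ Suc n)"
    by (intro suminf_le le) auto
  also have "\<dots> = (\<Sum>n. hausdorff_pre \<delta> s (A n)) + (\<Sum>n. ennreal e * ennreal ((1/2) ^ Suc n))"
    using e by (subst suminf_add[symmetric])
      (auto simp del: ennreal_suminf_cmult simp add: ennreal_mult[symmetric])
  also have "\<dots> = (\<Sum>n. hausdorff_pre \<delta> s (A n)) + e"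
    unfolding ennreal_suminf_cmult
    by (subst suminf_ennreal_eq[OF zero_le_power power_half_series]) auto
  finally show "hausdorff_pre \<delta> s (\<Union>i. A i) \<le> (\<Sum>n. hausdorff_pre \<delta> s (A n)) + e" .
qed

lemma outer_measure_space_hausdorff_outer: "outer_measure_space UNIV (hausdorff_outer s)"
proof -
  have "hausdorff_outer s (\<Union>i. A i) \<le> (\<Sum>i. hausdorff_outer s (A i))" for A :: "nat \<Rightarrow> 'a set"
    unfolding hausdorff_outer_def[of s "\<Union>i. A i"]
  proof (rule SUP_least)
    fix \<delta> :: real assume "\<delta> \<in> {0<..}"
    then have "hausdorff_pre \<delta> s (A i) \<le> hausdorff_outer s (A i)" for i
      unfolding hausdorff_outer_def by (rule SUP_upper)
    then have "(\<Sum>i. hausdorff_pre \<delta> s (A i)) \<le> (\<Sum>i. hausdorff_outer s (A i))"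
      by (intro suminf_le) auto
    with hausdorff_pre_subadditive[of \<delta> s A]
    show "hausdorff_pre \<delta> s (\<Union>i. A i) \<le> (\<Sum>i. hausdorff_outer s (A i))"
      by (rule order_trans)
  qed
  moreover have "hausdorff_outer s ({} :: 'a set) = 0"
    unfolding hausdorff_outer_def
    by (intro order_antisym SUP_least) (simp_all add: hausdorff_pre_empty)
  moreover have "hausdorff_outer s A \<le> hausdorff_outer s B" if "A \<subseteq> B" for A B :: "'a set"
    unfolding hausdorff_outer_def using hausdorff_pre_mono[OF that] by (intro SUP_mono) auto
  ultimately show ?thesis
    by (simp add: outer_measure_space_def positive_def increasing_def countably_subadditive_def)
qed

lemma
  fixes A :: "'a::metric_space set"
  shows space_hausdorff_measure: "space (hausdorff_measure s :: 'a measure) = UNIV"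
    and sets_hausdorff_measure:
      "sets (hausdorff_measure s :: 'a measure) = lambda_system UNIV UNIV (hausdorff_outer s)"
    and emeasure_hausdorff_measure:
      "A \<in> sets (hausdorff_measure s) \<Longrightarrow> emeasure (hausdorff_measure s) A = hausdorff_outer s A"
proof -
  have "measure_space UNIV (lambda_system UNIV UNIV (hausdorff_outer s))
      (hausdorff_outer s :: 'a set \<Rightarrow> ennreal)"
    using sigma_algebra.caratheodory_lemma[OF sigma_algebra_Pow[of UNIV],
        of "hausdorff_outer s :: 'a set \<Rightarrow> ennreal"]
    by (simp add: outer_measure_space_hausdorff_outer)
  then have ms: "sigma_algebra UNIV (lambda_system UNIV UNIV (hausdorff_outer s :: 'a set \<Rightarrow> _))"
      "positive (lambda_system UNIV UNIV (hausdorff_outer s :: 'a set \<Rightarrow> _)) (hausdorff_outer s)"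
      "countably_additive (lambda_system UNIV UNIV (hausdorff_outer s :: 'a set \<Rightarrow> _))
         (hausdorff_outer s)"
    by (auto simp: measure_space_def)
  show "space (hausdorff_measure s :: 'a measure) = UNIV"
    unfolding hausdorff_measure_def by (rule sigma_algebra.space_measure_of_eq[OF ms(1)])
  show S: "sets (hausdorff_measure s :: 'a measure)
      = lambda_system UNIV UNIV (hausdorff_outer s)"
    unfolding hausdorff_measure_def by (rule sigma_algebra.sets_measure_of_eq[OF ms(1)])
  show "emeasure (hausdorff_measure s) A = hausdorff_outer s A"
    if "A \<in> sets (hausdorff_measure s)"
    unfolding hausdorff_measure_def
    using that[unfolded S] by (rule emeasure_measure_of_sigma[OF ms])
qed

definition surface_measure :: "(real^'d) set \<Rightarrow> (real^'d) measure" where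
  "surface_measure \<Omega> = restrict_space (hausdorff_measure (CARD('d) - 1)) (frontier \<Omega>)"

section \<open>Lipschitz boundary\<close>

text \<open>
  Near each boundary point \<open>\<Omega>\<close> lies strictly below the graph of a Lipschitz function over the
  hyperplane orthogonal to a unit vector \<open>\<nu>\<close>.
\<close>

definition lipschitz_boundary :: "(real^'d) set \<Rightarrow> bool" where
  "lipschitz_boundary \<Omega> \<longleftrightarrow>
     (\<forall>x\<in>frontier \<Omega>. \<exists>U \<nu> L (\<phi> :: real^'d \<Rightarrow> real).
        open U \<and> x \<in> U \<and> norm \<nu> = 1 \<and> L-lipschitz_on {y. y \<bullet> \<nu> = 0} \<phi> \<and>
        \<Omega> \<inter> U = {y \<in> U. y \<bullet> \<nu> < \<phi> (y - (y \<bullet> \<nu>) *\<^sub>R \<nu>)})"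

section \<open>Square integrable functions\<close>

definition L2 :: "'a measure \<Rightarrow> ('a \<Rightarrow> 'b::euclidean_space) set" where
  "L2 M = {f \<in> borel_measurable M. integrable M (\<lambda>x. (norm (f x))\<^sup>2)}"

text \<open>For real-valued functions \<open>\<bullet>\<close> is multiplication.\<close>

definition L2_inner :: "'a measure \<Rightarrow> ('a \<Rightarrow> 'b::euclidean_space) \<Rightarrow> ('a \<Rightarrow> 'b) \<Rightarrow> real" where
  "L2_inner M f g = (\<integral>x. f x \<bullet> g x \<partial>M)"

definition L2_norm :: "'a measure \<Rightarrow> ('a \<Rightarrow> 'b::euclidean_space) \<Rightarrow> real" where
  "L2_norm M f = sqrt (L2_inner M f f)"

section \<open>Sobolev spaces\<close>

definition partial_deriv :: "'d \<Rightarrow> (real^'d \<Rightarrow> real) \<Rightarrow> real^'d \<Rightarrow> real" where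
  "partial_deriv i f x = frechet_derivative f (at x) (axis i 1)"

primrec C_k :: "nat \<Rightarrow> (real^'d \<Rightarrow> real) \<Rightarrow> bool" where
  "C_k 0 f \<longleftrightarrow> continuous_on UNIV f"
| "C_k (Suc k) f \<longleftrightarrow> (\<forall>x. f differentiable (at x)) \<and> (\<forall>i. C_k k (partial_deriv i f))"

definition smooth :: "(real^'d \<Rightarrow> real) \<Rightarrow> bool" where
  "smooth f \<longleftrightarrow> (\<forall>k. C_k k f)"

definition test_functions :: "(real^'d) set \<Rightarrow> (real^'d \<Rightarrow> real) set" where
  "test_functions \<Omega> =
     {\<phi>. smooth \<phi> \<and> compact (closure {x. \<phi> x \<noteq> 0}) \<and> closure {x. \<phi> x \<noteq> 0} \<subseteq> \<Omega>}"

definition has_weak_gradient :: "(real^'d) set \<Rightarrow> (real^'d \<Rightarrow> real) \<Rightarrow> (real^'d \<Rightarrow> real^'d) \<Rightarrow> bool"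
  where
  "has_weak_gradient \<Omega> u G \<longleftrightarrow> u \<in> L2 (lebesgue_on \<Omega>) \<and> G \<in> L2 (lebesgue_on \<Omega>) \<and>
     (\<forall>\<phi>\<in>test_functions \<Omega>. \<forall>i.
        (\<integral>x. u x * partial_deriv i \<phi> x \<partial>lebesgue_on \<Omega>) = - (\<integral>x. G x $ i * \<phi> x \<partial>lebesgue_on \<Omega>))"

text \<open>
  Functions stand for their classes modulo equality almost everywhere on \<open>\<Omega>\<close>.  In particular
  \<open>weak_gradient\<close> picks one representative of the weak gradient.
\<close>

definition H1 :: "(real^'d) set \<Rightarrow> (real^'d \<Rightarrow> real) set" where
  "H1 \<Omega> = {u. \<exists>G. has_weak_gradient \<Omega> u G}"

definition weak_gradient :: "(real^'d) set \<Rightarrow> (real^'d \<Rightarrow> real) \<Rightarrow> real^'d \<Rightarrow> real^'d" where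
  "weak_gradient \<Omega> u = (SOME G. has_weak_gradient \<Omega> u G)"

definition H1_norm :: "(real^'d) set \<Rightarrow> (real^'d \<Rightarrow> real) \<Rightarrow> real" where
  "H1_norm \<Omega> u =
     sqrt ((L2_norm (lebesgue_on \<Omega>) u)\<^sup>2 + (L2_norm (lebesgue_on \<Omega>) (weak_gradient \<Omega> u))\<^sup>2)"

definition H10 :: "(real^'d) set \<Rightarrow> (real^'d \<Rightarrow> real) set" where
  "H10 \<Omega> = {u \<in> H1 \<Omega>. \<exists>\<phi> :: nat \<Rightarrow> real^'d \<Rightarrow> real.
     (\<forall>k. \<phi> k \<in> test_functions \<Omega>) \<and> (\<lambda>k. H1_norm \<Omega> (\<lambda>x. u x - \<phi> k x)) \<longlonglongrightarrow> 0}"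

definition H10_vec :: "(real^'d) set \<Rightarrow> (real^'d \<Rightarrow> real^'d) set" where
  "H10_vec \<Omega> = {P. \<forall>i. (\<lambda>x. P x $ i) \<in> H10 \<Omega>}"

definition weak_div :: "(real^'d) set \<Rightarrow> (real^'d \<Rightarrow> real^'d) \<Rightarrow> real^'d \<Rightarrow> real" where
  "weak_div \<Omega> P x = (\<Sum>i\<in>UNIV. weak_gradient \<Omega> (\<lambda>x. P x $ i) x $ i)"

definition grad_inner ::
    "(real^'d) set \<Rightarrow> (real^'d \<Rightarrow> real^'d) \<Rightarrow> (real^'d \<Rightarrow> real^'d) \<Rightarrow> real" where
  "grad_inner \<Omega> P Q = (\<Sum>i\<in>UNIV. L2_inner (lebesgue_on \<Omega>)
     (weak_gradient \<Omega> (\<lambda>x. P x $ i)) (weak_gradient \<Omega> (\<lambda>x. Q x $ i)))"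

text \<open>
  Graph of the trace operator of a bounded Lipschitz domain, i.e. of the continuous extension to
  \<open>H1 \<Omega>\<close> of the restriction to \<open>\<partial>\<Omega>\<close> of functions smooth up to the boundary.
\<close>

definition has_trace :: "(real^'d) set \<Rightarrow> (real^'d \<Rightarrow> real) \<Rightarrow> (real^'d \<Rightarrow> real) \<Rightarrow> bool" where
  "has_trace \<Omega> u g \<longleftrightarrow> u \<in> H1 \<Omega> \<and> g \<in> L2 (surface_measure \<Omega>) \<and>
     (\<exists>\<phi> :: nat \<Rightarrow> real^'d \<Rightarrow> real. (\<forall>k. smooth (\<phi> k)) \<and>
        (\<lambda>k. H1_norm \<Omega> (\<lambda>x. u x - \<phi> k x)) \<longlonglongrightarrow> 0 \<and>
        (\<lambda>k. L2_norm (surface_measure \<Omega>) (\<lambda>x. \<phi> k x - g x)) \<longlonglongrightarrow> 0)"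

definition V_D :: "(real^'d) set \<Rightarrow> (real^'d) set \<Rightarrow> (real^'d \<Rightarrow> real) set" where
  "V_D \<Omega> \<Gamma>\<^sub>D = {w \<in> H1 \<Omega>. \<exists>g. has_trace \<Omega> w g \<and>
     (AE x in surface_measure \<Omega>. x \<in> \<Gamma>\<^sub>D \<longrightarrow> g x = 0)}"

section \<open>The electric potential\<close>

definition weak_solution ::
    "(real^'d) set \<Rightarrow> (real^'d) set \<Rightarrow> real \<Rightarrow> (real^'d \<Rightarrow> real) \<Rightarrow> (real^'d \<Rightarrow> real) \<Rightarrow> bool" where
  "weak_solution \<Omega> \<Gamma>\<^sub>D \<epsilon> h v \<longleftrightarrow> v \<in> V_D \<Omega> \<Gamma>\<^sub>D \<and>
     (\<forall>w\<in>V_D \<Omega> \<Gamma>\<^sub>D. L2_inner (lebesgue_on \<Omega>) (\<lambda>x. \<epsilon> *\<^sub>R weak_gradient \<Omega> v x) (weak_gradient \<Omega> w)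
        = L2_inner (lebesgue_on \<Omega>) h w)"

definition solution_operator ::
    "(real^'d) set \<Rightarrow> (real^'d) set \<Rightarrow> real \<Rightarrow> ((real^'d \<Rightarrow> real) \<Rightarrow> (real^'d \<Rightarrow> real)) \<Rightarrow> bool" where
  "solution_operator \<Omega> \<Gamma>\<^sub>D \<epsilon> \<Phi> \<longleftrightarrow>
     (\<forall>h\<in>L2 (lebesgue_on \<Omega>). weak_solution \<Omega> \<Gamma>\<^sub>D \<epsilon> h (\<Phi> h) \<and>
        (\<forall>v. weak_solution \<Omega> \<Gamma>\<^sub>D \<epsilon> h v \<longrightarrow> (AE x in lebesgue_on \<Omega>. v x = \<Phi> h x)))"

definition potential ::
    "(real^'d) set \<Rightarrow> ((real^'d \<Rightarrow> real) \<Rightarrow> (real^'d \<Rightarrow> real)) \<Rightarrow> (real^'d \<Rightarrow> real) \<Rightarrow>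
     (real^'d \<Rightarrow> real^'d) \<Rightarrow> real^'d \<Rightarrow> real" where
  "potential \<Omega> \<Phi> \<rho> P = \<Phi> (\<lambda>x. \<rho> x - weak_div \<Omega> P x)"

section \<open>The energy\<close>

definition pos_part :: "real \<Rightarrow> real" where "pos_part l = max l 0"
definition neg_part :: "real \<Rightarrow> real" where "neg_part l = max (- l) 0"

definition sextic :: "real \<Rightarrow> real \<Rightarrow> real \<Rightarrow> real^'d \<Rightarrow> real" where
  "sextic a b c p = (\<Sum>i\<in>UNIV. a * (p $ i)^2 + b * (p $ i)^4 + c * (p $ i)^6)"

definition D_sextic :: "real \<Rightarrow> real \<Rightarrow> real \<Rightarrow> real^'d \<Rightarrow> real^'d" where
  "D_sextic a b c p = (\<chi> i. 2 * a * p $ i + 4 * b * (p $ i)^3 + 6 * c * (p $ i)^5)"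

definition F_plus :: "real \<Rightarrow> real \<Rightarrow> real \<Rightarrow> real^'d \<Rightarrow> real" where
  "F_plus \<alpha> \<beta> \<gamma> = sextic (pos_part \<alpha>) (pos_part \<beta>) (pos_part \<gamma>)"

definition F_minus :: "real \<Rightarrow> real \<Rightarrow> real \<Rightarrow> real^'d \<Rightarrow> real" where
  "F_minus \<alpha> \<beta> \<gamma> = sextic (neg_part \<alpha>) (neg_part \<beta>) (neg_part \<gamma>)"

definition DF_plus :: "real \<Rightarrow> real \<Rightarrow> real \<Rightarrow> real^'d \<Rightarrow> real^'d" where
  "DF_plus \<alpha> \<beta> \<gamma> = D_sextic (pos_part \<alpha>) (pos_part \<beta>) (pos_part \<gamma>)"

definition DF_minus :: "real \<Rightarrow> real \<Rightarrow> real \<Rightarrow> real^'d \<Rightarrow> real^'d" where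
  "DF_minus \<alpha> \<beta> \<gamma> = D_sextic (neg_part \<alpha>) (neg_part \<beta>) (neg_part \<gamma>)"

definition F_total :: "real \<Rightarrow> real \<Rightarrow> real \<Rightarrow> real^'d \<Rightarrow> real" where
  "F_total \<alpha> \<beta> \<gamma> p = F_plus \<alpha> \<beta> \<gamma> p - F_minus \<alpha> \<beta> \<gamma> p"

definition energy ::
    "(real^'d) set \<Rightarrow> ((real^'d \<Rightarrow> real) \<Rightarrow> (real^'d \<Rightarrow> real)) \<Rightarrow> (real^'d \<Rightarrow> real) \<Rightarrow>
     real \<Rightarrow> real \<Rightarrow> real \<Rightarrow> real \<Rightarrow> real \<Rightarrow> (real^'d \<Rightarrow> real^'d) \<Rightarrow> real" where
  "energy \<Omega> \<Phi> \<rho> \<epsilon> \<alpha> \<beta> \<gamma> g P =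
     (\<integral>x. \<epsilon> / 2 * (norm (weak_gradient \<Omega> (potential \<Omega> \<Phi> \<rho> P) x))\<^sup>2
           + F_total \<alpha> \<beta> \<gamma> (P x)
           + (\<Sum>i\<in>UNIV. g / 2 * (norm (weak_gradient \<Omega> (\<lambda>y. P y $ i) x))\<^sup>2) \<partial>lebesgue_on \<Omega>)"

end

theory Submission
  imports Defs
begin

text \<open>
  The scheme treats the convex part \<open>F\<^sup>+\<close> of the potential implicitly and the concave part
  \<open>- F\<^sup>-\<close> explicitly.  Tested with the increment \<open>Q = P\<^sup>n\<^sup>+\<^sup>1 - P\<^sup>n\<close>, each of its terms bounds the
  increase of one part of the energy, up to the dissipation \<open>(\<rho>\<^sub>v / \<tau>) \<parallel>Q\<parallel>\<^sup>2 \<ge> 0\<close>.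

  \<^item> \<open>F\<^sup>+\<close> and \<open>F\<^sup>-\<close> are convex.  The tangent of \<open>F\<^sup>+\<close> at the new value and the tangent of
    \<open>F\<^sup>-\<close> at the old value give inequalities in the two opposite directions, which are those
    wanted for \<open>F = F\<^sup>+ - F\<^sup>-\<close> (\<open>sextic_tangent\<close>).

  \<^item> The gradient term is quadratic, and \<open>a \<bullet> (a - b) \<ge> (\<bar>a\<bar>\<^sup>2 - \<bar>b\<bar>\<^sup>2) / 2\<close>
    (\<open>grad_inner_diff_ge\<close>).

  \<^item> For the potential, integration by parts turns \<open>(\<nabla>V\<^sup>n\<^sup>+\<^sup>1, Q)\<close> into \<open>- (V\<^sup>n\<^sup>+\<^sup>1, div Q)\<close>.  As
    \<open>- div Q\<close> is the difference of the right hand sides in the equations for \<open>V\<^sup>n\<^sup>+\<^sup>1\<close> and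
    \<open>V\<^sup>n\<close>, this equals \<open>\<epsilon> (\<nabla>V\<^sup>n\<^sup>+\<^sup>1 - \<nabla>V\<^sup>n, \<nabla>V\<^sup>n\<^sup>+\<^sup>1)\<close>, and the quadratic inequality
    applies again (\<open>potential_coupling_ge\<close>).

  Two facts from analysis carry this argument.

  The first concerns weak gradients.  They have to be unique almost everywhere, so that the gradient
  of the increment is the difference of the gradients for whatever representatives are chosen, and
  this is the fundamental lemma of the calculus of variations.  Its proof needs enough test
  functions, here smooth bumps that approximate the indicators of boxes.  Moreover the weak gradient
  of a test function has to be its classical gradient.  Then a function in \<open>H10\<close> and its gradient
  are limits of test functions and their gradients, and the definition of the weak gradient extends
  from test functions to \<open>H10_integration_by_parts\<close>.

  The second is the Sobolev embedding of \<open>H10\<close> into \<open>L\<^sup>6\<close> in dimension at most 3.  The energy and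
  the nonlinear terms of the scheme are integrals of polynomials of degree up to 6 in the components
  of \<open>P\<close>, and the Bochner integral of a function that is not integrable is 0 by convention.  Without
  the embedding the energy could not be split, nor could pointwise inequalities be integrated.  For
  test functions the embedding is the Gagliardo--Nirenberg argument: \<open>\<phi>\<^sup>4\<close> is bounded by the integral
  of \<open>4 \<bar>\<phi>\<bar>\<^sup>3 \<bar>\<partial>\<^sub>i\<phi>\<bar>\<close> along each of three coordinate lines, and the Loomis--Whitney inequality combines
  the three bounds (\<open>sobolev_test_function\<close>).  Fatou's lemma carries the estimate over to \<open>H10\<close>.
\<close>

section \<open>Smooth functions and bumps\<close>

lemma partial_deriv_eq:
  assumes "(f has_derivative f') (at x)"
  shows "partial_deriv i f x = f' (axis i 1)"
  using frechet_derivative_at[OF assms] by (simp add: partial_deriv_def)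

text \<open>
  The definition of \<open>C_k\<close> asks for continuity only of the derivatives of top order; continuity of the
  lower ones comes from differentiability.
\<close>

lemma C_k_Suc_imp_C_k: "C_k (Suc k) f \<Longrightarrow> C_k k f"
proof (induction k arbitrary: f)
  case 0
  then have "continuous (at x) f" for x
    by (simp add: differentiable_imp_continuous_within)
  then show ?case
    by (simp add: continuous_on_eq_continuous_at)
next
  case (Suc k)
  from Suc.prems have "f differentiable (at x)" "C_k (Suc k) (partial_deriv i f)" for x i
    by auto
  with Suc.IH show ?case
    by simp
qed

lemma C_k_const: "C_k k (\<lambda>x. c)"
proof (induction k arbitrary: c)
  case (Suc k)
  have "partial_deriv i (\<lambda>x::real^'a. c) = (\<lambda>x. 0)" for i
    by (rule ext) (simp add: partial_deriv_eq[OF has_derivative_const])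
  with Suc show ?case
    by simp
qed simp

lemma partial_deriv_add:
  assumes "f differentiable (at x)" "g differentiable (at x)"
  shows "partial_deriv i (\<lambda>x. f x + g x) x = partial_deriv i f x + partial_deriv i g x"
  using has_derivative_add[OF assms[THEN frechet_derivative_works[THEN iffD1]]]
  by (simp add: partial_deriv_def[of i f] partial_deriv_def[of i g] partial_deriv_eq)

lemma C_k_add: "C_k k f \<Longrightarrow> C_k k g \<Longrightarrow> C_k k (\<lambda>x. f x + g x)"
proof (induction k arbitrary: f g)
  case 0
  then show ?case by (auto intro: continuous_intros)
next
  case (Suc k)
  then have d: "f differentiable (at x)" "g differentiable (at x)" for x
    by auto
  have "partial_deriv i (\<lambda>x. f x + g x) = (\<lambda>x. partial_deriv i f x + partial_deriv i g x)" for i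
    using partial_deriv_add[OF d] by auto
  with Suc d show ?case
    by (auto intro!: differentiable_add)
qed

lemma partial_deriv_mult:
  assumes "f differentiable (at x)" "g differentiable (at x)"
  shows "partial_deriv i (\<lambda>x. f x * g x) x = f x * partial_deriv i g x + partial_deriv i f x * g x"
  using has_derivative_mult[OF assms[THEN frechet_derivative_works[THEN iffD1]]]
  by (simp add: partial_deriv_def[of i f] partial_deriv_def[of i g] partial_deriv_eq)

lemma C_k_mult: "C_k k f \<Longrightarrow> C_k k g \<Longrightarrow> C_k k (\<lambda>x. f x * g x)"
proof (induction k arbitrary: f g)
  case 0
  then show ?case by (auto intro: continuous_intros)
next
  case (Suc k)
  then have d: "f differentiable (at x)" "g differentiable (at x)" for x
    by auto
  have "partial_deriv i (\<lambda>x. f x * g x) =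
      (\<lambda>x. f x * partial_deriv i g x + partial_deriv i f x * g x)" for i
    using partial_deriv_mult[OF d] by auto
  moreover have "C_k k (\<lambda>x. f x * partial_deriv i g x + partial_deriv i f x * g x)" for i
    using Suc.prems by (intro C_k_add Suc.IH) (auto intro: C_k_Suc_imp_C_k)
  ultimately show ?case
    using d by (auto intro!: differentiable_mult)
qed

lemma C_k_prod:
  assumes "finite A" "\<And>i. i \<in> A \<Longrightarrow> C_k k (f i)"
  shows "C_k k (\<lambda>x. \<Prod>i\<in>A. f i x)"
  using assms by (induction A) (auto intro: C_k_const C_k_mult)

lemma smooth_mult: "smooth f \<Longrightarrow> smooth g \<Longrightarrow> smooth (\<lambda>x. f x * g x)"
  by (simp add: smooth_def C_k_mult)

lemma smooth_diff:
  assumes "smooth f" "smooth g" shows "smooth (\<lambda>x. f x - g x)"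
  using assms C_k_add[of _ f "\<lambda>x. (-1) * g x"] C_k_mult[OF C_k_const[of _ "-1"], of _ g]
  by (simp add: smooth_def)

lemma smooth_differentiable: "smooth f \<Longrightarrow> f differentiable (at x)"
  unfolding smooth_def by (drule spec[of _ "Suc 0"]) simp

lemma smooth_continuous: "smooth f \<Longrightarrow> continuous_on S f"
  unfolding smooth_def using continuous_on_subset[of UNIV f S] by (drule_tac spec[of _ 0]) simp

lemma smooth_partial_deriv: "smooth f \<Longrightarrow> smooth (partial_deriv i f)"
  unfolding smooth_def using C_k.simps(2) by blast

text \<open>
  Dividing by powers of \<open>t\<close> makes the family of functions \<open>exp (- 1 / t) / t\<^sup>m\<close> closed under
  differentiation up to linear combinations, so that smoothness follows by induction on the order of
  the derivative, for all \<open>m\<close> at once.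
\<close>

definition flat_exp :: "nat \<Rightarrow> real \<Rightarrow> real" where
  "flat_exp m t = (if t > 0 then exp (- 1 / t) / t ^ m else 0)"

lemma tendsto_flat_exp_0: "(flat_exp m \<longlongrightarrow> 0) (at 0)"
proof -
  have "((\<lambda>t::real. (inverse t) ^ m / exp (inverse t)) \<longlongrightarrow> 0) (at_right 0)"
    by (rule filterlim_compose[OF tendsto_power_div_exp_0 filterlim_inverse_at_top_right])
  moreover have "\<forall>\<^sub>F t in at_right 0. (inverse t) ^ m / exp (inverse t) = flat_exp m t"
    by (auto simp: eventually_at_right_less flat_exp_def field_simps exp_minus
        intro!: eventually_mono[OF eventually_at_right_less[of "0::real"]])
  ultimately have "(flat_exp m \<longlongrightarrow> 0) (at_right 0)"
    by (rule Lim_transform_eventually)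
  moreover have "(flat_exp m \<longlongrightarrow> 0) (at_left 0)"
    by (rule tendsto_eventually, rule eventually_mono[OF eventually_at_leftI[of "-1" 0 "\<lambda>t. t < 0"]])
       (auto simp: flat_exp_def)
  ultimately show ?thesis
    by (simp add: filterlim_split_at)
qed

lemma DERIV_flat_exp:
  "(flat_exp m has_real_derivative flat_exp (m + 2) t - m * flat_exp (m + 1) t) (at t)"
proof (cases t "0::real" rule: linorder_cases)
  case less
  have "((\<lambda>_. 0) has_real_derivative 0) (at t)"
    by simp
  then have "(flat_exp m has_real_derivative 0) (at t)"
    by (rule has_field_derivative_transform_within_open[where S = "{..<0}"])
      (use less in \<open>auto simp: flat_exp_def\<close>)
  with less show ?thesis
    by (simp add: flat_exp_def)
next
  case equal
  have "((\<lambda>h. (flat_exp m h - flat_exp m 0) / (h - 0)) \<longlongrightarrow> 0) (at 0)"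
    using tendsto_flat_exp_0[of "Suc m"]
    by (rule Lim_transform_eventually) (auto simp: flat_exp_def eventually_at_filter field_simps)
  with equal show ?thesis
    by (simp add: has_field_derivative_iff flat_exp_def)
next
  case greater
  have "((\<lambda>t. exp (- 1 / t) / t ^ m) has_real_derivative
      flat_exp (m + 2) t - m * flat_exp (m + 1) t) (at t)"
  proof (cases m)
    case 0
    with greater show ?thesis
      by (auto intro!: derivative_eq_intros simp: flat_exp_def power2_eq_square)
  next
    case (Suc k)
    with greater show ?thesis
      by (auto intro!: derivative_eq_intros simp: flat_exp_def power2_eq_square divide_simps)
        (simp add: algebra_simps, cases k, auto)
  qed
  then show ?thesis
    by (rule has_field_derivative_transform_within_open[where S = "{0<..}"])
      (use greater in \<open>auto simp: flat_exp_def\<close>)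
qed

lemma C_k_flat_exp_coord: "C_k k (\<lambda>x::real^'d. flat_exp m (c * x $ i + b))"
proof (induction k arbitrary: m)
  case 0
  have "continuous_on UNIV (flat_exp m)"
    by (meson DERIV_continuous continuous_at_imp_continuous_on DERIV_flat_exp)
  then show ?case
    by (auto intro!: continuous_on_compose2[of UNIV "flat_exp m"] continuous_intros)
next
  case (Suc k)
  let ?d = "\<lambda>x::real^'d. flat_exp (m + 2) (c * x $ i + b) - m * flat_exp (m + 1) (c * x $ i + b)"
  have D: "((\<lambda>x::real^'d. flat_exp m (c * x $ i + b)) has_derivative (\<lambda>h. ?d x * (c * h $ i))) (at x)" for x
  proof (rule has_derivative_eq_rhs)
    have "((\<lambda>x::real^'d. c * x $ i + b) has_derivative (\<lambda>h. c * h $ i)) (at x)"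
      by (auto intro!: derivative_eq_intros bounded_linear.has_derivative[OF bounded_linear_vec_nth])
    from has_derivative_compose[OF this DERIV_flat_exp[of m "c * x $ i + b", unfolded has_field_derivative_def]]
    show "((\<lambda>x::real^'d. flat_exp m (c * x $ i + b)) has_derivative (\<lambda>h. ?d x * (c * h $ i))) (at x)"
      by simp
  qed simp
  have "partial_deriv j (\<lambda>x::real^'d. flat_exp m (c * x $ i + b)) =
      (\<lambda>x. (if i = j then c else 0) * (flat_exp (m + 2) (c * x $ i + b)
         + (- real m) * flat_exp (m + 1) (c * x $ i + b)))" for j
    by (rule ext) (auto simp: partial_deriv_eq[OF D] axis_def)
  moreover have "C_k k (\<lambda>x. (if i = j then c else 0) * (flat_exp (m + 2) (c * x $ i + b)
         + (- real m) * flat_exp (m + 1) (c * x $ i + b)))" for j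
    by (intro C_k_mult C_k_add C_k_const Suc.IH)
  ultimately show ?case
    using D by (auto simp del: add_2_eq_Suc' simp: differentiable_def)
qed

text \<open>
  Replacing \<open>t\<close> by \<open>(k + 1) t\<close> in \<open>exp (- 1 / t)\<close> leaves the support unchanged and lets the values
  at \<open>t > 0\<close> increase to 1 as \<open>k\<close> grows; hence these products converge to the indicator of the box
  while they stay supported in it.
\<close>

definition box_bump :: "real^'d \<Rightarrow> real^'d \<Rightarrow> nat \<Rightarrow> real^'d \<Rightarrow> real" where
  "box_bump a b k x = (\<Prod>i\<in>UNIV. flat_exp 0 (Suc k * (x $ i - a $ i)) * flat_exp 0 (Suc k * (b $ i - x $ i)))"

lemma smooth_box_bump: "smooth (box_bump a b k)"
  unfolding smooth_def
proof
  fix n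
  have "C_k n (\<lambda>x. \<Prod>i\<in>UNIV. flat_exp 0 (Suc k * x $ i + (- (Suc k * a $ i)))
      * flat_exp 0 ((- real (Suc k)) * x $ i + (Suc k * b $ i)))"
    by (intro C_k_prod C_k_mult C_k_flat_exp_coord) auto
  then show "C_k n (box_bump a b k)"
    unfolding box_bump_def[abs_def] by (simp add: algebra_simps)
qed

lemma box_bump_nonneg: "0 \<le> box_bump a b k x"
  and box_bump_le_1: "box_bump a b k x \<le> 1"
  by (auto simp: box_bump_def flat_exp_def intro!: prod_nonneg prod_le_1 mult_nonneg_nonneg mult_le_one)

lemma box_bump_outside: "x \<notin> box a b \<Longrightarrow> box_bump a b k x = 0"
proof -
  assume "x \<notin> box a b"
  then obtain i where "\<not> (a $ i < x $ i \<and> x $ i < b $ i)"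
    by (auto simp: mem_box_cart)
  then have "flat_exp 0 (Suc k * (x $ i - a $ i)) * flat_exp 0 (Suc k * (b $ i - x $ i)) = 0"
    by (auto simp: flat_exp_def zero_less_mult_iff)
  then show ?thesis
    unfolding box_bump_def by (intro prod_zero) auto
qed

lemma tendsto_box_bump: "(\<lambda>k. box_bump a b k x) \<longlonglongrightarrow> indicator (box a b) x"
proof (cases "x \<in> box a b")
  case True
  have *: "(\<lambda>k. flat_exp 0 (Suc k * t)) \<longlonglongrightarrow> 1" if "t > 0" for t :: real
  proof -
    have "(\<lambda>k. exp (- ((1 / t) * inverse (real (Suc k))))) \<longlonglongrightarrow> exp (- ((1/t) * 0))"
      by (intro tendsto_intros LIMSEQ_inverse_real_of_nat)
    moreover have "flat_exp 0 (Suc k * t) = exp (- ((1 / t) * inverse (real (Suc k))))" for k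
      using that unfolding flat_exp_def by (simp add: field_simps del: of_nat_Suc)
    ultimately show ?thesis
      by simp
  qed
  have "(\<lambda>k. box_bump a b k x) \<longlonglongrightarrow> (\<Prod>i\<in>(UNIV::'a set). 1 * 1)"
    unfolding box_bump_def using True[unfolded mem_box_cart]
    by (intro tendsto_prod tendsto_mult *) auto
  with True show ?thesis
    by simp
qed (simp add: box_bump_outside)

lemma box_bump_in_test_functions:
  assumes "cbox a b \<subseteq> \<Omega>"
  shows "box_bump a b k \<in> test_functions \<Omega>"
proof -
  have "closure {x. box_bump a b k x \<noteq> 0} \<subseteq> cbox a b"
    by (intro closure_minimal) (use box_bump_outside[of _ a b k] box_subset_cbox[of a b] in auto)
  moreover from this have "compact (closure {x. box_bump a b k x \<noteq> 0})"
    using compact_cbox by (meson closed_closure compact_Int_closed compact_eq_bounded_closed bounded_subset)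
  ultimately show ?thesis
    using assms by (auto simp: test_functions_def smooth_box_bump)
qed

section \<open>The fundamental lemma of the calculus of variations\<close>

text \<open>
  The sets over which \<open>f\<close> has integral 0 form a Dynkin system; it contains the boxes, which are stable
  under intersection and generate the Borel sets.
\<close>

lemma AE_eq_0_if_integral_boxes_eq_0_lborel:
  fixes f :: "'a::euclidean_space \<Rightarrow> real"
  assumes f: "integrable lborel f"
    and box: "\<And>a b. (\<integral>x. indicator (box a b) x *\<^sub>R f x \<partial>lborel) = 0"
    and all: "(\<integral>x. f x \<partial>lborel) = 0"
  shows "AE x in lborel. f x = 0"
proof (rule density_unique_real[OF f])
  fix A :: "'a set"
  assume "A \<in> sets lborel"
  then have A: "A \<in> sigma_sets UNIV (range (\<lambda>(a, b). box a b))"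
    by (simp add: borel_eq_box)
  have "Int_stable (range (\<lambda>(a, b). box a b :: 'a set))"
    by (auto simp: Int_stable_def box_Int_box)
  moreover have "range (\<lambda>(a, b). box a b :: 'a set) \<subseteq> Pow UNIV"
    by simp
  moreover note A
  ultimately   have "A \<in> sets borel \<and> (\<integral>x. indicator A x *\<^sub>R f x \<partial>lborel) = 0"
  proof (induction rule: sigma_sets_induct_disjoint)
    case (basic A)
    with box show ?case by auto
  next
    case (compl A)
    then have "(\<integral>x. indicator (UNIV - A) x *\<^sub>R f x \<partial>lborel) =
        (\<integral>x. f x - indicator A x *\<^sub>R f x \<partial>lborel)"
      by (intro Bochner_Integration.integral_cong) (auto simp: indicator_def)
    also have "\<dots> = 0"
      using compl f all by (subst Bochner_Integration.integral_diff)
        (auto intro!: integrable_mult_indicator[of _ _ f, unfolded real_scaleR_def])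
    finally show ?case using compl by auto
  next
    case (union A)
    have "(LINT x:(\<Union>i. A i)|lborel. f x) = (\<Sum>i. (LINT x:A i|lborel. f x))"
      using union by (intro lebesgue_integral_countable_add)
        (auto simp: disjoint_family_on_def set_integrable_def intro!: integrable_mult_indicator[OF _ f, unfolded real_scaleR_def])
    moreover have "(\<Union>i. A i) \<in> sets borel"
      using union by (intro sets.countable_UN) auto
    ultimately show ?case
      using union by (simp add: set_lebesgue_integral_def)
  qed auto
  then show "(LINT x:A|lborel. f x) = (LINT x:A|lborel. 0)"
    by (simp add: set_lebesgue_integral_def)
qed auto

text \<open>
  Only boxes with closure in \<open>\<Omega>\<close> are available, so the previous lemma is applied to \<open>E\<close> cut off to
  one such box at a time, and countably many of them cover \<open>\<Omega>\<close>.  That lemma is about Borel functions,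
  so \<open>E\<close> is first replaced by a Borel measurable function that equals it almost everywhere.
\<close>

lemma AE_eq_0_if_integral_boxes_eq_0:
  fixes E :: "'a::euclidean_space \<Rightarrow> real"
  assumes "open \<Omega>" and E: "integrable (lebesgue_on \<Omega>) E"
    and box: "\<And>a b. cbox a b \<subseteq> \<Omega> \<Longrightarrow> (\<integral>x. E x * indicator (box a b) x \<partial>lebesgue_on \<Omega>) = 0"
  shows "AE x in lebesgue_on \<Omega>. E x = 0"
proof -
  have \<Omega>: "\<Omega> \<in> sets lebesgue"
    using \<open>open \<Omega>\<close> by auto
  have E0: "integrable lebesgue (\<lambda>x. indicator \<Omega> x *\<^sub>R E x)"
    using E \<Omega> by (simp add: integrable_restrict_space)
  then obtain g where g: "g \<in> borel_measurable lborel"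
     and Eg: "AE x in lborel. indicator \<Omega> x *\<^sub>R E x = g x"
    using completion_ex_borel_measurable_real by (metis borel_measurable_integrable)
  then have Eg': "AE x in lebesgue. indicator \<Omega> x *\<^sub>R E x = g x"
    by (simp add: AE_completion)
  have "integrable lebesgue g"
    by (rule integrable_cong_AE_imp[OF E0]) (use g Eg' in \<open>auto intro: measurable_completion\<close>)
  then have g_int: "integrable lborel g"
    using g integrable_completion[of g lborel] by simp
  have g_box: "(\<integral>x. indicator (box a b) x *\<^sub>R g x \<partial>lborel) = 0" if "cbox a b \<subseteq> \<Omega>" for a b
  proof -
    have "(\<integral>x. indicator (box a b) x *\<^sub>R g x \<partial>lborel) = (\<integral>x. indicator (box a b) x *\<^sub>R g x \<partial>lebesgue)"
      using g by (intro integral_completion[symmetric]) auto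
    also have "\<dots> = (\<integral>x. indicator \<Omega> x *\<^sub>R (E x * indicator (box a b) x) \<partial>lebesgue)"
    proof (rule integral_cong_AE)
      show "(\<lambda>x. indicator (box a b) x *\<^sub>R g x) \<in> borel_measurable lebesgue"
        using g by (auto intro: measurable_completion)
      have "(\<lambda>x. (indicator \<Omega> x *\<^sub>R E x) * indicator (box a b) x) \<in> borel_measurable lebesgue"
        by (intro borel_measurable_times borel_measurable_integrable[OF E0] borel_measurable_indicator) auto
      then show "(\<lambda>x. indicator \<Omega> x *\<^sub>R (E x * indicator (box a b) x)) \<in> borel_measurable lebesgue"
        by (simp add: mult.assoc)
      show "AE x in lebesgue. indicator (box a b) x *\<^sub>R g x = indicator \<Omega> x *\<^sub>R (E x * indicator (box a b) x)"
        using Eg' by eventually_elim auto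
    qed
    also have "\<dots> = 0"
      using box[OF that] \<Omega> by (simp add: integral_restrict_space)
    finally show ?thesis .
  qed
  define \<B> where "\<B> = {box a b |a b. cbox a b \<subseteq> \<Omega>}"
  have "\<Omega> = \<Union>\<B>"
  proof (intro set_eqI iffI)
    fix x assume "x \<in> \<Omega>"
    with \<open>open \<Omega>\<close> obtain a b where "x \<in> box a b" "cbox a b \<subseteq> \<Omega>"
      by (meson open_contains_cbox)
    then show "x \<in> \<Union>\<B>"
      by (auto simp: \<B>_def)
  next
    fix x assume "x \<in> \<Union>\<B>"
    then show "x \<in> \<Omega>"
      unfolding \<B>_def using box_subset_cbox by blast
  qed
  moreover obtain \<F> where \<F>: "\<F> \<subseteq> \<B>" "countable \<F>" "\<Union>\<F> = \<Union>\<B>"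
    using Lindelof[of \<B>] by (auto simp: \<B>_def)
  moreover have "AE x in lborel. \<forall>B\<in>\<F>. x \<in> B \<longrightarrow> g x = 0"
    unfolding AE_ball_countable[OF \<F>(2)]
  proof
    fix B assume "B \<in> \<F>"
    with \<F> obtain c d where B: "B = box c d" "cbox c d \<subseteq> \<Omega>"
      by (auto simp: \<B>_def)
    have "AE x in lborel. indicator B x *\<^sub>R g x = 0"
    proof (rule AE_eq_0_if_integral_boxes_eq_0_lborel)
      show "integrable lborel (\<lambda>x. indicator B x *\<^sub>R g x)"
        using g_int B by (intro integrable_mult_indicator) auto
      show "(\<integral>x. indicator B x *\<^sub>R g x \<partial>lborel) = 0"
        using g_box B by simp
      fix a b
      have *: "indicator (box a b) x *\<^sub>R indicator B x *\<^sub>R g x = indicator (box a b \<inter> B) x *\<^sub>R g x" for x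
        by (simp add: indicator_inter_arith)
      show "(\<integral>x. indicator (box a b) x *\<^sub>R indicator B x *\<^sub>R g x \<partial>lborel) = 0"
      proof (cases "box a b \<inter> B = {}")
        case False
        obtain u v where uv: "box a b \<inter> B = box u v"
          by (auto simp: B(1) box_Int_box)
        with False have "cbox u v \<subseteq> cbox c d"
          using B(1) closure_minimal[of "box u v" "cbox c d"] closure_box[of u v] box_subset_cbox[of c d]
          by auto
        with B(2) show ?thesis
          unfolding * uv by (intro g_box) auto
      qed (unfold *, simp)
    qed
    then show "AE x in lborel. x \<in> B \<longrightarrow> g x = 0"
      by eventually_elim auto
  qed
  ultimately have cover: "\<Omega> = \<Union>\<F>" and "AE x in lborel. \<forall>B\<in>\<F>. x \<in> B \<longrightarrow> g x = 0"
    by simp_all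
  with Eg have "AE x in lborel. x \<in> \<Omega> \<longrightarrow> E x = 0"
    by (elim AE_mp) (auto intro!: AE_I2 simp: indicator_def split: if_splits)
  then have "AE x in lebesgue. x \<in> \<Omega> \<longrightarrow> E x = 0"
    by (rule AE_completion)
  then show ?thesis
    using \<Omega> by (simp add: AE_restrict_space_iff)
qed

text \<open>
  The indicator of a box is the bounded pointwise limit of test functions, so dominated convergence
  reduces the claim to boxes.
\<close>

lemma fundamental_lemma_of_calculus_of_variations:
  fixes E :: "real^'d \<Rightarrow> real"
  assumes "open \<Omega>" and E: "integrable (lebesgue_on \<Omega>) E"
    and orth: "\<And>\<phi>. \<phi> \<in> test_functions \<Omega> \<Longrightarrow> (\<integral>x. E x * \<phi> x \<partial>lebesgue_on \<Omega>) = 0"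
  shows "AE x in lebesgue_on \<Omega>. E x = 0"
proof (rule AE_eq_0_if_integral_boxes_eq_0[OF \<open>open \<Omega>\<close> E])
  fix a b :: "real^'d"
  assume ab: "cbox a b \<subseteq> \<Omega>"
  have m: "f \<in> borel_measurable (lebesgue_on \<Omega>)" if "f \<in> borel_measurable borel" for f :: "real^'d \<Rightarrow> real"
    using that by (intro measurable_restrict_space1 measurable_completion) simp
  have "(\<lambda>k. \<integral>x. E x * box_bump a b k x \<partial>lebesgue_on \<Omega>)
      \<longlonglongrightarrow> (\<integral>x. E x * indicator (box a b) x \<partial>lebesgue_on \<Omega>)"
  proof (rule integral_dominated_convergence[where w = "\<lambda>x. \<bar>E x\<bar>"])
    show "(\<lambda>x. E x * indicator (box a b) x) \<in> borel_measurable (lebesgue_on \<Omega>)"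
      by (intro borel_measurable_times m borel_measurable_integrable[OF E]) auto
    show "(\<lambda>x. E x * box_bump a b k x) \<in> borel_measurable (lebesgue_on \<Omega>)" for k
      by (intro borel_measurable_times m borel_measurable_continuous_onI
          smooth_continuous smooth_box_bump borel_measurable_integrable[OF E])
    show "AE x in lebesgue_on \<Omega>. norm (E x * box_bump a b k x) \<le> \<bar>E x\<bar>" for k
      using box_bump_nonneg[of a b k] box_bump_le_1[of a b k]
      by (auto simp: abs_mult intro!: mult_left_le)
    show "AE x in lebesgue_on \<Omega>. (\<lambda>k. E x * box_bump a b k x) \<longlonglongrightarrow> E x * indicator (box a b) x"
      by (intro AE_I2 tendsto_intros tendsto_box_bump)
  qed (use E in auto)
  then show "(\<integral>x. E x * indicator (box a b) x \<partial>lebesgue_on \<Omega>) = 0"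
    using orth[OF box_bump_in_test_functions[OF ab]] by (simp add: LIMSEQ_const_iff)
qed

section \<open>Integrals of partial derivatives\<close>

lemma vanishes_outside_imp_partial_deriv_eq_0:
  fixes f :: "real^'d \<Rightarrow> real"
  assumes "closed K" "\<And>x. x \<notin> K \<Longrightarrow> f x = 0" "x \<notin> K"
  shows "partial_deriv i f x = 0"
proof -
  have "(f has_derivative (\<lambda>h. 0)) (at x)"
    by (rule has_derivative_transform_within_open[of "\<lambda>_. 0" _ _ _ "- K"])
      (use assms in auto)
  from partial_deriv_eq[OF this] show ?thesis
    by simp
qed

lemma integrable_continuous_compact_support:
  fixes f :: "'a::euclidean_space \<Rightarrow> real"
  assumes "continuous_on UNIV f" "compact K" "\<And>x. x \<notin> K \<Longrightarrow> f x = 0"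
  shows "integrable lborel f"
proof -
  have "integrable lborel (\<lambda>x. indicator K x *\<^sub>R f x)"
    using assms by (intro borel_integrable_compact) (auto intro: continuous_on_subset)
  also have "(\<lambda>x. indicator K x *\<^sub>R f x) = f"
    using assms(3) by (auto simp: indicator_def fun_eq_iff)
  finally show ?thesis .
qed

lemma DERIV_along_axis:
  fixes f :: "real^'d \<Rightarrow> real"
  assumes "f differentiable (at (x + t *\<^sub>R axis i 1))"
  shows "((\<lambda>t. f (x + t *\<^sub>R axis i 1)) has_real_derivative partial_deriv i f (x + t *\<^sub>R axis i 1)) (at t)"
proof -
  let ?D = "frechet_derivative f (at (x + t *\<^sub>R axis i 1))"
  have D: "(f has_derivative ?D) (at (x + t *\<^sub>R axis i 1))"
    using assms by (rule frechet_derivative_works[THEN iffD1])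
  have "((\<lambda>t. x + t *\<^sub>R axis i 1) has_derivative (\<lambda>h. h *\<^sub>R axis i 1)) (at t)"
    by (auto intro!: derivative_eq_intros)
  from has_derivative_compose[OF this D]
  show ?thesis
    unfolding has_field_derivative_def
    by (rule has_derivative_eq_rhs)
      (simp add: fun_eq_iff partial_deriv_def linear_scale[OF has_derivative_linear[OF D]])
qed

text \<open>
  The integrals of the difference quotients vanish because Lebesgue measure is invariant under
  translations, and the quotients converge to the derivative dominated by a multiple of the indicator
  of a ball.  This avoids an iterated integral over the coordinates.
\<close>

lemma integral_partial_deriv_eq_0:
  fixes f :: "real^'d \<Rightarrow> real"
  assumes f: "C_k (Suc 0) f" and K: "compact K" "\<And>x. x \<notin> K \<Longrightarrow> f x = 0"
  shows "(\<integral>x. partial_deriv i f x \<partial>lborel) = 0"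
proof -
  let ?e = "axis i 1 :: real^'d"
  let ?h = "\<lambda>n. inverse (real (Suc n))"
  let ?s = "\<lambda>n x. (f (x + ?h n *\<^sub>R ?e) - f x) / ?h n"
  have diff: "f differentiable (at x)" for x
    using f by simp
  have cont: "continuous_on UNIV f" and pcont: "continuous_on UNIV (partial_deriv i f)"
    using f C_k_Suc_imp_C_k[OF f] by simp_all
  have p0: "partial_deriv i f x = 0" if "x \<notin> K" for x
    using vanishes_outside_imp_partial_deriv_eq_0[OF compact_imp_closed[OF K(1)] K(2) that] by simp
  obtain B where B: "\<And>x. \<bar>partial_deriv i f x\<bar> \<le> B"
  proof -
    have "bounded (partial_deriv i f ` K)"
      using compact_continuous_image[OF continuous_on_subset[OF pcont] K(1)] by (auto intro: compact_imp_bounded)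
    then obtain B where B: "\<And>x. x \<in> K \<Longrightarrow> \<bar>partial_deriv i f x\<bar> \<le> B"
      by (auto simp: bounded_iff)
    have "\<bar>partial_deriv i f x\<bar> \<le> \<bar>B\<bar>" for x
      using B[of x] p0[of x] by (cases "x \<in> K") auto
    then show thesis ..
  qed
  obtain R where R: "K \<subseteq> cball 0 R"
    using compact_imp_bounded[OF K(1)] unfolding bounded_iff by (metis mem_cball_0 subsetI)
  have f_int: "integrable lborel f"
    using integrable_continuous_compact_support[OF cont K] .
  have shift: "integrable lborel (\<lambda>x. f (x + c))" "(\<integral>x. f (x + c) \<partial>lborel) = (\<integral>x. f x \<partial>lborel)" for c
  proof -
    have "(\<lambda>x. x + c) = (+) c"
      by (simp add: fun_eq_iff)
    then have distr: "distr lborel borel (\<lambda>x. x + c) = lborel"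
      using lborel_distr_plus[of c] by (simp only:)
    have fm: "f \<in> borel_measurable borel" and sm: "(\<lambda>x. x + c) \<in> lborel \<rightarrow>\<^sub>M borel"
      using f_int by auto
    show "integrable lborel (\<lambda>x. f (x + c))"
      using f_int integrable_distr_eq[OF sm fm] unfolding distr by blast
    show "(\<integral>x. f (x + c) \<partial>lborel) = (\<integral>x. f x \<partial>lborel)"
      using integral_distr[OF sm fm] unfolding distr by simp
  qed
  have "(\<lambda>n. \<integral>x. ?s n x \<partial>lborel) \<longlonglongrightarrow> (\<integral>x. partial_deriv i f x \<partial>lborel)"
  proof (rule integral_dominated_convergence[where w = "\<lambda>x. indicator (cball 0 (R + 1)) x *\<^sub>R B"])
    show "partial_deriv i f \<in> borel_measurable lborel"
      using pcont by (simp add: borel_measurable_continuous_onI)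
    have "f \<in> borel_measurable borel"
      using cont by (rule borel_measurable_continuous_onI)
    then show "?s n \<in> borel_measurable lborel" for n
      by measurable
    show "integrable lborel (\<lambda>x::real^'d. indicator (cball 0 (R + 1)) x *\<^sub>R B)"
      by (intro borel_integrable_compact) auto
    show "AE x in lborel. norm (?s n x) \<le> indicator (cball 0 (R + 1)) x *\<^sub>R B" for n
    proof (intro AE_I2)
      fix x
      have h: "0 < ?h n" "?h n \<le> 1" by (auto simp: field_simps)
      show "norm (?s n x) \<le> indicator (cball 0 (R + 1)) x *\<^sub>R B"
      proof (cases "x \<in> cball 0 (R + 1)")
        case True
        have "\<exists>z. 0 < z \<and> z < ?h n \<and> f (x + ?h n *\<^sub>R ?e) - f (x + 0 *\<^sub>R ?e) =
            (?h n - 0) * partial_deriv i f (x + z *\<^sub>R ?e)"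
          using h by (intro MVT2 DERIV_along_axis diff) auto
        then obtain z where "f (x + ?h n *\<^sub>R ?e) - f x = ?h n * partial_deriv i f (x + z *\<^sub>R ?e)"
          by auto
        with h have "?s n x = partial_deriv i f (x + z *\<^sub>R ?e)"
          by simp
        with B True show ?thesis by simp
      next
        case False
        have "norm x \<le> norm (x + ?h n *\<^sub>R ?e) + norm (?h n *\<^sub>R ?e)"
          by (metis add_diff_cancel_right' norm_triangle_ineq4)
        with False h have "x \<notin> cball 0 R" "x + ?h n *\<^sub>R ?e \<notin> cball 0 R"
          by (auto simp: norm_axis_1)
        with R K have "f x = 0" "f (x + ?h n *\<^sub>R ?e) = 0"
          by blast+
        then show ?thesis
          using B[of x] by (simp add: indicator_def)
      qed
    qed
    show "AE x in lborel. (\<lambda>n. ?s n x) \<longlonglongrightarrow> partial_deriv i f x"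
    proof (intro AE_I2)
      fix x
      have "(\<lambda>t. (f (x + t *\<^sub>R ?e) - f (x + 0 *\<^sub>R ?e)) / (t - 0)) \<midarrow>0\<rightarrow> partial_deriv i f (x + 0 *\<^sub>R ?e)"
        using DERIV_along_axis[OF diff, where x = x and t = 0 and i = i] unfolding has_field_derivative_iff .
      moreover have "filterlim ?h (at 0) sequentially"
        using LIMSEQ_inverse_real_of_nat by (auto simp: filterlim_at)
      ultimately have "(\<lambda>n. (f (x + ?h n *\<^sub>R ?e) - f (x + 0 *\<^sub>R ?e)) / (?h n - 0)) \<longlonglongrightarrow>
          partial_deriv i f (x + 0 *\<^sub>R ?e)"
        by (rule filterlim_compose)
      then show "(\<lambda>n. ?s n x) \<longlonglongrightarrow> partial_deriv i f x"
        by (simp only: diff_zero scaleR_zero_left add_0_right)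
    qed
  qed
  moreover have "(\<integral>x. ?s n x \<partial>lborel) = 0" for n
  proof -
    have "(\<integral>x. f (x + ?h n *\<^sub>R ?e) - f x \<partial>lborel) = 0"
      using shift[of "?h n *\<^sub>R ?e"] f_int by (subst Bochner_Integration.integral_diff) auto
    then show ?thesis
      by (simp only: integral_divide_zero div_0)
  qed
  ultimately show ?thesis
    by (simp add: LIMSEQ_const_iff)
qed

section \<open>Square integrable functions\<close>

lemma L2_measurable: "f \<in> L2 M \<Longrightarrow> f \<in> borel_measurable M"
  and L2_integrable_norm: "f \<in> L2 M \<Longrightarrow> integrable M (\<lambda>x. (norm (f x))\<^sup>2)"
  by (simp_all add: L2_def)

lemma L2_inner_integrable:
  assumes "f \<in> L2 M" "g \<in> L2 M"
  shows "integrable M (\<lambda>x. f x \<bullet> g x)"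
proof (rule Bochner_Integration.integrable_bound)
  show "integrable M (\<lambda>x. (norm (f x))\<^sup>2 + (norm (g x))\<^sup>2)"
    using assms by (intro Bochner_Integration.integrable_add L2_integrable_norm)
  have "\<bar>a \<bullet> b\<bar> \<le> (norm a)\<^sup>2 + (norm b)\<^sup>2" for a b :: 'b
  proof -
    have "\<bar>a \<bullet> b\<bar> \<le> norm a * norm b"
      by (rule Cauchy_Schwarz_ineq2)
    also have "\<dots> \<le> (norm a)\<^sup>2 + (norm b)\<^sup>2"
      using sum_squares_bound[of "norm a" "norm b"] mult_nonneg_nonneg[OF norm_ge_zero[of a] norm_ge_zero[of b]]
      by linarith
    finally show ?thesis .
  qed
  then show "AE x in M. norm (f x \<bullet> g x) \<le> norm ((norm (f x))\<^sup>2 + (norm (g x))\<^sup>2)"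
    by (intro AE_I2) simp
qed (use assms in \<open>auto intro: borel_measurable_inner L2_measurable\<close>)

lemma L2_mult_integrable:
  fixes f g :: "'a \<Rightarrow> real"
  shows "f \<in> L2 M \<Longrightarrow> g \<in> L2 M \<Longrightarrow> integrable M (\<lambda>x. f x * g x)"
  using L2_inner_integrable[of f M g] by simp

lemma L2_diff:
  assumes "f \<in> L2 M" "g \<in> L2 M"
  shows "(\<lambda>x. f x - g x) \<in> L2 M"
proof -
  have "integrable M (\<lambda>x. (norm (f x))\<^sup>2 - 2 * (f x \<bullet> g x) + (norm (g x))\<^sup>2)"
    by (intro Bochner_Integration.integrable_add Bochner_Integration.integrable_diff integrable_mult_right
        L2_integrable_norm L2_inner_integrable assms)
  also have "(\<lambda>x. (norm (f x))\<^sup>2 - 2 * (f x \<bullet> g x) + (norm (g x))\<^sup>2) = (\<lambda>x. (norm (f x - g x))\<^sup>2)"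
    unfolding power2_norm_eq_inner by (simp add: fun_eq_iff inner_diff inner_commute)
  finally show ?thesis
    using assms by (auto simp: L2_def intro: borel_measurable_diff)
qed

lemma L2_scaleR: "f \<in> L2 M \<Longrightarrow> (\<lambda>x. c *\<^sub>R f x) \<in> L2 M"
  by (auto simp: L2_def power_mult_distrib intro: borel_measurable_scaleR)

lemma L2_component:
  fixes f :: "'a \<Rightarrow> real^'d"
  assumes "f \<in> L2 M"
  shows "(\<lambda>x. f x $ i) \<in> L2 M"
proof -
  have m: "(\<lambda>x. f x $ i) \<in> borel_measurable M"
    using borel_measurable_inner[OF L2_measurable[OF assms] borel_measurable_const[of "axis i 1"]]
    by (simp add: inner_axis)
  moreover have "integrable M (\<lambda>x. (norm (f x $ i))\<^sup>2)"
  proof (rule Bochner_Integration.integrable_bound[OF L2_integrable_norm[OF assms]])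
    have "(norm (f x $ i))\<^sup>2 \<le> (norm (f x))\<^sup>2" for x
      by (intro power_mono Finite_Cartesian_Product.norm_nth_le norm_ge_zero)
    then show "AE x in M. norm ((norm (f x $ i))\<^sup>2) \<le> norm ((norm (f x))\<^sup>2)"
      by simp
  qed (use m in auto)
  ultimately show ?thesis
    by (simp add: L2_def)
qed

lemma L2_sum:
  fixes f :: "'i \<Rightarrow> 'a \<Rightarrow> real"
  assumes "finite A" "\<And>i. i \<in> A \<Longrightarrow> f i \<in> L2 M"
  shows "(\<lambda>x. \<Sum>i\<in>A. f i x) \<in> L2 M"
  using assms
proof (induction A)
  case (insert a A)
  then have "(\<lambda>x. f a x - (-1) *\<^sub>R (\<Sum>i\<in>A. f i x)) \<in> L2 M"
    by (intro L2_diff L2_scaleR) auto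
  with insert show ?case by simp
qed (simp add: L2_def)

lemma (in finite_measure) L2_imp_integrable:
  fixes f :: "'a \<Rightarrow> real"
  assumes "f \<in> L2 M" shows "integrable M f"
  using L2_mult_integrable[OF assms, of "\<lambda>_. 1"] by (simp add: L2_def)

lemma L2_norm_nonneg: "0 \<le> L2_norm M f"
  by (simp add: L2_norm_def L2_inner_def integral_nonneg_AE)

lemma L2_norm_power2: "(L2_norm M f)\<^sup>2 = (\<integral>x. (norm (f x))\<^sup>2 \<partial>M)"
  unfolding power2_norm_eq_inner by (simp add: L2_norm_def L2_inner_def integral_nonneg_AE)

lemma L2_norm_cong_AE:
  assumes "f \<in> borel_measurable M" "g \<in> borel_measurable M" "AE x in M. f x = g x"
  shows "L2_norm M f = L2_norm M g"
  unfolding L2_norm_def L2_inner_def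
  by (intro arg_cong[of _ _ sqrt] integral_cong_AE borel_measurable_inner) (use assms in auto)

lemma L2_inner_diff_left:
  assumes "f \<in> L2 M" "g \<in> L2 M" "h \<in> L2 M"
  shows "L2_inner M (\<lambda>x. f x - g x) h = L2_inner M f h - L2_inner M g h"
  using assms by (simp add: L2_inner_def inner_diff_left L2_inner_integrable)

lemma L2_inner_commute: "L2_inner M f g = L2_inner M g f"
  by (simp add: L2_inner_def inner_commute)

lemma L2_norm_diff_power2:
  assumes "f \<in> L2 M" "g \<in> L2 M"
  shows "(L2_norm M (\<lambda>x. f x - g x))\<^sup>2 = (L2_norm M f)\<^sup>2 - 2 * L2_inner M f g + (L2_norm M g)\<^sup>2"
proof -
  have "(L2_norm M (\<lambda>x. f x - g x))\<^sup>2 = (\<integral>x. (norm (f x))\<^sup>2 - 2 * (f x \<bullet> g x) + (norm (g x))\<^sup>2 \<partial>M)"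
    unfolding L2_norm_power2 by (intro Bochner_Integration.integral_cong refl)
      (unfold power2_norm_eq_inner, simp add: inner_diff inner_commute)
  then show ?thesis
    unfolding L2_norm_power2 L2_inner_def
    using L2_integrable_norm[OF assms(1)] L2_integrable_norm[OF assms(2)] L2_inner_integrable[OF assms]
    by simp
qed

lemma L2_Cauchy_Schwarz:
  assumes "f \<in> L2 M" "g \<in> L2 M"
  shows "\<bar>L2_inner M f g\<bar> \<le> L2_norm M f * L2_norm M g"
proof (rule power2_le_imp_le)
  let ?f = "\<lambda>x. ennreal (norm (f x))" and ?g = "\<lambda>x. ennreal (norm (g x))"
  have sq: "(\<integral>\<^sup>+x. (ennreal (norm (h x)))\<^sup>2 \<partial>M) = ennreal ((L2_norm M h)\<^sup>2)" if "h \<in> L2 M" for h :: "'a \<Rightarrow> 'b"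
    using L2_integrable_norm[OF that] unfolding L2_norm_power2
    by (subst nn_integral_eq_integral[symmetric]) (auto simp: ennreal_power)
  have "ennreal \<bar>L2_inner M f g\<bar> \<le> (\<integral>\<^sup>+x. norm (f x \<bullet> g x) \<partial>M)"
    using integral_norm_bound_ennreal[OF L2_inner_integrable[OF assms]] by (simp add: L2_inner_def)
  also have "\<dots> \<le> (\<integral>\<^sup>+x. ?f x * ?g x \<partial>M)"
    by (intro nn_integral_mono) (simp add: Cauchy_Schwarz_ineq2 flip: ennreal_mult)
  finally have "(ennreal \<bar>L2_inner M f g\<bar>)\<^sup>2 \<le> (\<integral>\<^sup>+x. ?f x * ?g x \<partial>M)\<^sup>2"
    by (intro power_mono) auto
  also have "\<dots> \<le> (\<integral>\<^sup>+x. (?f x)\<^sup>2 \<partial>M) * (\<integral>\<^sup>+x. (?g x)\<^sup>2 \<partial>M)"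
    using assms by (intro Cauchy_Schwarz_nn_integral) (auto dest: L2_measurable)
  also have "\<dots> = ennreal ((L2_norm M f)\<^sup>2 * (L2_norm M g)\<^sup>2)"
    by (simp add: sq assms ennreal_mult)
  finally show "\<bar>L2_inner M f g\<bar>\<^sup>2 \<le> (L2_norm M f * L2_norm M g)\<^sup>2"
    by (simp add: ennreal_power power_mult_distrib)
qed (simp add: L2_norm_nonneg)

lemma L2_norm_triangle_diff:
  assumes "f \<in> L2 M" "g \<in> L2 M"
  shows "L2_norm M (\<lambda>x. f x - g x) \<le> L2_norm M f + L2_norm M g"
proof (rule power2_le_imp_le)
  show "(L2_norm M (\<lambda>x. f x - g x))\<^sup>2 \<le> (L2_norm M f + L2_norm M g)\<^sup>2"
    using L2_Cauchy_Schwarz[OF assms] unfolding L2_norm_diff_power2[OF assms]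
    by (simp add: power2_sum abs_le_iff)
qed (simp add: L2_norm_nonneg)

lemma tendsto_L2_inner:
  assumes lim: "(\<lambda>k. L2_norm M (\<lambda>x. u x - \<phi> k x)) \<longlonglongrightarrow> 0"
    and "u \<in> L2 M" "\<And>k. \<phi> k \<in> L2 M" "w \<in> L2 M"
  shows "(\<lambda>k. L2_inner M (\<phi> k) w) \<longlonglongrightarrow> L2_inner M u w"
proof -
  have "(\<lambda>k. L2_inner M u w - L2_inner M (\<phi> k) w) \<longlonglongrightarrow> 0"
  proof (rule Lim_null_comparison)
    show "\<forall>\<^sub>F k in sequentially. norm (L2_inner M u w - L2_inner M (\<phi> k) w)
        \<le> L2_norm M (\<lambda>x. u x - \<phi> k x) * L2_norm M w"
      using L2_Cauchy_Schwarz[OF L2_diff, of u M _ w] assms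
      by (auto simp: L2_inner_diff_left)
    show "(\<lambda>k. L2_norm M (\<lambda>x. u x - \<phi> k x) * L2_norm M w) \<longlonglongrightarrow> 0"
      using tendsto_mult_right[OF lim] by simp
  qed
  then have "(\<lambda>k. L2_inner M u w - (L2_inner M u w - L2_inner M (\<phi> k) w)) \<longlonglongrightarrow> L2_inner M u w - 0"
    by (intro tendsto_intros)
  then show ?thesis by simp
qed

section \<open>Weak gradients and the space of functions vanishing on the boundary\<close>

definition grad :: "(real^'d \<Rightarrow> real) \<Rightarrow> real^'d \<Rightarrow> real^'d" where
  "grad f x = (\<chi> i. partial_deriv i f x)"

lemma integrable_lborel_imp_lebesgue_on:
  fixes f :: "'a::euclidean_space \<Rightarrow> 'b::euclidean_space"
  assumes "integrable lborel f" "\<Omega> \<in> sets lebesgue"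
  shows "integrable (lebesgue_on \<Omega>) f"
proof -
  have "integrable lebesgue f"
    using assms(1) by (simp add: integrable_completion)
  then show ?thesis
    using assms(2) by (auto simp: integrable_restrict_space intro: integrable_mult_indicator)
qed

lemma integral_lebesgue_on_eq_lborel:
  fixes f :: "'a::euclidean_space \<Rightarrow> 'b::euclidean_space"
  assumes "f \<in> borel_measurable borel" "\<Omega> \<in> sets lebesgue" "\<And>x. x \<notin> \<Omega> \<Longrightarrow> f x = 0"
  shows "(\<integral>x. f x \<partial>lebesgue_on \<Omega>) = (\<integral>x. f x \<partial>lborel)"
proof -
  have "(\<integral>x. f x \<partial>lebesgue_on \<Omega>) = (\<integral>x. f x \<partial>lebesgue)"
    using assms by (auto simp: integral_restrict_space indicator_def intro!: Bochner_Integration.integral_cong)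
  with assms(1) show ?thesis
    by (simp add: integral_completion)
qed

lemma test_functionD:
  assumes "\<phi> \<in> test_functions \<Omega>"
  shows "smooth \<phi>" "compact (closure {x. \<phi> x \<noteq> 0})" "closure {x. \<phi> x \<noteq> 0} \<subseteq> \<Omega>"
    "x \<notin> closure {x. \<phi> x \<noteq> 0} \<Longrightarrow> \<phi> x = 0"
    "x \<notin> closure {x. \<phi> x \<noteq> 0} \<Longrightarrow> partial_deriv i \<phi> x = 0"
proof -
  show *: "smooth \<phi>" "compact (closure {x. \<phi> x \<noteq> 0})" "closure {x. \<phi> x \<noteq> 0} \<subseteq> \<Omega>"
    using assms by (auto simp: test_functions_def)
  show **: "\<phi> x = 0" if "x \<notin> closure {x. \<phi> x \<noteq> 0}" for x
    using that closure_subset[of "{x. \<phi> x \<noteq> 0}"] by auto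
  show "partial_deriv i \<phi> x = 0" if "x \<notin> closure {x. \<phi> x \<noteq> 0}"
    by (rule vanishes_outside_imp_partial_deriv_eq_0[OF closed_closure ** that])
qed

lemma continuous_compact_support_L2:
  fixes f :: "'a::euclidean_space \<Rightarrow> real"
  assumes "continuous_on UNIV f" "compact K" "\<And>x. x \<notin> K \<Longrightarrow> f x = 0" "\<Omega> \<in> sets lebesgue"
  shows "f \<in> L2 (lebesgue_on \<Omega>)"
proof -
  have "integrable lborel f" "integrable lborel (\<lambda>x. (norm (f x))\<^sup>2)"
    using assms by (auto intro!: integrable_continuous_compact_support[of _ K] continuous_intros)
  from this[THEN integrable_lborel_imp_lebesgue_on, OF assms(4)] show ?thesis
    by (simp add: L2_def)
qed

lemma test_function_L2:
  assumes "\<phi> \<in> test_functions \<Omega>" "S \<in> sets lebesgue"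
  shows "\<phi> \<in> L2 (lebesgue_on S)" "partial_deriv i \<phi> \<in> L2 (lebesgue_on S)"
proof -
  note \<phi> = test_functionD[OF assms(1)]
  show "\<phi> \<in> L2 (lebesgue_on S)"
    by (rule continuous_compact_support_L2[OF smooth_continuous[OF \<phi>(1)] \<phi>(2) \<phi>(4) assms(2)])
  show "partial_deriv i \<phi> \<in> L2 (lebesgue_on S)"
    by (rule continuous_compact_support_L2[OF smooth_continuous[OF smooth_partial_deriv[OF \<phi>(1)]]
        \<phi>(2) \<phi>(5) assms(2)])
qed

lemma L2_vec:
  fixes f :: "'a \<Rightarrow> real^'d"
  assumes "\<And>i. (\<lambda>x. f x $ i) \<in> L2 M"
  shows "f \<in> L2 M"
proof -
  have "f \<in> borel_measurable M"
    by (rule borel_measurable_euclidean_space[THEN iffD2])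
      (auto simp: Basis_vec_def inner_axis L2_measurable[OF assms])
  moreover have "integrable M (\<lambda>x. \<Sum>i\<in>UNIV. (norm (f x $ i))\<^sup>2)"
    by (intro Bochner_Integration.integrable_sum L2_integrable_norm assms)
  ultimately show ?thesis
    by (simp add: L2_def norm_vec_def L2_set_def sum_nonneg)
qed

lemma test_function_grad_L2:
  assumes "\<phi> \<in> test_functions \<Omega>" "S \<in> sets lebesgue"
  shows "grad \<phi> \<in> L2 (lebesgue_on S)"
  by (rule L2_vec) (use test_function_L2[OF assms] in \<open>simp add: grad_def\<close>)

lemma test_function_integration_by_parts:
  assumes "\<phi> \<in> test_functions \<Omega>" "\<psi> \<in> test_functions \<Omega>" "\<Omega> \<in> sets lebesgue"
  shows "(\<integral>x. \<phi> x * partial_deriv i \<psi> x \<partial>lebesgue_on \<Omega>) = - (\<integral>x. partial_deriv i \<phi> x * \<psi> x \<partial>lebesgue_on \<Omega>)"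
proof -
  note \<phi> = test_functionD[OF assms(1)] and \<psi> = test_functionD[OF assms(2)]
  let ?p = "\<lambda>x. \<phi> x * \<psi> x"
  have "smooth ?p"
    by (intro smooth_mult \<phi> \<psi>)
  then have "C_k (Suc 0) ?p"
    unfolding smooth_def by (rule spec)
  moreover have "?p x = 0" if "x \<notin> closure {x. \<phi> x \<noteq> 0}" for x
    using \<phi>(4)[OF that] by simp
  ultimately have "(\<integral>x. partial_deriv i ?p x \<partial>lborel) = 0"
    by (rule integral_partial_deriv_eq_0[OF _ \<phi>(2)])
  moreover have deriv: "partial_deriv i ?p x = \<phi> x * partial_deriv i \<psi> x + partial_deriv i \<phi> x * \<psi> x" for x
    using \<phi>(1) \<psi>(1) by (intro partial_deriv_mult smooth_differentiable)
  moreover have "(\<integral>x. partial_deriv i ?p x \<partial>lebesgue_on \<Omega>) = (\<integral>x. partial_deriv i ?p x \<partial>lborel)"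
  proof (rule integral_lebesgue_on_eq_lborel)
    show "partial_deriv i ?p \<in> borel_measurable borel"
      by (intro borel_measurable_continuous_onI smooth_continuous smooth_partial_deriv \<open>smooth ?p\<close>)
    show "partial_deriv i ?p x = 0" if "x \<notin> \<Omega>" for x
    proof -
      have "x \<notin> closure {x. \<phi> x \<noteq> 0}"
        using that \<phi>(3) by auto
      from \<phi>(4)[OF this] \<phi>(5)[OF this] show ?thesis
        by (simp add: deriv)
    qed
  qed fact
  moreover have "integrable (lebesgue_on \<Omega>) (\<lambda>x. \<phi> x * partial_deriv i \<psi> x)"
      "integrable (lebesgue_on \<Omega>) (\<lambda>x. partial_deriv i \<phi> x * \<psi> x)"
    using assms by (auto intro!: L2_mult_integrable test_function_L2)
  ultimately show ?thesis
    by simp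
qed

text \<open>
  The \<open>H1_norm\<close> distance to a test function is defined with some representative of the weak gradient
  of the difference; with this lemma and uniqueness it is expressed by the classical gradient.
\<close>

lemma test_function_has_weak_gradient:
  assumes "\<phi> \<in> test_functions \<Omega>" "\<Omega> \<in> sets lebesgue"
  shows "has_weak_gradient \<Omega> \<phi> (grad \<phi>)"
  unfolding has_weak_gradient_def
  using test_function_L2[OF assms] test_function_grad_L2[OF assms]
    test_function_integration_by_parts[OF assms(1) _ assms(2)]
  by (simp add: grad_def)

lemma has_weak_gradient_diff:
  assumes "has_weak_gradient \<Omega> u G" "has_weak_gradient \<Omega> v H" "\<Omega> \<in> sets lebesgue"
  shows "has_weak_gradient \<Omega> (\<lambda>x. u x - v x) (\<lambda>x. G x - H x)"
  unfolding has_weak_gradient_def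
proof (intro conjI ballI allI)
  note u = assms(1)[unfolded has_weak_gradient_def] and v = assms(2)[unfolded has_weak_gradient_def]
  show "(\<lambda>x. u x - v x) \<in> L2 (lebesgue_on \<Omega>)" "(\<lambda>x. G x - H x) \<in> L2 (lebesgue_on \<Omega>)"
    using u v by (auto intro: L2_diff)
  fix \<phi> i assume \<phi>: "\<phi> \<in> test_functions \<Omega>"
  have "integrable (lebesgue_on \<Omega>) (\<lambda>x. w x * partial_deriv i \<phi> x)"
      "integrable (lebesgue_on \<Omega>) (\<lambda>x. w x * \<phi> x)" if "w \<in> L2 (lebesgue_on \<Omega>)" for w
    using that \<phi> assms(3) by (auto intro!: L2_mult_integrable test_function_L2)
  with u v \<phi> show "(\<integral>x. (u x - v x) * partial_deriv i \<phi> x \<partial>lebesgue_on \<Omega>) =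
      - (\<integral>x. (G x - H x) $ i * \<phi> x \<partial>lebesgue_on \<Omega>)"
    by (simp add: left_diff_distrib L2_component)
qed

text \<open>
  Each component of the difference of two weak gradients is orthogonal to all test functions, and it
  is integrable because \<open>\<Omega>\<close> has finite measure.
\<close>

lemma has_weak_gradient_unique:
  fixes \<Omega> :: "(real^'d) set"
  assumes "open \<Omega>" "bounded \<Omega>" "has_weak_gradient \<Omega> u G" "has_weak_gradient \<Omega> u H"
  shows "AE x in lebesgue_on \<Omega>. G x = H x"
proof -
  interpret finite_measure "lebesgue_on \<Omega>"
    using assms(1,2) by (intro finite_measure_lebesgue_on lmeasurable_open)
  have \<Omega>: "\<Omega> \<in> sets lebesgue"
    using assms(1) by auto
  note D = has_weak_gradient_diff[OF assms(3,4) \<Omega>, unfolded has_weak_gradient_def]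
  have "AE x in lebesgue_on \<Omega>. (G x - H x) $ i = 0" for i
  proof (rule fundamental_lemma_of_calculus_of_variations[OF assms(1)])
    show "integrable (lebesgue_on \<Omega>) (\<lambda>x. (G x - H x) $ i)"
      using D by (intro L2_imp_integrable L2_component) auto
    show "(\<integral>x. (G x - H x) $ i * \<phi> x \<partial>lebesgue_on \<Omega>) = 0" if "\<phi> \<in> test_functions \<Omega>" for \<phi>
      using D that by auto
  qed
  then have "AE x in lebesgue_on \<Omega>. \<forall>i. (G x - H x) $ i = 0"
    by (simp add: AE_all_countable)
  then show ?thesis
    by eventually_elim (simp add: vec_eq_iff)
qed

lemma weak_gradient: "u \<in> H1 \<Omega> \<Longrightarrow> has_weak_gradient \<Omega> u (weak_gradient \<Omega> u)"
  unfolding H1_def weak_gradient_def by (simp add: someI_ex)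

lemma weak_gradient_eq:
  assumes "open \<Omega>" "bounded \<Omega>" "has_weak_gradient \<Omega> u G"
  shows "AE x in lebesgue_on \<Omega>. weak_gradient \<Omega> u x = G x"
  using assms by (intro has_weak_gradient_unique[OF assms(1,2) weak_gradient]) (auto simp: H1_def)

lemma H1_L2: "u \<in> H1 \<Omega> \<Longrightarrow> u \<in> L2 (lebesgue_on \<Omega>)"
  and weak_gradient_L2: "u \<in> H1 \<Omega> \<Longrightarrow> weak_gradient \<Omega> u \<in> L2 (lebesgue_on \<Omega>)"
  using weak_gradient[of u \<Omega>] by (auto simp: has_weak_gradient_def)

lemma H1_diff:
  assumes "u \<in> H1 \<Omega>" "v \<in> H1 \<Omega>" "\<Omega> \<in> sets lebesgue"
  shows "(\<lambda>x. u x - v x) \<in> H1 \<Omega>"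
  using has_weak_gradient_diff[OF weak_gradient weak_gradient assms(3)] assms(1,2)
  unfolding H1_def by blast

lemma weak_gradient_diff:
  assumes "open \<Omega>" "bounded \<Omega>" "u \<in> H1 \<Omega>" "v \<in> H1 \<Omega>"
  shows "AE x in lebesgue_on \<Omega>. weak_gradient \<Omega> (\<lambda>x. u x - v x) x = weak_gradient \<Omega> u x - weak_gradient \<Omega> v x"
  using assms by (intro weak_gradient_eq has_weak_gradient_diff weak_gradient) auto

lemma H1_norm_diff_test_function:
  assumes "open \<Omega>" "bounded \<Omega>" "u \<in> H1 \<Omega>" "\<phi> \<in> test_functions \<Omega>"
  shows "(H1_norm \<Omega> (\<lambda>x. u x - \<phi> x))\<^sup>2 = (L2_norm (lebesgue_on \<Omega>) (\<lambda>x. u x - \<phi> x))\<^sup>2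
      + (L2_norm (lebesgue_on \<Omega>) (\<lambda>x. weak_gradient \<Omega> u x - grad \<phi> x))\<^sup>2"
proof -
  have D: "has_weak_gradient \<Omega> (\<lambda>x. u x - \<phi> x) (\<lambda>x. weak_gradient \<Omega> u x - grad \<phi> x)"
    using assms by (intro has_weak_gradient_diff weak_gradient test_function_has_weak_gradient) auto
  then have "(\<lambda>x. u x - \<phi> x) \<in> H1 \<Omega>"
    by (auto simp: H1_def)
  from weak_gradient[OF this] have "weak_gradient \<Omega> (\<lambda>x. u x - \<phi> x) \<in> L2 (lebesgue_on \<Omega>)"
    by (simp add: has_weak_gradient_def)
  with D have "L2_norm (lebesgue_on \<Omega>) (weak_gradient \<Omega> (\<lambda>x. u x - \<phi> x))
     = L2_norm (lebesgue_on \<Omega>) (\<lambda>x. weak_gradient \<Omega> u x - grad \<phi> x)"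
    by (intro L2_norm_cong_AE weak_gradient_eq[OF assms(1,2)]) (auto simp: has_weak_gradient_def dest: L2_measurable)
  then show ?thesis
    by (simp add: H1_norm_def)
qed

text \<open>
  The form in which membership in \<open>H10\<close> is used and proved: convergence of the functions and of the
  gradients separately, with classical gradients of the approximating test functions.
\<close>

lemma H10_iff:
  assumes "open \<Omega>" "bounded \<Omega>"
  shows "u \<in> H10 \<Omega> \<longleftrightarrow> u \<in> H1 \<Omega> \<and> (\<exists>\<phi> :: nat \<Rightarrow> real^'d \<Rightarrow> real. (\<forall>k. \<phi> k \<in> test_functions \<Omega>) \<and>
    (\<lambda>k. L2_norm (lebesgue_on \<Omega>) (\<lambda>x. u x - \<phi> k x)) \<longlonglongrightarrow> 0 \<and>
    (\<lambda>k. L2_norm (lebesgue_on \<Omega>) (\<lambda>x. weak_gradient \<Omega> u x - grad (\<phi> k) x)) \<longlonglongrightarrow> 0)"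
proof -
  have "(\<lambda>k. H1_norm \<Omega> (\<lambda>x. u x - \<phi> k x)) \<longlonglongrightarrow> 0 \<longleftrightarrow>
    (\<lambda>k. L2_norm (lebesgue_on \<Omega>) (\<lambda>x. u x - \<phi> k x)) \<longlonglongrightarrow> 0 \<and>
    (\<lambda>k. L2_norm (lebesgue_on \<Omega>) (\<lambda>x. weak_gradient \<Omega> u x - grad (\<phi> k) x)) \<longlonglongrightarrow> 0"
    (is "?a \<longlonglongrightarrow> 0 \<longleftrightarrow> ?b \<longlonglongrightarrow> 0 \<and> ?c \<longlonglongrightarrow> 0")
    if u: "u \<in> H1 \<Omega>" and \<phi>: "\<forall>k. \<phi> k \<in> test_functions \<Omega>" for \<phi> :: "nat \<Rightarrow> real^'d \<Rightarrow> real"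
  proof -
    have sq: "(?a k)\<^sup>2 = (?b k)\<^sup>2 + (?c k)\<^sup>2" for k
      using H1_norm_diff_test_function[OF assms u] \<phi> by auto
    have pos: "0 \<le> ?a k" "0 \<le> ?b k" "0 \<le> ?c k" for k
      by (simp_all add: L2_norm_nonneg H1_norm_def)
    have "?b k \<le> ?a k" "?c k \<le> ?a k" for k
      using sq[of k] pos[of k] by (auto intro!: power2_le_imp_le[of _ "?a k"])
    moreover have "?a k \<le> ?b k + ?c k" for k
      using sq[of k] pos[of k] by (intro power2_le_imp_le[of "?a k"]) (auto simp: power2_sum)
    ultimately show ?thesis
      using pos tendsto_add[of ?b 0 sequentially ?c 0]
      by (auto intro: tendsto_sandwich[OF _ _ tendsto_const, of _ ?b _ ?a]
          tendsto_sandwich[OF _ _ tendsto_const, of _ ?c _ ?a]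
          tendsto_sandwich[OF _ _ tendsto_const, of _ ?a _ "\<lambda>k. ?b k + ?c k"])
  qed
  then show ?thesis
    unfolding H10_def by blast
qed

lemma test_functions_diff:
  assumes "\<phi> \<in> test_functions \<Omega>" "\<psi> \<in> test_functions \<Omega>"
  shows "(\<lambda>x. \<phi> x - \<psi> x) \<in> test_functions \<Omega>"
proof -
  let ?K = "closure {x. \<phi> x \<noteq> 0} \<union> closure {x. \<psi> x \<noteq> 0}"
  note \<phi> = test_functionD[OF assms(1)] and \<psi> = test_functionD[OF assms(2)]
  have K: "compact ?K" "?K \<subseteq> \<Omega>"
    using \<phi>(2,3) \<psi>(2,3) by (auto intro: compact_Un)
  have "{x. \<phi> x - \<psi> x \<noteq> 0} \<subseteq> {x. \<phi> x \<noteq> 0} \<union> {x. \<psi> x \<noteq> 0}"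
    by auto
  then have sub: "closure {x. \<phi> x - \<psi> x \<noteq> 0} \<subseteq> ?K"
    by (simp only: closure_Un[symmetric] closure_mono)
  have "compact (closure {x. \<phi> x - \<psi> x \<noteq> 0})"
    using bounded_subset[OF compact_imp_bounded[OF K(1)] order_trans[OF closure_subset sub]]
    by (simp only: compact_closure)
  with order_trans[OF sub K(2)] smooth_diff[OF \<phi>(1) \<psi>(1)] show ?thesis
    unfolding test_functions_def by blast
qed

lemma grad_diff:
  assumes "smooth f" "smooth g"
  shows "grad (\<lambda>x. f x - g x) x = grad f x - grad g x"
proof -
  have "((\<lambda>x. f x - g x) has_derivative (\<lambda>h. frechet_derivative f (at x) h - frechet_derivative g (at x) h)) (at x)"
    using assms[THEN smooth_differentiable] by (intro has_derivative_diff frechet_derivative_works[THEN iffD1])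
  from partial_deriv_eq[OF this] show ?thesis
    by (simp add: grad_def vec_eq_iff partial_deriv_def)
qed

lemma H10_diff:
  fixes \<Omega> :: "(real^'d) set"
  assumes \<Omega>: "open \<Omega>" "bounded \<Omega>" and u: "u \<in> H10 \<Omega>" and v: "v \<in> H10 \<Omega>"
  shows "(\<lambda>x. u x - v x) \<in> H10 \<Omega>"
proof -
  let ?n = "\<lambda>f. L2_norm (lebesgue_on \<Omega>) f"
  let ?m = "\<lambda>f::real^'d \<Rightarrow> real^'d. L2_norm (lebesgue_on \<Omega>) f"
  have [simp]: "\<Omega> \<in> sets lebesgue"
    using \<Omega> by auto
  from u obtain \<phi> where \<phi>: "u \<in> H1 \<Omega>" "\<And>k::nat. \<phi> k \<in> test_functions \<Omega>"
    "(\<lambda>k. ?n (\<lambda>x. u x - \<phi> k x)) \<longlonglongrightarrow> 0" "(\<lambda>k. ?m (\<lambda>x. weak_gradient \<Omega> u x - grad (\<phi> k) x)) \<longlonglongrightarrow> 0"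
    unfolding H10_iff[OF \<Omega>] by auto
  from v obtain \<psi> where \<psi>: "v \<in> H1 \<Omega>" "\<And>k::nat. \<psi> k \<in> test_functions \<Omega>"
    "(\<lambda>k. ?n (\<lambda>x. v x - \<psi> k x)) \<longlonglongrightarrow> 0" "(\<lambda>k. ?m (\<lambda>x. weak_gradient \<Omega> v x - grad (\<psi> k) x)) \<longlonglongrightarrow> 0"
    unfolding H10_iff[OF \<Omega>] by auto
  let ?\<chi> = "\<lambda>k x. \<phi> k x - \<psi> k x"
  have D: "(\<lambda>x. u x - v x) \<in> H1 \<Omega>"
    using \<phi>(1) \<psi>(1) by (intro H1_diff) auto
  have \<chi>: "?\<chi> k \<in> test_functions \<Omega>" for k
    using \<phi>(2) \<psi>(2) by (intro test_functions_diff)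
  have "(\<lambda>k. ?n (\<lambda>x. (u x - v x) - ?\<chi> k x)) \<longlonglongrightarrow> 0"
  proof (rule tendsto_sandwich[OF _ _ tendsto_const])
    have "?n (\<lambda>x. (u x - v x) - ?\<chi> k x) \<le> ?n (\<lambda>x. u x - \<phi> k x) + ?n (\<lambda>x. v x - \<psi> k x)" for k
      using L2_norm_triangle_diff[of "\<lambda>x. u x - \<phi> k x" "lebesgue_on \<Omega>" "\<lambda>x. v x - \<psi> k x",
          OF L2_diff[OF H1_L2[OF \<phi>(1)] test_function_L2(1)[OF \<phi>(2)]]
            L2_diff[OF H1_L2[OF \<psi>(1)] test_function_L2(1)[OF \<psi>(2)]]]
      by (simp add: algebra_simps)
    then show "\<forall>\<^sub>F k in sequentially. ?n (\<lambda>x. (u x - v x) - ?\<chi> k x)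
        \<le> ?n (\<lambda>x. u x - \<phi> k x) + ?n (\<lambda>x. v x - \<psi> k x)"
      by simp
    show "(\<lambda>k. ?n (\<lambda>x. u x - \<phi> k x) + ?n (\<lambda>x. v x - \<psi> k x)) \<longlonglongrightarrow> 0"
      using tendsto_add[OF \<phi>(3) \<psi>(3)] by simp
  qed (simp add: L2_norm_nonneg)
  moreover have "(\<lambda>k. ?m (\<lambda>x. weak_gradient \<Omega> (\<lambda>x. u x - v x) x - grad (?\<chi> k) x)) \<longlonglongrightarrow> 0"
  proof (rule tendsto_sandwich[OF _ _ tendsto_const])
    have "?m (\<lambda>x. weak_gradient \<Omega> (\<lambda>x. u x - v x) x - grad (?\<chi> k) x)
        \<le> ?m (\<lambda>x. weak_gradient \<Omega> u x - grad (\<phi> k) x) + ?m (\<lambda>x. weak_gradient \<Omega> v x - grad (\<psi> k) x)" for k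
    proof -
      have L2s: "(\<lambda>x. weak_gradient \<Omega> u x - grad (\<phi> k) x) \<in> L2 (lebesgue_on \<Omega>)"
        "(\<lambda>x. weak_gradient \<Omega> v x - grad (\<psi> k) x) \<in> L2 (lebesgue_on \<Omega>)"
        "(\<lambda>x. weak_gradient \<Omega> (\<lambda>x. u x - v x) x - grad (?\<chi> k) x) \<in> L2 (lebesgue_on \<Omega>)"
        using \<phi>(1,2) \<psi>(1,2) D \<chi> by (auto intro!: L2_diff weak_gradient_L2 test_function_grad_L2)
      have "?m (\<lambda>x. weak_gradient \<Omega> (\<lambda>x. u x - v x) x - grad (?\<chi> k) x) =
        ?m (\<lambda>x. (weak_gradient \<Omega> u x - grad (\<phi> k) x) - (weak_gradient \<Omega> v x - grad (\<psi> k) x))"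
      proof (rule L2_norm_cong_AE)
        \<comment> \<open>The weak gradient of \<open>u - v\<close> is an arbitrary representative, so the two sides agree only almost
          everywhere.\<close>
        show "AE x in lebesgue_on \<Omega>. weak_gradient \<Omega> (\<lambda>x. u x - v x) x - grad (?\<chi> k) x =
          (weak_gradient \<Omega> u x - grad (\<phi> k) x) - (weak_gradient \<Omega> v x - grad (\<psi> k) x)"
          using weak_gradient_diff[OF \<Omega> \<phi>(1) \<psi>(1)]
          by eventually_elim
            (simp add: grad_diff[OF test_functionD(1)[OF \<phi>(2)] test_functionD(1)[OF \<psi>(2)]])
      qed (use L2s in \<open>auto intro!: L2_measurable L2_diff\<close>)
      with L2_norm_triangle_diff[OF L2s(1,2)] show ?thesis
        by simp
    qed
    then show "\<forall>\<^sub>F k in sequentially. ?m (\<lambda>x. weak_gradient \<Omega> (\<lambda>x. u x - v x) x - grad (?\<chi> k) x)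
        \<le> ?m (\<lambda>x. weak_gradient \<Omega> u x - grad (\<phi> k) x) + ?m (\<lambda>x. weak_gradient \<Omega> v x - grad (\<psi> k) x)"
      by simp
    show "(\<lambda>k. ?m (\<lambda>x. weak_gradient \<Omega> u x - grad (\<phi> k) x) + ?m (\<lambda>x. weak_gradient \<Omega> v x - grad (\<psi> k) x)) \<longlonglongrightarrow> 0"
      using tendsto_add[OF \<phi>(4) \<psi>(4)] by simp
  qed (simp add: L2_norm_nonneg)
  ultimately show ?thesis
    unfolding H10_iff[OF \<Omega>] using D \<chi> by (intro conjI exI[of _ ?\<chi>]) auto
qed

lemma L2_norm_component_le:
  fixes f :: "'a \<Rightarrow> real^'d"
  assumes "f \<in> L2 M"
  shows "L2_norm M (\<lambda>x. f x $ i) \<le> L2_norm M f"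
proof (rule power2_le_imp_le)
  show "(L2_norm M (\<lambda>x. f x $ i))\<^sup>2 \<le> (L2_norm M f)\<^sup>2"
    unfolding L2_norm_power2
    by (intro integral_mono L2_integrable_norm L2_component assms power_mono Finite_Cartesian_Product.norm_nth_le norm_ge_zero)
qed (rule L2_norm_nonneg)

text \<open>
  For a test function \<open>u\<close> this is the definition of the weak gradient of \<open>v\<close>, and both sides are
  continuous in \<open>u\<close> for the norm of \<open>H1\<close>.  There is no boundary term because \<open>u\<close> is a limit
  of test functions.
\<close>

lemma H10_integration_by_parts:
  fixes \<Omega> :: "(real^'d) set"
  assumes \<Omega>: "open \<Omega>" "bounded \<Omega>" and v: "v \<in> H1 \<Omega>" and u: "u \<in> H10 \<Omega>"
  shows "(\<integral>x. weak_gradient \<Omega> v x $ i * u x \<partial>lebesgue_on \<Omega>) =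
    - (\<integral>x. v x * weak_gradient \<Omega> u x $ i \<partial>lebesgue_on \<Omega>)"
proof -
  let ?M = "lebesgue_on \<Omega>"
  have [simp]: "\<Omega> \<in> sets lebesgue"
    using \<Omega> by auto
  from u obtain \<phi> where \<phi>: "u \<in> H1 \<Omega>" "\<And>k::nat. \<phi> k \<in> test_functions \<Omega>"
    "(\<lambda>k. L2_norm ?M (\<lambda>x. u x - \<phi> k x)) \<longlonglongrightarrow> 0" "(\<lambda>k. L2_norm ?M (\<lambda>x. weak_gradient \<Omega> u x - grad (\<phi> k) x)) \<longlonglongrightarrow> 0"
    unfolding H10_iff[OF \<Omega>] by auto
  have vL2: "v \<in> L2 ?M" "(\<lambda>x. weak_gradient \<Omega> v x $ i) \<in> L2 ?M"
    using v by (auto intro: H1_L2 weak_gradient_L2 L2_component)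
  have uL2: "u \<in> L2 ?M" "(\<lambda>x. weak_gradient \<Omega> u x $ i) \<in> L2 ?M"
    using \<phi>(1) by (auto intro: H1_L2 weak_gradient_L2 L2_component)
  have "(\<lambda>k. L2_norm ?M (\<lambda>x. weak_gradient \<Omega> u x $ i - partial_deriv i (\<phi> k) x)) \<longlonglongrightarrow> 0"
  proof (rule tendsto_sandwich[OF _ _ tendsto_const \<phi>(4)])
    have "L2_norm ?M (\<lambda>x. weak_gradient \<Omega> u x $ i - partial_deriv i (\<phi> k) x)
        \<le> L2_norm ?M (\<lambda>x. weak_gradient \<Omega> u x - grad (\<phi> k) x)" for k
      using L2_norm_component_le[of "\<lambda>x. weak_gradient \<Omega> u x - grad (\<phi> k) x" ?M i,
          OF L2_diff[OF weak_gradient_L2[OF \<phi>(1)] test_function_grad_L2[OF \<phi>(2)]]]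
      by (simp add: grad_def)
    then show "\<forall>\<^sub>F k in sequentially. L2_norm ?M (\<lambda>x. weak_gradient \<Omega> u x $ i - partial_deriv i (\<phi> k) x)
        \<le> L2_norm ?M (\<lambda>x. weak_gradient \<Omega> u x - grad (\<phi> k) x)"
      by simp
  qed (simp add: L2_norm_nonneg)
  then have "(\<lambda>k. L2_inner ?M (partial_deriv i (\<phi> k)) v) \<longlonglongrightarrow> L2_inner ?M (\<lambda>x. weak_gradient \<Omega> u x $ i) v"
    using \<phi>(2) by (intro tendsto_L2_inner uL2 vL2 test_function_L2) auto
  moreover have "(\<lambda>k. L2_inner ?M (\<phi> k) (\<lambda>x. weak_gradient \<Omega> v x $ i)) \<longlonglongrightarrow> L2_inner ?M u (\<lambda>x. weak_gradient \<Omega> v x $ i)"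
    using \<phi>(2) by (intro tendsto_L2_inner \<phi>(3) uL2 vL2 test_function_L2) auto
  moreover have "L2_inner ?M (partial_deriv i (\<phi> k)) v = - L2_inner ?M (\<phi> k) (\<lambda>x. weak_gradient \<Omega> v x $ i)" for k
    using weak_gradient[OF v] \<phi>(2)[of k] unfolding has_weak_gradient_def L2_inner_def
    by (simp add: mult.commute)
  ultimately have "L2_inner ?M (\<lambda>x. weak_gradient \<Omega> u x $ i) v = - L2_inner ?M u (\<lambda>x. weak_gradient \<Omega> v x $ i)"
    using LIMSEQ_unique[OF _ tendsto_minus] by fastforce
  then show ?thesis
    by (simp add: L2_inner_def mult.commute)
qed

section \<open>The Loomis--Whitney inequality\<close>

definition esqrt :: "ennreal \<Rightarrow> ennreal" where
  "esqrt x = (if x = top then top else ennreal (sqrt (enn2real x)))"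

lemma esqrt_measurable [measurable]: "esqrt \<in> borel_measurable borel"
  unfolding esqrt_def[abs_def] by measurable

lemma power2_esqrt [simp]: "(esqrt x)\<^sup>2 = x"
proof (cases x)
  case (real r)
  then show ?thesis by (simp add: esqrt_def ennreal_power)
next
  case top
  then show ?thesis by (simp add: esqrt_def power2_eq_square ennreal_top_mult)
qed

lemma ennreal_power2_le_imp_le:
  fixes x y :: ennreal
  assumes "x\<^sup>2 \<le> y\<^sup>2" shows "x \<le> y"
proof (cases y)
  case (real s)
  note s = this
  show ?thesis
  proof (cases x)
    case (real r)
    with s assms have "r\<^sup>2 \<le> s\<^sup>2"
      by (simp add: ennreal_power)
    then have "r \<le> s"
      using s(1) by (rule power2_le_imp_le)
    with real s show ?thesis
      by (simp add: ennreal_leI)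
  next
    case top
    then have "x\<^sup>2 = top"
      by (simp add: power2_eq_square ennreal_top_mult)
    moreover have "y\<^sup>2 = ennreal (s\<^sup>2)"
      using s by (simp add: ennreal_power)
    ultimately show ?thesis
      using assms by (simp add: top_unique)
  qed
qed simp

text \<open>
  The Cauchy--Schwarz inequality in \<open>z\<close>, then in \<open>y\<close>, then in \<open>x\<close>.  Each of the three functions
  depends on two of the variables only, so at every stage one factor moves out of the integral.
\<close>

lemma loomis_whitney_3:
  fixes f :: "'b \<Rightarrow> 'c \<Rightarrow> ennreal" and g :: "'a \<Rightarrow> 'c \<Rightarrow> ennreal" and h :: "'a \<Rightarrow> 'b \<Rightarrow> ennreal"
  assumes "sigma_finite_measure L" "sigma_finite_measure M" "sigma_finite_measure N"
    and [measurable]: "(\<lambda>(y, z). f y z) \<in> borel_measurable (M \<Otimes>\<^sub>M N)"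
      "(\<lambda>(x, z). g x z) \<in> borel_measurable (L \<Otimes>\<^sub>M N)" "(\<lambda>(x, y). h x y) \<in> borel_measurable (L \<Otimes>\<^sub>M M)"
  shows "(\<integral>\<^sup>+x. \<integral>\<^sup>+y. \<integral>\<^sup>+z. f y z * g x z * h x y \<partial>N \<partial>M \<partial>L)\<^sup>2 \<le>
    (\<integral>\<^sup>+y. \<integral>\<^sup>+z. (f y z)\<^sup>2 \<partial>N \<partial>M) * (\<integral>\<^sup>+x. \<integral>\<^sup>+z. (g x z)\<^sup>2 \<partial>N \<partial>L) * (\<integral>\<^sup>+x. \<integral>\<^sup>+y. (h x y)\<^sup>2 \<partial>M \<partial>L)"
proof -
  interpret L: sigma_finite_measure L by fact
  interpret M: sigma_finite_measure M by fact
  interpret N: sigma_finite_measure N by fact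
  define F where "F y = (\<integral>\<^sup>+z. (f y z)\<^sup>2 \<partial>N)" for y
  define G where "G x = (\<integral>\<^sup>+z. (g x z)\<^sup>2 \<partial>N)" for x
  define H where "H x = (\<integral>\<^sup>+y. (h x y)\<^sup>2 \<partial>M)" for x
  have [measurable]: "F \<in> borel_measurable M" "G \<in> borel_measurable L" "H \<in> borel_measurable L"
    unfolding F_def[abs_def] G_def[abs_def] H_def[abs_def] by measurable
  have fg: "(\<integral>\<^sup>+z. f y z * g x z \<partial>N) \<le> esqrt (F y) * esqrt (G x)"
    if [measurable]: "x \<in> space L" "y \<in> space M" for x y
    by (rule ennreal_power2_le_imp_le)
      (use Cauchy_Schwarz_nn_integral[of "f y" N "g x"] in \<open>simp add: power_mult_distrib F_def G_def\<close>)
  have Fh: "(\<integral>\<^sup>+y. esqrt (F y) * h x y \<partial>M) \<le> esqrt (\<integral>\<^sup>+y. F y \<partial>M) * esqrt (H x)"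
    if [measurable]: "x \<in> space L" for x
    by (rule ennreal_power2_le_imp_le)
      (use Cauchy_Schwarz_nn_integral[of "\<lambda>y. esqrt (F y)" M "h x"] in \<open>simp add: power_mult_distrib H_def\<close>)
  \<comment> \<open>The factor \<open>h\<close> does not depend on \<open>z\<close>, and the square root of \<open>G\<close> does not depend on \<open>y\<close>.\<close>
  have "(\<integral>\<^sup>+x. \<integral>\<^sup>+y. \<integral>\<^sup>+z. f y z * g x z * h x y \<partial>N \<partial>M \<partial>L)
      \<le> (\<integral>\<^sup>+x. esqrt (\<integral>\<^sup>+y. F y \<partial>M) * (esqrt (G x) * esqrt (H x)) \<partial>L)"
  proof (rule nn_integral_mono)
    fix x assume x[measurable]: "x \<in> space L"
    have "(\<integral>\<^sup>+y. \<integral>\<^sup>+z. f y z * g x z * h x y \<partial>N \<partial>M) \<le> (\<integral>\<^sup>+y. esqrt (G x) * (esqrt (F y) * h x y) \<partial>M)"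
    proof (rule nn_integral_mono)
      fix y assume y[measurable]: "y \<in> space M"
      have "(\<integral>\<^sup>+z. f y z * g x z * h x y \<partial>N) = (\<integral>\<^sup>+z. f y z * g x z \<partial>N) * h x y"
        by (intro nn_integral_multc) measurable
      also have "\<dots> \<le> (esqrt (F y) * esqrt (G x)) * h x y"
        by (intro mult_right_mono fg x y) simp
      finally show "(\<integral>\<^sup>+z. f y z * g x z * h x y \<partial>N) \<le> esqrt (G x) * (esqrt (F y) * h x y)"
        by (simp add: ac_simps)
    qed
    also have "\<dots> = esqrt (G x) * (\<integral>\<^sup>+y. esqrt (F y) * h x y \<partial>M)"
      by (intro nn_integral_cmult) measurable
    also have "\<dots> \<le> esqrt (G x) * (esqrt (\<integral>\<^sup>+y. F y \<partial>M) * esqrt (H x))"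
      by (intro mult_left_mono Fh x) simp
    finally show "(\<integral>\<^sup>+y. \<integral>\<^sup>+z. f y z * g x z * h x y \<partial>N \<partial>M)
        \<le> esqrt (\<integral>\<^sup>+y. F y \<partial>M) * (esqrt (G x) * esqrt (H x))"
      by (simp add: ac_simps)
  qed
  also have "\<dots> = esqrt (\<integral>\<^sup>+y. F y \<partial>M) * (\<integral>\<^sup>+x. esqrt (G x) * esqrt (H x) \<partial>L)"
    by (intro nn_integral_cmult) measurable
  finally have "(\<integral>\<^sup>+x. \<integral>\<^sup>+y. \<integral>\<^sup>+z. f y z * g x z * h x y \<partial>N \<partial>M \<partial>L)\<^sup>2
      \<le> (esqrt (\<integral>\<^sup>+y. F y \<partial>M) * (\<integral>\<^sup>+x. esqrt (G x) * esqrt (H x) \<partial>L))\<^sup>2"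
    by (intro power_mono) auto
  also have "\<dots> = (\<integral>\<^sup>+y. F y \<partial>M) * (\<integral>\<^sup>+x. esqrt (G x) * esqrt (H x) \<partial>L)\<^sup>2"
    by (simp add: power_mult_distrib)
  also have "\<dots> \<le> (\<integral>\<^sup>+y. F y \<partial>M) * ((\<integral>\<^sup>+x. (esqrt (G x))\<^sup>2 \<partial>L) * (\<integral>\<^sup>+x. (esqrt (H x))\<^sup>2 \<partial>L))"
    by (intro mult_left_mono Cauchy_Schwarz_nn_integral) auto
  finally show ?thesis
    by (simp add: F_def G_def H_def mult.assoc)
qed

text \<open>
  A bound for \<open>u\<^sup>2\<close> at each point by a product of integrals over the three coordinate lines through
  it becomes a bound for the integral of \<open>u\<close>: the square root of the integral over a line in one
  direction depends on the other two variables only, as the Loomis--Whitney inequality demands.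
\<close>

lemma gagliardo_of_line_integrals:
  fixes u :: "'a \<Rightarrow> 'b \<Rightarrow> 'c \<Rightarrow> ennreal" and w0 w1 w2 :: "'a \<times> 'b \<times> 'c \<Rightarrow> ennreal"
  assumes sf: "sigma_finite_measure L" "sigma_finite_measure M" "sigma_finite_measure N"
    and [measurable]: "w0 \<in> borel_measurable (L \<Otimes>\<^sub>M M \<Otimes>\<^sub>M N)"
      "w1 \<in> borel_measurable (L \<Otimes>\<^sub>M M \<Otimes>\<^sub>M N)"
      "w2 \<in> borel_measurable (L \<Otimes>\<^sub>M M \<Otimes>\<^sub>M N)"
    and u: "\<And>x y z. (u x y z)\<^sup>2 \<le> (\<integral>\<^sup>+x. w0 (x, y, z) \<partial>L) * (\<integral>\<^sup>+y. w1 (x, y, z) \<partial>M) * (\<integral>\<^sup>+z. w2 (x, y, z) \<partial>N)"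
  shows "(\<integral>\<^sup>+x. \<integral>\<^sup>+y. \<integral>\<^sup>+z. u x y z \<partial>N \<partial>M \<partial>L)\<^sup>2 \<le> (\<integral>\<^sup>+x. \<integral>\<^sup>+y. \<integral>\<^sup>+z. w0 (x, y, z) \<partial>N \<partial>M \<partial>L)
    * (\<integral>\<^sup>+x. \<integral>\<^sup>+y. \<integral>\<^sup>+z. w1 (x, y, z) \<partial>N \<partial>M \<partial>L) * (\<integral>\<^sup>+x. \<integral>\<^sup>+y. \<integral>\<^sup>+z. w2 (x, y, z) \<partial>N \<partial>M \<partial>L)"
proof -
  interpret L: sigma_finite_measure L by fact
  interpret M: sigma_finite_measure M by fact
  interpret N: sigma_finite_measure N by fact
  interpret LM: pair_sigma_finite L M ..
  interpret LN: pair_sigma_finite L N ..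
  interpret MN: pair_sigma_finite M N ..
  define A where "A y z = (\<integral>\<^sup>+x. w0 (x, y, z) \<partial>L)" for y z
  define B where "B x z = (\<integral>\<^sup>+y. w1 (x, y, z) \<partial>M)" for x z
  define C where "C x y = (\<integral>\<^sup>+z. w2 (x, y, z) \<partial>N)" for x y
  have [measurable]: "(\<lambda>(y, z). A y z) \<in> borel_measurable (M \<Otimes>\<^sub>M N)"
    unfolding A_def by measurable
  have [measurable]: "(\<lambda>(x, z). B x z) \<in> borel_measurable (L \<Otimes>\<^sub>M N)"
    unfolding B_def by measurable
  have [measurable]: "(\<lambda>(x, y). C x y) \<in> borel_measurable (L \<Otimes>\<^sub>M M)"
    unfolding C_def by measurable
  have "(\<integral>\<^sup>+x. \<integral>\<^sup>+y. \<integral>\<^sup>+z. u x y z \<partial>N \<partial>M \<partial>L) \<le>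
      (\<integral>\<^sup>+x. \<integral>\<^sup>+y. \<integral>\<^sup>+z. esqrt (A y z) * esqrt (B x z) * esqrt (C x y) \<partial>N \<partial>M \<partial>L)"
  proof (intro nn_integral_mono, rule ennreal_power2_le_imp_le)
    show "(u x y z)\<^sup>2 \<le> (esqrt (A y z) * esqrt (B x z) * esqrt (C x y))\<^sup>2" for x y z
      unfolding power_mult_distrib power2_esqrt A_def B_def C_def by (rule u)
  qed
  then have "(\<integral>\<^sup>+x. \<integral>\<^sup>+y. \<integral>\<^sup>+z. u x y z \<partial>N \<partial>M \<partial>L)\<^sup>2 \<le>
      (\<integral>\<^sup>+x. \<integral>\<^sup>+y. \<integral>\<^sup>+z. esqrt (A y z) * esqrt (B x z) * esqrt (C x y) \<partial>N \<partial>M \<partial>L)\<^sup>2"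
    by (intro power_mono) auto
  also have "\<dots> \<le> (\<integral>\<^sup>+y. \<integral>\<^sup>+z. (esqrt (A y z))\<^sup>2 \<partial>N \<partial>M) * (\<integral>\<^sup>+x. \<integral>\<^sup>+z. (esqrt (B x z))\<^sup>2 \<partial>N \<partial>L)
      * (\<integral>\<^sup>+x. \<integral>\<^sup>+y. (esqrt (C x y))\<^sup>2 \<partial>M \<partial>L)"
    by (intro loomis_whitney_3 sf) measurable
  also have "(\<integral>\<^sup>+x. \<integral>\<^sup>+z. (esqrt (B x z))\<^sup>2 \<partial>N \<partial>L) = (\<integral>\<^sup>+x. \<integral>\<^sup>+y. \<integral>\<^sup>+z. w1 (x, y, z) \<partial>N \<partial>M \<partial>L)"
    unfolding power2_esqrt B_def by (intro nn_integral_cong MN.Fubini') measurable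
  also have "(\<integral>\<^sup>+y. \<integral>\<^sup>+z. (esqrt (A y z))\<^sup>2 \<partial>N \<partial>M) = (\<integral>\<^sup>+y. \<integral>\<^sup>+x. \<integral>\<^sup>+z. w0 (x, y, z) \<partial>N \<partial>L \<partial>M)"
    unfolding power2_esqrt A_def by (intro nn_integral_cong LN.Fubini') measurable
  also have "\<dots> = (\<integral>\<^sup>+x. \<integral>\<^sup>+y. \<integral>\<^sup>+z. w0 (x, y, z) \<partial>N \<partial>M \<partial>L)"
    by (intro LM.Fubini') measurable
  finally show ?thesis
    by (simp add: C_def)
qed

section \<open>Spaces of dimension at most three as images of a triple product\<close>

text \<open>
  An injection \<open>k\<close> of the coordinates into \<open>{0, 1, 2}\<close> lets one argument with three variables cover
  the dimensions 1, 2 and 3.  A variable that corresponds to no coordinate carries a probability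
  measure, so that integrating over it does not change a function that is constant in it.
\<close>

definition slot_measure :: "('d \<Rightarrow> nat) \<Rightarrow> nat \<Rightarrow> real measure" where
  "slot_measure k j = (if j \<in> range k then lborel else density lborel (indicator {0..1}))"

definition slot_vec :: "('d \<Rightarrow> nat) \<Rightarrow> real \<Rightarrow> real \<Rightarrow> real \<Rightarrow> real^'d" where
  "slot_vec k x y z = (\<chi> i. if k i = 0 then x else if k i = 1 then y else z)"

lemma sets_slot_measure [measurable_cong, simp]: "sets (slot_measure k j) = sets borel"
  and space_slot_measure [simp]: "space (slot_measure k j) = UNIV"
  by (auto simp: slot_measure_def)

lemma emeasure_slot_measure_UNIV: "j \<notin> range k \<Longrightarrow> emeasure (slot_measure k j) UNIV = 1"
  by (simp add: slot_measure_def emeasure_density)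

lemma sigma_finite_slot_measure: "sigma_finite_measure (slot_measure k j)"
proof (cases "j \<in> range k")
  case True
  then show ?thesis
    by (simp add: slot_measure_def sigma_finite_lborel)
next
  case False
  then have "finite_measure (slot_measure k j)"
    by (intro finite_measureI) (simp add: emeasure_slot_measure_UNIV)
  then show ?thesis
    by (simp add: finite_measure.axioms)
qed

lemma slot_vec_measurable [measurable]:
  "(\<lambda>(x, y, z). slot_vec k x y z) \<in> borel_measurable (slot_measure k a \<Otimes>\<^sub>M slot_measure k b \<Otimes>\<^sub>M slot_measure k c)"
proof (rule borel_measurable_euclidean_space[THEN iffD2], rule ballI)
  fix b' :: "real^'a" assume "b' \<in> Basis"
  then obtain i where b': "b' = axis i 1"
    by (auto simp: Basis_vec_def)
  show "(\<lambda>p. (case p of (x, y, z) \<Rightarrow> slot_vec k x y z) \<bullet> b') \<in>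
      borel_measurable (slot_measure k a \<Otimes>\<^sub>M slot_measure k b \<Otimes>\<^sub>M slot_measure k c)"
    unfolding b' by (simp add: slot_vec_def inner_axis case_prod_beta)
qed

lemma prod_Basis_vec: "(\<Prod>b\<in>Basis. (v::real^'d) \<bullet> b) = (\<Prod>i\<in>UNIV. v $ i)"
proof -
  have "(Basis :: (real^'d) set) = (\<lambda>i. axis i 1) ` UNIV"
    by (auto simp: Basis_vec_def)
  moreover have "(\<Prod>b\<in>(\<lambda>i. axis i 1) ` UNIV. v \<bullet> b) = (\<Prod>i\<in>UNIV. v $ i)"
    by (subst prod.reindex) (auto simp: inj_on_def axis_eq_axis inner_axis)
  ultimately show ?thesis
    by (simp only:)
qed

text \<open>
  The preimage of a box is a product of three sets.  The variables without a coordinate contribute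
  the factor 1 to its measure, the others the side lengths of the box.
\<close>

lemma distr_slot_vec:
  assumes inj: "inj k" and k: "\<And>i. k i < 3"
  shows "distr (slot_measure k 0 \<Otimes>\<^sub>M slot_measure k 1 \<Otimes>\<^sub>M slot_measure k 2) borel
     (\<lambda>(x, y, z). slot_vec k x y z) = (lborel :: (real^'d) measure)" (is "distr ?P _ ?e = _")
proof (rule lborel_eqI[symmetric])
  fix l u :: "real^'d"
  assume le: "\<And>b. b \<in> Basis \<Longrightarrow> l \<bullet> b \<le> u \<bullet> b"
  have lu: "l $ i \<le> u $ i" for i
    using le[of "axis i 1"] by (simp add: inner_axis)
  \<comment> \<open>The projections of the preimage of the box, and their measures.\<close>
  define A where "A j = (if j \<in> range k then {l $ (inv k j) <..< u $ (inv k j)} else UNIV)" for j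
  define q where "q j = (if j \<in> range k then u $ (inv k j) - l $ (inv k j) else 1)" for j
  have A: "A j \<in> sets borel" for j
    by (simp add: A_def)
  have q: "emeasure (slot_measure k j) (A j) = ennreal (q j)" for j
    using lu by (auto simp: A_def q_def emeasure_slot_measure_UNIV) (auto simp: slot_measure_def)
  have q0: "0 \<le> q j" for j
    using lu by (auto simp: q_def)
  have "?e -` box l u \<inter> space ?P = A 0 \<times> A 1 \<times> A 2"
  proof -
    have "slot_vec k x y z \<in> box l u \<longleftrightarrow> x \<in> A 0 \<and> y \<in> A 1 \<and> z \<in> A 2" for x y z
    proof
      assume "slot_vec k x y z \<in> box l u"
      then have b: "l $ i < slot_vec k x y z $ i \<and> slot_vec k x y z $ i < u $ i" for i
        by (simp add: mem_box_cart)
      show "x \<in> A 0 \<and> y \<in> A 1 \<and> z \<in> A 2"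
        using b[of "inv k 0"] b[of "inv k 1"] b[of "inv k 2"]
        by (auto simp: A_def slot_vec_def f_inv_into_f)
    next
      assume a: "x \<in> A 0 \<and> y \<in> A 1 \<and> z \<in> A 2"
      have "l $ i < slot_vec k x y z $ i \<and> slot_vec k x y z $ i < u $ i" for i
      proof -
        have "k i = 0 \<or> k i = 1 \<or> k i = 2"
          using k[of i] by auto
        then have "slot_vec k x y z $ i \<in> A (k i)"
          using a by (elim disjE) (simp_all add: slot_vec_def)
        moreover have "A (k i) = {l $ i <..< u $ i}"
          using inj by (simp add: A_def)
        ultimately show ?thesis
          by simp
      qed
      then show "slot_vec k x y z \<in> box l u"
        by (simp add: mem_box_cart)
    qed
    then show ?thesis
      by (auto simp: space_pair_measure)
  qed
  then have "emeasure (distr ?P borel ?e) (box l u) = emeasure ?P (A 0 \<times> A 1 \<times> A 2)"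
    by (subst emeasure_distr) auto
  also have "\<dots> = ennreal (q 0 * q 1 * q 2)"
  proof -
    interpret N2: sigma_finite_measure "slot_measure k 2" by (rule sigma_finite_slot_measure)
    interpret N1: sigma_finite_measure "slot_measure k 1" by (rule sigma_finite_slot_measure)
    interpret P: pair_sigma_finite "slot_measure k 1" "slot_measure k 2" ..
    have "emeasure ?P (A 0 \<times> A 1 \<times> A 2) = emeasure (slot_measure k 0) (A 0)
        * (emeasure (slot_measure k 1) (A 1) * emeasure (slot_measure k 2) (A 2))"
      using A by (subst P.emeasure_pair_measure_Times) (auto simp: N2.emeasure_pair_measure_Times)
    then show ?thesis
      using q0 by (simp only: q) (simp add: ennreal_mult'[symmetric] mult.assoc)
  qed
  also have "q 0 * q 1 * q 2 = (\<Prod>j\<in>{..<3}. q j)"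
    by (simp add: eval_nat_numeral lessThan_Suc)
  also have "\<dots> = (\<Prod>j\<in>range k. q j)"
    using k by (intro prod.mono_neutral_right) (auto simp: q_def)
  also have "\<dots> = (\<Prod>i\<in>UNIV. u $ i - l $ i)"
    using inj by (simp add: prod.reindex q_def)
  also have "\<dots> = (\<Prod>b\<in>Basis. (u - l) \<bullet> b)"
    by (simp add: prod_Basis_vec)
  finally show "emeasure (distr ?P borel ?e) (box l u) = (\<Prod>b\<in>Basis. (u - l) \<bullet> b)" .
qed simp

lemma nn_integral_slot_vec:
  fixes f :: "real^'d \<Rightarrow> ennreal"
  assumes inj: "inj k" and k: "\<And>i. k i < 3" and f[measurable]: "f \<in> borel_measurable borel"
  shows "(\<integral>\<^sup>+p. f p \<partial>lborel) =
    (\<integral>\<^sup>+x. \<integral>\<^sup>+y. \<integral>\<^sup>+z. f (slot_vec k x y z) \<partial>slot_measure k 2 \<partial>slot_measure k 1 \<partial>slot_measure k 0)"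
proof -
  interpret N2: sigma_finite_measure "slot_measure k 2" by (rule sigma_finite_slot_measure)
  interpret N1: sigma_finite_measure "slot_measure k 1" by (rule sigma_finite_slot_measure)
  interpret P: pair_sigma_finite "slot_measure k 1" "slot_measure k 2" ..
  have "(\<integral>\<^sup>+p. f p \<partial>lborel) = (\<integral>\<^sup>+p. f (case p of (x, y, z) \<Rightarrow> slot_vec k x y z)
      \<partial>(slot_measure k 0 \<Otimes>\<^sub>M slot_measure k 1 \<Otimes>\<^sub>M slot_measure k 2))"
    unfolding distr_slot_vec[OF inj k, symmetric] by (intro nn_integral_distr) auto
  also have "\<dots> = (\<integral>\<^sup>+x. \<integral>\<^sup>+p. f (case p of (y, z) \<Rightarrow> slot_vec k x y z)
      \<partial>(slot_measure k 1 \<Otimes>\<^sub>M slot_measure k 2) \<partial>slot_measure k 0)"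
    by (subst P.nn_integral_fst[symmetric]) auto
  also have "\<dots> = (\<integral>\<^sup>+x. \<integral>\<^sup>+y. \<integral>\<^sup>+z. f (slot_vec k x y z) \<partial>slot_measure k 2 \<partial>slot_measure k 1 \<partial>slot_measure k 0)"
    by (intro nn_integral_cong, subst N2.nn_integral_fst[symmetric]) auto
  finally show ?thesis .
qed

section \<open>The Sobolev inequality\<close>

lemma abs_le_nn_integral_deriv:
  fixes f f' :: "real \<Rightarrow> real"
  assumes deriv: "\<And>s. (f has_real_derivative f' s) (at s)" and cont: "continuous_on UNIV f'"
    and zero: "\<And>s. s \<le> a \<Longrightarrow> f s = 0"
  shows "ennreal \<bar>f t\<bar> \<le> (\<integral>\<^sup>+s. ennreal \<bar>f' s\<bar> \<partial>lborel)"
proof -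
  define b where "b = min a t"
  have b: "b \<le> t" "f b = 0"
    using zero[of b] by (auto simp: b_def)
  have isCont: "isCont f' s" for s
    using cont by (simp add: continuous_on_eq_continuous_at)
  have int: "integrable lborel (\<lambda>s. f' s * indicator {b..t} s)"
    using borel_integrable_atLeastAtMost[of b t f'] isCont by (simp add: mult.commute)
  have "(\<integral>s. f' s * indicator {b..t} s \<partial>lborel) = f t - f b"
    by (rule integral_FTC_Icc_real[OF b(1) deriv isCont])
  with b(2) have "ennreal \<bar>f t\<bar> = ennreal (norm (\<integral>s. f' s * indicator {b..t} s \<partial>lborel))"
    by simp
  also have "\<dots> \<le> (\<integral>\<^sup>+s. ennreal (norm (f' s * indicator {b..t} s)) \<partial>lborel)"
    by (rule integral_norm_bound_ennreal[OF int])
  also have "\<dots> \<le> (\<integral>\<^sup>+s. ennreal \<bar>f' s\<bar> \<partial>lborel)"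
    by (intro nn_integral_mono ennreal_leI) (simp add: indicator_def)
  finally show ?thesis .
qed

text \<open>
  In a variable that corresponds to no coordinate the function itself takes the role of the partial
  derivative: the integral of \<open>4 \<bar>\<phi>\<bar>\<^sup>3 \<bar>\<phi>\<bar>\<close> over a probability space bounds the constant \<open>\<phi>\<^sup>4\<close>.
\<close>

definition slot_deriv :: "('d::finite \<Rightarrow> nat) \<Rightarrow> nat \<Rightarrow> (real^'d \<Rightarrow> real) \<Rightarrow> real^'d \<Rightarrow> real" where
  "slot_deriv k j \<phi> p = (if j \<in> range k then partial_deriv (inv k j) \<phi> p else \<phi> p)"

text \<open>
  Along a coordinate line the derivative of \<open>\<phi>\<^sup>4\<close> is \<open>4 \<phi>\<^sup>3 \<partial>\<^sub>i\<phi>\<close>, and \<open>\<phi>\<close> vanishes far out on the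
  line.  The fourth power is the one for which \<open>(\<phi>\<^sup>4)\<^sup>3 = (\<phi>\<^sup>6)\<^sup>2\<close>, as the Loomis--Whitney inequality
  in three variables requires.
\<close>

lemma power4_le_nn_integral_slot:
  fixes \<phi> :: "real^'d \<Rightarrow> real"
  assumes \<phi>: "\<phi> \<in> test_functions \<Omega>"
    and l: "\<And>s. j \<in> range k \<Longrightarrow> l s = q + s *\<^sub>R axis (inv k j) 1" "\<And>s. j \<notin> range k \<Longrightarrow> l s = q"
  shows "ennreal ((\<phi> (l t))^4) \<le>
    (\<integral>\<^sup>+s. ennreal (4 * \<bar>\<phi> (l s)\<bar>^3 * \<bar>slot_deriv k j \<phi> (l s)\<bar>) \<partial>slot_measure k j)"
proof (cases "j \<in> range k")
  case True
  define i where "i = inv k j"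
  let ?l = "\<lambda>s. q + s *\<^sub>R axis i 1"
  have l': "l = ?l"
    using l(1)[OF True] by (auto simp: i_def)
  note \<phi>' = test_functionD[OF \<phi>]
  obtain R where R: "\<And>x. x \<in> closure {x. \<phi> x \<noteq> 0} \<Longrightarrow> norm x \<le> R"
    using compact_imp_bounded[OF \<phi>'(2)] unfolding bounded_iff by blast
  let ?f = "\<lambda>s. (\<phi> (?l s))^4" and ?f' = "\<lambda>s. 4 * (\<phi> (?l s))^3 * partial_deriv i \<phi> (?l s)"
  have cl: "continuous_on UNIV ?l"
    by (intro continuous_intros)
  have "ennreal \<bar>?f t\<bar> \<le> (\<integral>\<^sup>+s. ennreal \<bar>?f' s\<bar> \<partial>lborel)"
  proof (rule abs_le_nn_integral_deriv[where f = ?f and f' = ?f' and a = "- (\<bar>R\<bar> + norm q + 1)"])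
    show "(?f has_real_derivative ?f' s) (at s)" for s
      using DERIV_power[OF DERIV_along_axis[OF smooth_differentiable[OF \<phi>'(1)], where x = q and t = s and i = i], of 4]
      by (simp add: ac_simps)
    show "continuous_on UNIV ?f'"
      using continuous_on_compose2[OF smooth_continuous[OF \<phi>'(1), of UNIV] cl]
        continuous_on_compose2[OF smooth_continuous[OF smooth_partial_deriv[OF \<phi>'(1)], of UNIV] cl]
      by (intro continuous_intros) auto
    \<comment> \<open>The reverse triangle inequality gives \<open>norm (q + s e) \<ge> \<bar>s\<bar> - norm q > R\<close> on this half line.\<close>
    show "?f s = 0" if "s \<le> - (\<bar>R\<bar> + norm q + 1)" for s
    proof -
      have "\<bar>s\<bar> = norm (s *\<^sub>R axis i 1 :: real^'d)"
        by (simp add: norm_axis_1)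
      also have "\<dots> \<le> norm (?l s) + norm q"
        using norm_triangle_ineq4[of "?l s" q] by simp
      finally have "\<not> norm (?l s) \<le> R"
        using that by linarith
      with R have "?l s \<notin> closure {x. \<phi> x \<noteq> 0}"
        by blast
      from \<phi>'(4)[OF this] show ?thesis
        by simp
    qed
  qed
  then show ?thesis
    using True by (simp add: l' slot_measure_def slot_deriv_def i_def[symmetric] abs_mult power_abs)
next
  case False
  then have l': "l s = q" for s
    using l(2) by simp
  have "\<bar>\<phi> q\<bar>^3 * \<bar>\<phi> q\<bar> = \<bar>\<phi> q\<bar>^4"
    by (simp add: power3_eq_cube power4_eq_xxxx)
  also have "\<dots> = (\<phi> q)^4"
    by (rule power_even_abs) simp
  finally have "(\<phi> q)^4 \<le> 4 * \<bar>\<phi> q\<bar>^3 * \<bar>\<phi> q\<bar>"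
    using zero_le_even_power[of 4 "\<phi> q"] by (simp add: mult.assoc)
  then show ?thesis
    using False unfolding l' by (simp add: slot_deriv_def emeasure_slot_measure_UNIV ennreal_leI)
qed

lemma slot_vec_axis:
  assumes "inj k" "\<And>i. k i < 3"
  shows "0 \<in> range k \<Longrightarrow> slot_vec k s y z = slot_vec k 0 y z + s *\<^sub>R axis (inv k 0) 1"
    and "1 \<in> range k \<Longrightarrow> slot_vec k x s z = slot_vec k x 0 z + s *\<^sub>R axis (inv k 1) 1"
    and "2 \<in> range k \<Longrightarrow> slot_vec k x y s = slot_vec k x y 0 + s *\<^sub>R axis (inv k 2) 1"
    and "0 \<notin> range k \<Longrightarrow> slot_vec k s y z = slot_vec k 0 y z"
    and "1 \<notin> range k \<Longrightarrow> slot_vec k x s z = slot_vec k x 0 z"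
    and "2 \<notin> range k \<Longrightarrow> slot_vec k x y s = slot_vec k x y 0"
proof -
  have k2: "k i = 2" if "k i \<noteq> 0" "k i \<noteq> Suc 0" for i
    using assms(2)[of i] that by simp
  have inv: "i = inv k j \<longleftrightarrow> k i = j" if "j \<in> range k" for i j
    using that assms(1) by (auto dest: injD)
  show "0 \<in> range k \<Longrightarrow> slot_vec k s y z = slot_vec k 0 y z + s *\<^sub>R axis (inv k 0) 1"
    "1 \<in> range k \<Longrightarrow> slot_vec k x s z = slot_vec k x 0 z + s *\<^sub>R axis (inv k 1) 1"
    "2 \<in> range k \<Longrightarrow> slot_vec k x y s = slot_vec k x y 0 + s *\<^sub>R axis (inv k 2) 1"
    using k2 by (auto simp: vec_eq_iff slot_vec_def axis_def inv)
  show "0 \<notin> range k \<Longrightarrow> slot_vec k s y z = slot_vec k 0 y z"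
    "1 \<notin> range k \<Longrightarrow> slot_vec k x s z = slot_vec k x 0 z"
    "2 \<notin> range k \<Longrightarrow> slot_vec k x y s = slot_vec k x y 0"
    using k2 by (auto simp: vec_eq_iff slot_vec_def) (metis rangeI)+
qed

lemma ennreal_power_cancel:
  fixes S c :: ennreal
  assumes "S^4 \<le> c * S^3" "S < top"
  shows "S \<le> c"
proof (cases c)
  case (real r)
  obtain s where s: "S = ennreal s" "0 \<le> s"
    using assms(2) by (cases S) auto
  have "s ^ 4 \<le> r * s^3"
    using assms(1) s real by (simp add: ennreal_power ennreal_mult[symmetric])
  then have "s = 0 \<or> s \<le> r"
    using s(2) by (cases "s = 0") (auto simp: power4_eq_xxxx power3_eq_cube mult.assoc[symmetric])
  with s real show ?thesis
    by (auto intro: ennreal_leI)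
qed simp

text \<open>
  Write \<open>S\<close> for the integral of \<open>\<phi>\<^sup>6\<close>, \<open>K\<close> for that of \<open>\<phi>\<^sup>2 + \<bar>\<nabla>\<phi>\<bar>\<^sup>2\<close> and \<open>W\<^sub>j\<close> for that of
  \<open>4 \<bar>\<phi>\<bar>\<^sup>3 \<bar>\<partial>\<^sub>j\<phi>\<bar>\<close>.  The bounds along lines give \<open>S\<^sup>2 \<le> W\<^sub>0 W\<^sub>1 W\<^sub>2\<close>, and \<open>W\<^sub>j\<^sup>2 \<le> 16 S K\<close> by the
  Cauchy--Schwarz inequality.  Together \<open>S\<^sup>4 \<le> 16\<^sup>3 S\<^sup>3 K\<^sup>3\<close>, where \<open>S\<^sup>3\<close> cancels because \<open>S\<close> is finite
  for a continuous function with compact support.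
\<close>

lemma sobolev_test_function:
  fixes \<phi> :: "real^'d \<Rightarrow> real"
  assumes d: "CARD('d) \<le> 3" and \<phi>: "\<phi> \<in> test_functions \<Omega>"
  shows "(\<integral>\<^sup>+p. ennreal ((\<phi> p)^6) \<partial>lborel) \<le> 4096 * (\<integral>\<^sup>+p. ennreal ((\<phi> p)\<^sup>2 + (norm (grad \<phi> p))\<^sup>2) \<partial>lborel)^3"
proof -
  obtain k :: "'d \<Rightarrow> nat" where "bij_betw k UNIV {0..<CARD('d)}"
    using ex_bij_betw_finite_nat[of "UNIV :: 'd set"] by auto
  then have inj: "inj k" and k: "k i < 3" for i
    using d by (auto simp: bij_betw_def dest!: equalityD1)
      (metis atLeastLessThan_iff order_less_le_trans rangeI subsetD)
  note \<phi>' = test_functionD[OF \<phi>]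
  have [measurable]: "\<phi> \<in> borel_measurable borel" "partial_deriv i \<phi> \<in> borel_measurable borel" for i
    by (intro borel_measurable_continuous_onI smooth_continuous smooth_partial_deriv \<phi>')+
  define S where "S = (\<integral>\<^sup>+p. ennreal ((\<phi> p)^6) \<partial>lborel)"
  define K where "K = (\<integral>\<^sup>+p. ennreal ((\<phi> p)\<^sup>2 + (norm (grad \<phi> p))\<^sup>2) \<partial>lborel)"
  define w where "w j p = ennreal (4 * \<bar>\<phi> p\<bar>^3 * \<bar>slot_deriv k j \<phi> p\<bar>)" for j p
  define W where "W j = (\<integral>\<^sup>+p. w j p \<partial>lborel)" for j
  have sd[measurable]: "slot_deriv k j \<phi> \<in> borel_measurable borel" for j
    unfolding slot_deriv_def[abs_def] by (cases "j \<in> range k") simp_all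
  have w[measurable]: "w j \<in> borel_measurable borel" for j
    unfolding w_def[abs_def] by measurable
  let ?e = "slot_vec k" and ?N = "slot_measure k"
  have "S\<^sup>2 \<le> W 0 * W 1 * W 2"
  proof -
    have S: "S = (\<integral>\<^sup>+x. \<integral>\<^sup>+y. \<integral>\<^sup>+z. ennreal ((\<phi> (?e x y z))^6) \<partial>?N 2 \<partial>?N 1 \<partial>?N 0)"
      unfolding S_def by (rule nn_integral_slot_vec[OF inj k]) measurable
    have W: "W j = (\<integral>\<^sup>+x. \<integral>\<^sup>+y. \<integral>\<^sup>+z. w j (?e x y z) \<partial>?N 2 \<partial>?N 1 \<partial>?N 0)" for j
      unfolding W_def by (rule nn_integral_slot_vec[OF inj k]) measurable
    have wm: "(\<lambda>p. w j (case p of (x, y, z) \<Rightarrow> ?e x y z)) \<in> borel_measurable (?N 0 \<Otimes>\<^sub>M ?N 1 \<Otimes>\<^sub>M ?N 2)" for j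
      by measurable
    have "S\<^sup>2 \<le> (\<integral>\<^sup>+x. \<integral>\<^sup>+y. \<integral>\<^sup>+z. (\<lambda>p. w 0 (case p of (x, y, z) \<Rightarrow> ?e x y z)) (x, y, z) \<partial>?N 2 \<partial>?N 1 \<partial>?N 0)
      * (\<integral>\<^sup>+x. \<integral>\<^sup>+y. \<integral>\<^sup>+z. (\<lambda>p. w 1 (case p of (x, y, z) \<Rightarrow> ?e x y z)) (x, y, z) \<partial>?N 2 \<partial>?N 1 \<partial>?N 0)
      * (\<integral>\<^sup>+x. \<integral>\<^sup>+y. \<integral>\<^sup>+z. (\<lambda>p. w 2 (case p of (x, y, z) \<Rightarrow> ?e x y z)) (x, y, z) \<partial>?N 2 \<partial>?N 1 \<partial>?N 0)"
      unfolding S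
    proof (rule gagliardo_of_line_integrals[OF sigma_finite_slot_measure sigma_finite_slot_measure sigma_finite_slot_measure wm wm wm])
      fix x y z
      let ?a = "ennreal ((\<phi> (?e x y z))^4)"
      have "(ennreal ((\<phi> (?e x y z))^6))\<^sup>2 = ?a * ?a * ?a"
        by (simp add: ennreal_power ennreal_mult[symmetric] flip: power_mult power_add)
      also have "\<dots> \<le> (\<integral>\<^sup>+x. w 0 (?e x y z) \<partial>?N 0) * (\<integral>\<^sup>+y. w 1 (?e x y z) \<partial>?N 1) * (\<integral>\<^sup>+z. w 2 (?e x y z) \<partial>?N 2)"
      proof (intro mult_mono)
        show "?a \<le> (\<integral>\<^sup>+x. w 0 (?e x y z) \<partial>?N 0)"
          unfolding w_def by (rule power4_le_nn_integral_slot[OF \<phi>, where l = "\<lambda>s. ?e s y z" and q = "?e 0 y z"])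
            (erule slot_vec_axis[OF inj k])+
        show "?a \<le> (\<integral>\<^sup>+y. w 1 (?e x y z) \<partial>?N 1)"
          unfolding w_def by (rule power4_le_nn_integral_slot[OF \<phi>, where l = "\<lambda>s. ?e x s z" and q = "?e x 0 z"])
            (erule slot_vec_axis[OF inj k])+
        show "?a \<le> (\<integral>\<^sup>+z. w 2 (?e x y z) \<partial>?N 2)"
          unfolding w_def by (rule power4_le_nn_integral_slot[OF \<phi>, where l = "\<lambda>s. ?e x y s" and q = "?e x y 0"])
            (erule slot_vec_axis[OF inj k])+
      qed auto
      finally show "(ennreal ((\<phi> (?e x y z))^6))\<^sup>2 \<le> (\<integral>\<^sup>+x. w 0 (case (x, y, z) of (x, y, z) \<Rightarrow> ?e x y z) \<partial>?N 0)
          * (\<integral>\<^sup>+y. w 1 (case (x, y, z) of (x, y, z) \<Rightarrow> ?e x y z) \<partial>?N 1)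
          * (\<integral>\<^sup>+z. w 2 (case (x, y, z) of (x, y, z) \<Rightarrow> ?e x y z) \<partial>?N 2)"
        by simp
    qed
    then show ?thesis
      by (simp add: W)
  qed
  moreover have W: "(W j)\<^sup>2 \<le> 16 * S * K" for j
  proof -
    have "(W j)\<^sup>2 = (\<integral>\<^sup>+p. ennreal (4 * \<bar>\<phi> p\<bar>^3) * ennreal \<bar>slot_deriv k j \<phi> p\<bar> \<partial>lborel)\<^sup>2"
      unfolding W_def w_def by (simp add: ennreal_mult)
    also have "\<dots> \<le> (\<integral>\<^sup>+p. (ennreal (4 * \<bar>\<phi> p\<bar>^3))\<^sup>2 \<partial>lborel) * (\<integral>\<^sup>+p. (ennreal \<bar>slot_deriv k j \<phi> p\<bar>)\<^sup>2 \<partial>lborel)"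
      by (intro Cauchy_Schwarz_nn_integral) measurable
    also have "\<dots> \<le> (16 * S) * K"
    proof (intro mult_mono)
      have "(ennreal (4 * \<bar>\<phi> p\<bar>^3))\<^sup>2 = 16 * ennreal ((\<phi> p)^6)" for p
      proof -
        have "(4 * \<bar>\<phi> p\<bar>^3)\<^sup>2 = 16 * (\<phi> p)^6"
          by (simp add: power_mult_distrib flip: power_mult)
        then show ?thesis
          by (simp add: ennreal_power ennreal_mult')
      qed
      then show "(\<integral>\<^sup>+p. (ennreal (4 * \<bar>\<phi> p\<bar>^3))\<^sup>2 \<partial>lborel) \<le> 16 * S"
        unfolding S_def by (simp add: nn_integral_cmult)
      have "(slot_deriv k j \<phi> p)\<^sup>2 \<le> (\<phi> p)\<^sup>2 + (norm (grad \<phi> p))\<^sup>2" for p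
      proof (cases "j \<in> range k")
        case True
        have "\<bar>grad \<phi> p $ inv k j\<bar>\<^sup>2 \<le> (norm (grad \<phi> p))\<^sup>2"
          by (intro power_mono component_le_norm_cart) simp
        with True show ?thesis
          by (simp add: slot_deriv_def grad_def add_increasing)
      qed (simp add: slot_deriv_def)
      then show "(\<integral>\<^sup>+p. (ennreal \<bar>slot_deriv k j \<phi> p\<bar>)\<^sup>2 \<partial>lborel) \<le> K"
        unfolding K_def by (intro nn_integral_mono) (simp add: ennreal_power ennreal_leI del: ennreal_plus)
    qed auto
    finally show ?thesis .
  qed
  ultimately have "(S\<^sup>2)\<^sup>2 \<le> (W 0 * W 1 * W 2)\<^sup>2"
    by (intro power_mono) auto
  also have "\<dots> \<le> (16 * S * K) * (16 * S * K) * (16 * S * K)"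
    unfolding power_mult_distrib by (intro mult_mono W) auto
  also have "\<dots> = 4096 * K^3 * S^3"
    by (simp add: power3_eq_cube ac_simps)
  finally have "S^4 \<le> 4096 * K^3 * S^3"
    by (simp flip: power_mult)
  moreover have "S < top"
  proof -
    have "(\<phi> p)^6 = 0" if "p \<notin> closure {x. \<phi> x \<noteq> 0}" for p
      using \<phi>'(4)[OF that] by simp
    then have "integrable lborel (\<lambda>p. (\<phi> p)^6)"
      by (intro integrable_continuous_compact_support[OF _ \<phi>'(2)] continuous_on_power
          smooth_continuous \<phi>'(1))
    then have "S = ennreal (\<integral>p. (\<phi> p)^6 \<partial>lborel)"
      unfolding S_def by (intro nn_integral_eq_integral) auto
    then show ?thesis by simp
  qed
  ultimately show ?thesis
    unfolding S_def[symmetric] K_def[symmetric] by (rule ennreal_power_cancel)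
qed

section \<open>The polynomial part of the energy\<close>

text \<open>The integrand is at most \<open>c\<^sup>m\<^sup>+\<^sup>1 \<le> 1 + c\<^sup>6\<close>, where \<open>c\<close> is the maximum of \<open>\<bar>f\<bar>\<close> and \<open>\<bar>g\<bar>\<close>.\<close>

lemma integrable_power_of_integrable_power6:
  fixes f g :: "'a \<Rightarrow> real"
  assumes "finite_measure M"
    and f: "f \<in> borel_measurable M" "integrable M (\<lambda>x. (f x)^6)"
    and g: "g \<in> borel_measurable M" "integrable M (\<lambda>x. (g x)^6)"
    and m: "m \<le> 5"
  shows "integrable M (\<lambda>x. (f x)^m * g x)"
proof -
  interpret finite_measure M by fact
  have "\<bar>a^m * b\<bar> \<le> 1 + a^6 + b^6" for a b :: real
  proof -
    define c where "c = max \<bar>a\<bar> \<bar>b\<bar>"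
    have c: "0 \<le> c" "\<bar>a\<bar> \<le> c" "\<bar>b\<bar> \<le> c" by (auto simp: c_def)
    have "\<bar>a^m * b\<bar> \<le> c^m * c"
      unfolding abs_mult power_abs using c by (intro mult_mono power_mono) auto
    also have "\<dots> = c^(Suc m)"
      by simp
    also have "\<dots> \<le> 1 + c^6"
    proof (cases "c \<le> 1")
      case True
      then have "c^(Suc m) \<le> 1"
        by (intro power_le_one c)
      moreover have "0 \<le> c^6"
        by simp
      ultimately show ?thesis by linarith
    next
      case False
      then have "c^(Suc m) \<le> c^6"
        using m by (intro power_increasing) auto
      then show ?thesis by linarith
    qed
    also have "c^6 \<le> a^6 + b^6"
    proof -
      have "c^6 = a^6 \<or> c^6 = b^6"
        by (auto simp: c_def max_def power_even_abs)
      then show ?thesis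
        using zero_le_even_power[of 6 a] zero_le_even_power[of 6 b] by auto
    qed
    finally show ?thesis by simp
  qed
  moreover have "0 \<le> 1 + a^6 + b^6" for a b :: real
    using zero_le_even_power[of 6 a] zero_le_even_power[of 6 b] by auto
  ultimately have "norm ((f x)^m * g x) \<le> norm (1 + (f x)^6 + (g x)^6)" for x
    by (simp only: real_norm_def abs_of_nonneg)
  then have bound: "AE x in M. norm ((f x)^m * g x) \<le> norm (1 + (f x)^6 + (g x)^6)"
    by simp
  have "integrable M (\<lambda>x. 1 + (f x)^6 + (g x)^6)"
    by (intro Bochner_Integration.integrable_add f g) simp
  moreover have "(\<lambda>x. (f x)^m * g x) \<in> borel_measurable M"
    by (intro borel_measurable_times borel_measurable_power f g)
  ultimately show ?thesis
    using bound by (rule Bochner_Integration.integrable_bound)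
qed

lemma integrable_sextic:
  fixes p :: "'a \<Rightarrow> real^'d"
  assumes M: "finite_measure M"
    and p: "\<And>i. (\<lambda>x. p x $ i) \<in> borel_measurable M" "\<And>i. integrable M (\<lambda>x. (p x $ i)^6)"
  shows "integrable M (\<lambda>x. sextic a b c (p x))"
proof -
  have "integrable M (\<lambda>x. (p x $ i)^2)" "integrable M (\<lambda>x. (p x $ i)^4)" for i
    using integrable_power_of_integrable_power6[OF M p(1)[of i] p(2)[of i] p(1)[of i] p(2)[of i], of 1]
      integrable_power_of_integrable_power6[OF M p(1)[of i] p(2)[of i] p(1)[of i] p(2)[of i], of 3]
    by (simp_all add: power2_eq_square power3_eq_cube power4_eq_xxxx)
  then show ?thesis
    unfolding sextic_def using p(2) by (auto intro!: Bochner_Integration.integrable_sum)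
qed

lemma integrable_D_sextic_inner:
  fixes p q :: "'a \<Rightarrow> real^'d"
  assumes M: "finite_measure M"
    and p: "\<And>i. (\<lambda>x. p x $ i) \<in> borel_measurable M" "\<And>i. integrable M (\<lambda>x. (p x $ i)^6)"
    and q: "\<And>i. (\<lambda>x. q x $ i) \<in> borel_measurable M" "\<And>i. integrable M (\<lambda>x. (q x $ i)^6)"
  shows "integrable M (\<lambda>x. D_sextic a b c (p x) \<bullet> q x)"
proof -
  have *: "integrable M (\<lambda>x. (p x $ i)^m * (q x $ i))" if "m \<le> 5" for m i
    by (rule integrable_power_of_integrable_power6[OF M p q that])
  have "integrable M (\<lambda>x. \<Sum>i\<in>UNIV. 2 * a * ((p x $ i)^1 * (q x $ i)) + 4 * b * ((p x $ i)^3 * (q x $ i))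
      + 6 * c * ((p x $ i)^5 * (q x $ i)))"
    by (intro Bochner_Integration.integrable_sum Bochner_Integration.integrable_add integrable_mult_right *) auto
  also have "(\<lambda>x. \<Sum>i\<in>UNIV. 2 * a * ((p x $ i)^1 * (q x $ i)) + 4 * b * ((p x $ i)^3 * (q x $ i))
      + 6 * c * ((p x $ i)^5 * (q x $ i))) = (\<lambda>x. D_sextic a b c (p x) \<bullet> q x)"
    by (simp add: D_sextic_def inner_vec_def distrib_right mult.assoc)
  finally show ?thesis .
qed

text \<open>
  With nonnegative coefficients \<open>sextic\<close> is convex and lies above its tangents.  For each of the
  powers 2, 4 and 6 the gap is \<open>(t - s)\<^sup>2\<close> times a sum of squares.
\<close>

lemma sextic_tangent:
  assumes "0 \<le> a" "0 \<le> b" "0 \<le> c"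
  shows "sextic a b c p + D_sextic a b c p \<bullet> (q - p) \<le> sextic a b c q"
proof -
  have 2: "s^2 + 2 * s * (t - s) \<le> t^2" for s t :: real
  proof -
    have "t^2 - (s^2 + 2 * s * (t - s)) = (t - s)^2"
      by (simp add: power2_eq_square algebra_simps)
    moreover have "0 \<le> (t - s)^2" by simp
    ultimately show ?thesis by linarith
  qed
  have 4: "s^4 + 4 * s^3 * (t - s) \<le> t^4" for s t :: real
  proof -
    have "t^4 - (s^4 + 4 * s^3 * (t - s)) = (t - s)^2 * ((t + s)^2 + 2 * s^2)"
      by (simp add: eval_nat_numeral algebra_simps)
    moreover have "0 \<le> (t - s)^2 * ((t + s)^2 + 2 * s^2)"
      by (intro mult_nonneg_nonneg add_nonneg_nonneg) auto
    ultimately show ?thesis by linarith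
  qed
  have 6: "s^6 + 6 * s^5 * (t - s) \<le> t^6" for s t :: real
  proof -
    have "t^6 - (s^6 + 6 * s^5 * (t - s)) = (t - s)^2 * ((t^2 + t * s)^2 + 2 * (t * s + s^2)^2 + 3 * (s^2)^2)"
      by (simp add: eval_nat_numeral algebra_simps)
    moreover have "0 \<le> (t - s)^2 * ((t^2 + t * s)^2 + 2 * (t * s + s^2)^2 + 3 * (s^2)^2)"
      by (intro mult_nonneg_nonneg add_nonneg_nonneg) auto
    ultimately show ?thesis by linarith
  qed
  have "sextic a b c p + D_sextic a b c p \<bullet> (q - p) = (\<Sum>i\<in>UNIV. a * ((p $ i)^2 + 2 * (p $ i) * (q $ i - p $ i))
     + b * ((p $ i)^4 + 4 * (p $ i)^3 * (q $ i - p $ i)) + c * ((p $ i)^6 + 6 * (p $ i)^5 * (q $ i - p $ i)))"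
    by (simp add: sextic_def D_sextic_def inner_vec_def algebra_simps flip: sum.distrib)
  also have "\<dots> \<le> sextic a b c q"
    unfolding sextic_def using assms by (intro sum_mono add_mono mult_left_mono 2 4 6)
  finally show ?thesis .
qed

section \<open>The quadratic part of the energy\<close>

lemma half_diff_L2_norm_power2_le_L2_inner:
  assumes "f \<in> L2 M" "g \<in> L2 M"
  shows "((L2_norm M f)\<^sup>2 - (L2_norm M g)\<^sup>2) / 2 \<le> L2_inner M f f - L2_inner M g f"
proof -
  have "L2_inner M f f = (L2_norm M f)\<^sup>2"
    unfolding L2_norm_power2 L2_inner_def power2_norm_eq_inner ..
  moreover have "0 \<le> (L2_norm M (\<lambda>x. f x - g x))\<^sup>2"
    by simp
  ultimately show ?thesis
    using L2_norm_diff_power2[OF assms] by (simp add: L2_inner_commute[of M g f])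
qed

lemma grad_inner_diff_ge:
  fixes \<Omega> :: "(real^'d) set"
  assumes \<Omega>: "open \<Omega>" "bounded \<Omega>" and p: "\<And>i. (\<lambda>x. p x $ i) \<in> H1 \<Omega>" and q: "\<And>i. (\<lambda>x. q x $ i) \<in> H1 \<Omega>"
  shows "(\<Sum>i\<in>UNIV. ((L2_norm (lebesgue_on \<Omega>) (weak_gradient \<Omega> (\<lambda>x. q x $ i)))\<^sup>2
      - (L2_norm (lebesgue_on \<Omega>) (weak_gradient \<Omega> (\<lambda>x. p x $ i)))\<^sup>2) / 2)
    \<le> grad_inner \<Omega> q (\<lambda>x. q x - p x)"
  unfolding grad_inner_def
proof (rule sum_mono)
  fix i
  let ?M = "lebesgue_on \<Omega>" and ?q = "weak_gradient \<Omega> (\<lambda>x. q x $ i)" and ?p = "weak_gradient \<Omega> (\<lambda>x. p x $ i)"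
  have L2: "?q \<in> L2 ?M" "?p \<in> L2 ?M"
    by (intro weak_gradient_L2 p q)+
  have "(\<lambda>x. q x $ i - p x $ i) \<in> H1 \<Omega>"
    using \<Omega> by (intro H1_diff p q) auto
  then have D: "weak_gradient \<Omega> (\<lambda>x. q x $ i - p x $ i) \<in> L2 ?M"
    by (rule weak_gradient_L2)
  have "L2_inner ?M ?q (weak_gradient \<Omega> (\<lambda>x. (q x - p x) $ i)) = L2_inner ?M ?q (\<lambda>x. ?q x - ?p x)"
    unfolding L2_inner_def vector_minus_component
  proof (rule integral_cong_AE)
    show "AE x in ?M. ?q x \<bullet> weak_gradient \<Omega> (\<lambda>x. q x $ i - p x $ i) x = ?q x \<bullet> (?q x - ?p x)"
      using weak_gradient_diff[OF \<Omega> q[of i] p[of i]] by eventually_elim simp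
  qed (intro borel_measurable_inner L2_measurable L2 D L2_diff)+
  also have "\<dots> = L2_inner ?M ?q ?q - L2_inner ?M ?p ?q"
    using L2_inner_diff_left[OF L2 L2(1)] by (simp add: L2_inner_commute)
  finally show "((L2_norm ?M ?q)\<^sup>2 - (L2_norm ?M ?p)\<^sup>2) / 2 \<le> L2_inner ?M ?q (weak_gradient \<Omega> (\<lambda>x. (q x - p x) $ i))"
    using half_diff_L2_norm_power2_le_L2_inner[OF L2] by simp
qed

lemma weak_div_L2:
  assumes "\<And>i. (\<lambda>x. p x $ i) \<in> H1 \<Omega>"
  shows "weak_div \<Omega> p \<in> L2 (lebesgue_on \<Omega>)"
  unfolding weak_div_def[abs_def]
  by (rule L2_sum[OF finite], rule L2_component, rule weak_gradient_L2, rule assms)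

lemma weak_div_diff:
  fixes \<Omega> :: "(real^'d) set"
  assumes \<Omega>: "open \<Omega>" "bounded \<Omega>" and p: "\<And>i. (\<lambda>x. p x $ i) \<in> H1 \<Omega>" and q: "\<And>i. (\<lambda>x. q x $ i) \<in> H1 \<Omega>"
  shows "AE x in lebesgue_on \<Omega>. weak_div \<Omega> (\<lambda>x. q x - p x) x = weak_div \<Omega> q x - weak_div \<Omega> p x"
proof -
  have "AE x in lebesgue_on \<Omega>. \<forall>i. weak_gradient \<Omega> (\<lambda>x. q x $ i - p x $ i) x
      = weak_gradient \<Omega> (\<lambda>x. q x $ i) x - weak_gradient \<Omega> (\<lambda>x. p x $ i) x"
    unfolding AE_all_countable using weak_gradient_diff[OF \<Omega> q p] by blast
  then show ?thesis
    by eventually_elim (simp add: weak_div_def sum_subtractf)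
qed

lemma L2_inner_weak_gradient_eq_weak_div:
  fixes \<Omega> :: "(real^'d) set"
  assumes \<Omega>: "open \<Omega>" "bounded \<Omega>" and v: "v \<in> H1 \<Omega>" and p: "p \<in> H10_vec \<Omega>"
  shows "L2_inner (lebesgue_on \<Omega>) (weak_gradient \<Omega> v) p = - L2_inner (lebesgue_on \<Omega>) (weak_div \<Omega> p) v"
proof -
  let ?M = "lebesgue_on \<Omega>"
  have p': "(\<lambda>x. p x $ i) \<in> H10 \<Omega>" "(\<lambda>x. p x $ i) \<in> H1 \<Omega>" for i
    using p by (auto simp: H10_vec_def H10_def)
  have "L2_inner ?M (weak_gradient \<Omega> v) p = (\<Sum>i\<in>UNIV. \<integral>x. weak_gradient \<Omega> v x $ i * p x $ i \<partial>?M)"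
    unfolding L2_inner_def inner_vec_def inner_real_def
    by (intro Bochner_Integration.integral_sum L2_mult_integrable L2_component weak_gradient_L2 v H1_L2 p')
  also have "\<dots> = (\<Sum>i\<in>UNIV. - (\<integral>x. v x * weak_gradient \<Omega> (\<lambda>x. p x $ i) x $ i \<partial>?M))"
    by (intro sum.cong refl H10_integration_by_parts \<Omega> v p')
  also have "\<dots> = - (\<Sum>i\<in>UNIV. (\<integral>x. v x * weak_gradient \<Omega> (\<lambda>x. p x $ i) x $ i \<partial>?M))"
    by (simp add: sum_negf)
  also have "(\<Sum>i\<in>UNIV. (\<integral>x. v x * weak_gradient \<Omega> (\<lambda>x. p x $ i) x $ i \<partial>?M)) =
      (\<integral>x. (\<Sum>i\<in>UNIV. v x * weak_gradient \<Omega> (\<lambda>x. p x $ i) x $ i) \<partial>?M)"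
    by (intro Bochner_Integration.integral_sum[symmetric] L2_mult_integrable L2_component weak_gradient_L2 v H1_L2 p')
  also have "\<dots> = L2_inner ?M (weak_div \<Omega> p) v"
    by (simp add: L2_inner_def weak_div_def sum_distrib_left mult.commute)
  finally show ?thesis .
qed

text \<open>
  The coupling \<open>(\<nabla>V\<^sub>q, q - p)\<close> equals \<open>\<epsilon> (\<nabla>V\<^sub>q - \<nabla>V\<^sub>p, \<nabla>V\<^sub>q)\<close>: after integration by parts, the
  equations for \<open>V\<^sub>q\<close> and \<open>V\<^sub>p\<close> are both tested with \<open>V\<^sub>q\<close>, which lies in \<open>V_D\<close>.
\<close>

lemma potential_coupling_ge:
  fixes \<Omega> :: "(real^'d) set"
  assumes \<Omega>: "open \<Omega>" "bounded \<Omega>" and \<Phi>: "solution_operator \<Omega> \<Gamma>\<^sub>D \<epsilon> \<Phi>" and \<rho>: "\<rho> \<in> L2 (lebesgue_on \<Omega>)"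
    and \<epsilon>: "\<epsilon> > 0" and p: "p \<in> H10_vec \<Omega>" and q: "q \<in> H10_vec \<Omega>" and D: "(\<lambda>x. q x - p x) \<in> H10_vec \<Omega>"
  shows "\<epsilon> / 2 * ((L2_norm (lebesgue_on \<Omega>) (weak_gradient \<Omega> (potential \<Omega> \<Phi> \<rho> q)))\<^sup>2
      - (L2_norm (lebesgue_on \<Omega>) (weak_gradient \<Omega> (potential \<Omega> \<Phi> \<rho> p)))\<^sup>2)
    \<le> L2_inner (lebesgue_on \<Omega>) (weak_gradient \<Omega> (potential \<Omega> \<Phi> \<rho> q)) (\<lambda>x. q x - p x)"
proof -
  let ?M = "lebesgue_on \<Omega>" and ?h = "\<lambda>p x. \<rho> x - weak_div \<Omega> p x" and ?V = "potential \<Omega> \<Phi> \<rho>"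
  let ?G = "\<lambda>p. weak_gradient \<Omega> (?V p)"
  have p': "(\<lambda>x. p x $ i) \<in> H1 \<Omega>" and q': "(\<lambda>x. q x $ i) \<in> H1 \<Omega>" for i
    using p q by (auto simp: H10_vec_def H10_def)
  have h: "?h p \<in> L2 ?M" "?h q \<in> L2 ?M"
    by (intro L2_diff \<rho> weak_div_L2 p' q')+
  have ws: "weak_solution \<Omega> \<Gamma>\<^sub>D \<epsilon> (?h p) (?V p)" "weak_solution \<Omega> \<Gamma>\<^sub>D \<epsilon> (?h q) (?V q)"
    using \<Phi> h unfolding solution_operator_def potential_def by auto
  then have V: "?V p \<in> H1 \<Omega>" "?V q \<in> H1 \<Omega>"
    by (auto simp: weak_solution_def V_D_def)
  note G = V[THEN weak_gradient_L2]
  have scale: "L2_inner ?M (\<lambda>x. \<epsilon> *\<^sub>R f x) f' = \<epsilon> * L2_inner ?M f f'" for f f' :: "real^'d \<Rightarrow> real^'d"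
    by (simp add: L2_inner_def)
  have "L2_inner ?M (?G q) (\<lambda>x. q x - p x) = - L2_inner ?M (weak_div \<Omega> (\<lambda>x. q x - p x)) (?V q)"
    by (rule L2_inner_weak_gradient_eq_weak_div[OF \<Omega> V(2) D])
  also have "L2_inner ?M (weak_div \<Omega> (\<lambda>x. q x - p x)) (?V q) = L2_inner ?M (\<lambda>x. ?h p x - ?h q x) (?V q)"
    unfolding L2_inner_def
  proof (rule integral_cong_AE)
    show "AE x in ?M. weak_div \<Omega> (\<lambda>x. q x - p x) x \<bullet> ?V q x = (?h p x - ?h q x) \<bullet> ?V q x"
      using weak_div_diff[OF \<Omega> p' q'] by eventually_elim simp
    have "(\<lambda>x. (q x - p x) $ i) \<in> H1 \<Omega>" for i
      using D by (simp add: H10_vec_def H10_def)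
    then show "(\<lambda>x. weak_div \<Omega> (\<lambda>x. q x - p x) x \<bullet> ?V q x) \<in> borel_measurable ?M"
      using V by (intro borel_measurable_inner L2_measurable weak_div_L2 H1_L2)
    show "(\<lambda>x. (?h p x - ?h q x) \<bullet> ?V q x) \<in> borel_measurable ?M"
      using V h by (intro borel_measurable_inner L2_measurable[OF L2_diff] L2_measurable[OF H1_L2])
  qed
  also have "\<dots> = L2_inner ?M (?h p) (?V q) - L2_inner ?M (?h q) (?V q)"
    by (intro L2_inner_diff_left h H1_L2 V)
  also have "L2_inner ?M (?h p) (?V q) = \<epsilon> * L2_inner ?M (?G p) (?G q)"
    using ws by (auto simp: weak_solution_def scale)
  also have "L2_inner ?M (?h q) (?V q) = \<epsilon> * L2_inner ?M (?G q) (?G q)"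
    using ws by (auto simp: weak_solution_def scale)
  finally have "L2_inner ?M (?G q) (\<lambda>x. q x - p x) = \<epsilon> * (L2_inner ?M (?G q) (?G q) - L2_inner ?M (?G p) (?G q))"
    by (simp add: algebra_simps)
  also have "\<dots> \<ge> \<epsilon> * (((L2_norm ?M (?G q))\<^sup>2 - (L2_norm ?M (?G p))\<^sup>2) / 2)"
    using half_diff_L2_norm_power2_le_L2_inner[OF G(2,1)] \<epsilon> by (intro mult_left_mono) auto
  finally show ?thesis
    by simp
qed

section \<open>The Sobolev embedding and the energy estimate\<close>

lemma nn_integral_lebesgue_on_le_lborel:
  fixes f :: "'a::euclidean_space \<Rightarrow> ennreal"
  assumes "f \<in> borel_measurable borel" "\<Omega> \<in> sets lebesgue"
  shows "(\<integral>\<^sup>+x. f x \<partial>lebesgue_on \<Omega>) \<le> (\<integral>\<^sup>+x. f x \<partial>lborel)"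
proof -
  have "(\<integral>\<^sup>+x. f x \<partial>lebesgue_on \<Omega>) = (\<integral>\<^sup>+x. f x * indicator \<Omega> x \<partial>lebesgue)"
    using assms(2) by (simp add: nn_integral_restrict_space)
  also have "\<dots> \<le> (\<integral>\<^sup>+x. f x \<partial>lebesgue)"
    by (intro nn_integral_mono) (simp add: indicator_def)
  also have "\<dots> = (\<integral>\<^sup>+x. f x \<partial>lborel)"
    using assms(1) by (simp add: nn_integral_completion)
  finally show ?thesis .
qed

lemma test_function_L2_norm:
  assumes "\<phi> \<in> test_functions \<Omega>" "\<Omega> \<in> sets lebesgue"
  shows "(\<integral>\<^sup>+p. ennreal ((\<phi> p)\<^sup>2 + (norm (grad \<phi> p))\<^sup>2) \<partial>lborel) =
    ennreal ((L2_norm (lebesgue_on \<Omega>) \<phi>)\<^sup>2 + (L2_norm (lebesgue_on \<Omega>) (grad \<phi>))\<^sup>2)"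
proof -
  note \<phi> = test_functionD[OF assms(1)]
  let ?K = "closure {x. \<phi> x \<noteq> 0}"
  have transfer: "integrable lborel f" "(\<integral>p. f p \<partial>lebesgue_on \<Omega>) = (\<integral>p. f p \<partial>lborel)"
    if f: "continuous_on UNIV f" "\<And>x. x \<notin> ?K \<Longrightarrow> f x = 0" for f :: "real^'a \<Rightarrow> real"
  proof -
    show "integrable lborel f"
      by (rule integrable_continuous_compact_support[OF f(1) \<phi>(2) f(2)])
    have "f x = 0" if "x \<notin> \<Omega>" for x
      by (rule f(2)) (use \<phi>(3) that in blast)
    then show "(\<integral>p. f p \<partial>lebesgue_on \<Omega>) = (\<integral>p. f p \<partial>lborel)"
      by (rule integral_lebesgue_on_eq_lborel[OF borel_measurable_continuous_onI[OF f(1)] assms(2)])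
  qed
  have grad: "(norm (grad \<phi> p))\<^sup>2 = (\<Sum>i\<in>UNIV. (partial_deriv i \<phi> p)\<^sup>2)" for p
    by (simp add: grad_def norm_vec_def L2_set_def sum_nonneg)
  have cont: "continuous_on UNIV (\<lambda>p. (\<phi> p)\<^sup>2)" "continuous_on UNIV (\<lambda>p. (norm (grad \<phi> p))\<^sup>2)"
    unfolding grad by (intro continuous_on_power continuous_on_sum smooth_continuous smooth_partial_deriv \<phi>(1))+
  have zero: "(\<phi> x)\<^sup>2 = 0" "(norm (grad \<phi> x))\<^sup>2 = 0" if "x \<notin> ?K" for x
    using \<phi>(4)[OF that] \<phi>(5)[OF that] unfolding grad by simp_all
  note int = transfer(1)[OF cont(1) zero(1)] transfer(1)[OF cont(2) zero(2)]
    and eq = transfer(2)[OF cont(1) zero(1)] transfer(2)[OF cont(2) zero(2)]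
  have "(\<integral>\<^sup>+p. ennreal ((\<phi> p)\<^sup>2 + (norm (grad \<phi> p))\<^sup>2) \<partial>lborel) = ennreal (\<integral>p. (\<phi> p)\<^sup>2 + (norm (grad \<phi> p))\<^sup>2 \<partial>lborel)"
    by (intro nn_integral_eq_integral Bochner_Integration.integrable_add int AE_I2
        add_nonneg_nonneg zero_le_power2)
  also have "(\<integral>p. (\<phi> p)\<^sup>2 + (norm (grad \<phi> p))\<^sup>2 \<partial>lborel) =
      (L2_norm (lebesgue_on \<Omega>) \<phi>)\<^sup>2 + (L2_norm (lebesgue_on \<Omega>) (grad \<phi>))\<^sup>2"
    unfolding L2_norm_power2 using int eq by simp
  finally show ?thesis .
qed

text \<open>
  The approximating test functions are bounded in the norm of \<open>H1\<close>, hence by the Sobolev inequality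
  in \<open>L\<^sup>6\<close>, and a subsequence converges almost everywhere, so Fatou's lemma bounds the limit.
\<close>

lemma H10_integrable_power6:
  fixes \<Omega> :: "(real^'d) set"
  assumes d: "CARD('d) \<le> 3" and \<Omega>: "open \<Omega>" "bounded \<Omega>" and u: "u \<in> H10 \<Omega>"
  shows "integrable (lebesgue_on \<Omega>) (\<lambda>x. (u x)^6)"
proof -
  let ?M = "lebesgue_on \<Omega>"
  have \<Omega>': "\<Omega> \<in> sets lebesgue"
    using \<Omega> by auto
  from u obtain \<phi> where \<phi>: "u \<in> H1 \<Omega>" "\<And>k::nat. \<phi> k \<in> test_functions \<Omega>"
    "(\<lambda>k. L2_norm ?M (\<lambda>x. u x - \<phi> k x)) \<longlonglongrightarrow> 0" "(\<lambda>k. L2_norm ?M (\<lambda>x. weak_gradient \<Omega> u x - grad (\<phi> k) x)) \<longlonglongrightarrow> 0"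
    unfolding H10_iff[OF \<Omega>] by auto
  have bounded: "\<exists>a. \<forall>k. L2_norm ?M (\<psi> k) \<le> a"
    if "v \<in> L2 ?M" "\<And>k. \<psi> k \<in> L2 ?M" "(\<lambda>k. L2_norm ?M (\<lambda>x. v x - \<psi> k x)) \<longlonglongrightarrow> 0"
    for v :: "real^'d \<Rightarrow> 'b::euclidean_space" and \<psi> :: "nat \<Rightarrow> real^'d \<Rightarrow> 'b"
  proof -
    have "Bseq (\<lambda>k. L2_norm ?M (\<lambda>x. v x - \<psi> k x))"
      using that(3) by (intro convergent_imp_Bseq convergentI)
    then obtain K where K: "\<And>k. norm (L2_norm ?M (\<lambda>x. v x - \<psi> k x)) \<le> K"
      unfolding Bseq_def by blast
    have "L2_norm ?M (\<psi> k) \<le> L2_norm ?M v + K" for k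
      using L2_norm_triangle_diff[OF that(1) L2_diff[OF that(1,2)], of k] K[of k] by simp
    then show ?thesis
      by blast
  qed
  obtain a where a: "\<And>k. L2_norm ?M (\<phi> k) \<le> a"
    using bounded[OF H1_L2[OF \<phi>(1)] test_function_L2(1)[OF \<phi>(2) \<Omega>'] \<phi>(3)] by blast
  obtain b where b: "\<And>k. L2_norm ?M (grad (\<phi> k)) \<le> b"
    using bounded[OF weak_gradient_L2[OF \<phi>(1)] test_function_grad_L2[OF \<phi>(2) \<Omega>'] \<phi>(4)] by blast
  have cont: "continuous_on UNIV (\<phi> k)" for k
    using test_functionD(1)[OF \<phi>(2)] by (rule smooth_continuous)
  have bound: "(\<integral>\<^sup>+x. ennreal ((\<phi> k x)^6) \<partial>?M) \<le> 4096 * ennreal (a\<^sup>2 + b\<^sup>2)^3" for k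
  proof -
    have "(\<integral>\<^sup>+x. ennreal ((\<phi> k x)^6) \<partial>?M) \<le> (\<integral>\<^sup>+x. ennreal ((\<phi> k x)^6) \<partial>lborel)"
    proof (rule nn_integral_lebesgue_on_le_lborel[OF _ \<Omega>'])
      have "\<phi> k \<in> borel_measurable borel"
        by (rule borel_measurable_continuous_onI[OF cont])
      then show "(\<lambda>x. ennreal ((\<phi> k x)^6)) \<in> borel_measurable borel"
        by measurable
    qed
    also have "\<dots> \<le> 4096 * ennreal ((L2_norm ?M (\<phi> k))\<^sup>2 + (L2_norm ?M (grad (\<phi> k)))\<^sup>2)^3"
      using sobolev_test_function[OF d \<phi>(2)] unfolding test_function_L2_norm[OF \<phi>(2) \<Omega>'] .
    also have "\<dots> \<le> 4096 * ennreal (a\<^sup>2 + b\<^sup>2)^3"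
      by (intro mult_left_mono power_mono ennreal_leI add_mono a b L2_norm_nonneg) auto
    finally show ?thesis .
  qed
  \<comment> \<open>Convergence in \<open>L\<^sup>2\<close> is convergence in \<open>L\<^sup>1\<close> of the squares of the differences.\<close>
  have "\<exists>r. strict_mono (r::nat\<Rightarrow>nat) \<and> (AE x in ?M. (\<lambda>n. (u x - \<phi> (r n) x)\<^sup>2) \<longlonglongrightarrow> 0)"
  proof (rule tendsto_L1_AE_subseq)
    show "integrable ?M (\<lambda>x. (u x - \<phi> k x)\<^sup>2)" for k
      using L2_integrable_norm[OF L2_diff[OF H1_L2[OF \<phi>(1)] test_function_L2(1)[OF \<phi>(2) \<Omega>']]] by simp
    have "(\<lambda>k. (L2_norm ?M (\<lambda>x. u x - \<phi> k x))\<^sup>2) \<longlonglongrightarrow> 0\<^sup>2"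
      by (intro tendsto_power \<phi>(3))
    then show "(\<lambda>k. \<integral>x. norm ((u x - \<phi> k x)\<^sup>2) \<partial>?M) \<longlonglongrightarrow> 0"
      by (simp add: L2_norm_power2)
  qed
  then obtain r where r: "AE x in ?M. (\<lambda>n. (u x - \<phi> (r n) x)\<^sup>2) \<longlonglongrightarrow> 0"
    by blast
  have lim: "AE x in ?M. (\<lambda>n. ennreal ((\<phi> (r n) x)^6)) \<longlonglongrightarrow> ennreal ((u x)^6)"
    using r
  proof eventually_elim
    case (elim x)
    have "(\<lambda>n. sqrt ((u x - \<phi> (r n) x)\<^sup>2)) \<longlonglongrightarrow> sqrt 0"
      by (intro tendsto_real_sqrt elim)
    then have "(\<lambda>n. \<bar>u x - \<phi> (r n) x\<bar>) \<longlonglongrightarrow> 0"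
      by simp
    then have "(\<lambda>n. u x - \<phi> (r n) x) \<longlonglongrightarrow> 0"
      by (rule tendsto_rabs_zero_cancel)
    then have "(\<lambda>n. u x - (u x - \<phi> (r n) x)) \<longlonglongrightarrow> u x - 0"
      by (intro tendsto_diff tendsto_const)
    then have "(\<lambda>n. \<phi> (r n) x) \<longlonglongrightarrow> u x"
      by simp
    then show ?case
      by (intro tendsto_ennrealI tendsto_power)
  qed
  have um: "u \<in> borel_measurable ?M" and [measurable]: "\<phi> k \<in> borel_measurable ?M" for k
    using L2_measurable[OF H1_L2[OF \<phi>(1)]] L2_measurable[OF test_function_L2(1)[OF \<phi>(2) \<Omega>']] by auto
  have "(\<integral>\<^sup>+x. ennreal ((u x)^6) \<partial>?M) = (\<integral>\<^sup>+x. liminf (\<lambda>n. ennreal ((\<phi> (r n) x)^6)) \<partial>?M)"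
  proof (rule nn_integral_cong_AE)
    show "AE x in ?M. ennreal ((u x)^6) = liminf (\<lambda>n. ennreal ((\<phi> (r n) x)^6))"
      using lim by eventually_elim (rule lim_imp_Liminf[OF sequentially_bot, symmetric])
  qed
  also have "\<dots> \<le> liminf (\<lambda>n. \<integral>\<^sup>+x. ennreal ((\<phi> (r n) x)^6) \<partial>?M)"
    by (intro nn_integral_liminf) measurable
  also have "\<dots> \<le> liminf (\<lambda>n::nat. 4096 * ennreal (a\<^sup>2 + b\<^sup>2)^3)"
    using bound by (intro Liminf_mono) auto
  also have "\<dots> = 4096 * ennreal (a\<^sup>2 + b\<^sup>2)^3"
    by (simp add: Liminf_const)
  also have "\<dots> < \<infinity>"
    by (simp add: ennreal_power ennreal_mult_less_top del: ennreal_plus)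
  finally have fin: "(\<integral>\<^sup>+x. ennreal ((u x)^6) \<partial>?M) < \<infinity>" .
  show ?thesis
  proof (rule integrableI_bounded)
    show "(\<lambda>x. (u x)^6) \<in> borel_measurable ?M"
      using um by (rule borel_measurable_power)
    show "(\<integral>\<^sup>+x. ennreal (norm ((u x)^6)) \<partial>?M) < \<infinity>"
      using fin by simp
  qed
qed

text \<open>
  Splitting the integral that defines the energy needs the integrability of each part; for the
  polynomial part this is where the sixth powers enter.
\<close>

lemma energy_eq:
  fixes \<Omega> :: "(real^'d) set"
  assumes fin: "finite_measure (lebesgue_on \<Omega>)" and V: "potential \<Omega> \<Phi> \<rho> p \<in> H1 \<Omega>"
    and p: "\<And>i. (\<lambda>x. p x $ i) \<in> H1 \<Omega>" "\<And>i. integrable (lebesgue_on \<Omega>) (\<lambda>x. (p x $ i)^6)"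
  shows "energy \<Omega> \<Phi> \<rho> \<epsilon> \<alpha> \<beta> \<gamma> g p = \<epsilon> / 2 * (L2_norm (lebesgue_on \<Omega>) (weak_gradient \<Omega> (potential \<Omega> \<Phi> \<rho> p)))\<^sup>2
    + ((\<integral>x. F_plus \<alpha> \<beta> \<gamma> (p x) \<partial>lebesgue_on \<Omega>) - (\<integral>x. F_minus \<alpha> \<beta> \<gamma> (p x) \<partial>lebesgue_on \<Omega>))
    + (\<Sum>i\<in>UNIV. g / 2 * (L2_norm (lebesgue_on \<Omega>) (weak_gradient \<Omega> (\<lambda>x. p x $ i)))\<^sup>2)"
proof -
  have "integrable (lebesgue_on \<Omega>) (\<lambda>x. sextic a b c (p x))" for a b c
    by (rule integrable_sextic[OF fin L2_measurable[OF H1_L2[OF p(1)]] p(2)])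
  then show ?thesis
    using L2_integrable_norm[OF weak_gradient_L2[OF V]] L2_integrable_norm[OF weak_gradient_L2[OF p(1)]]
    by (simp add: energy_def L2_norm_power2 F_total_def F_plus_def F_minus_def)
qed

text \<open>
  The first inequality uses the tangent at \<open>p\<close> and serves the explicit term \<open>F\<^sup>-\<close> of the scheme, the
  second uses the tangent at \<open>q\<close> and serves the implicit term \<open>F\<^sup>+\<close>.
\<close>

lemma integral_sextic_tangent:
  fixes p q :: "'a \<Rightarrow> real^'d"
  assumes fin: "finite_measure M"
    and p: "\<And>i. (\<lambda>x. p x $ i) \<in> borel_measurable M" "\<And>i. integrable M (\<lambda>x. (p x $ i)^6)"
    and q: "\<And>i. (\<lambda>x. q x $ i) \<in> borel_measurable M" "\<And>i. integrable M (\<lambda>x. (q x $ i)^6)"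
    and r: "\<And>i. (\<lambda>x. (q x - p x) $ i) \<in> borel_measurable M" "\<And>i. integrable M (\<lambda>x. ((q x - p x) $ i)^6)"
    and abc: "0 \<le> a" "0 \<le> b" "0 \<le> c"
  shows "(\<integral>x. sextic a b c (p x) \<partial>M) + (\<integral>x. D_sextic a b c (p x) \<bullet> (q x - p x) \<partial>M) \<le> (\<integral>x. sextic a b c (q x) \<partial>M)"
    and "(\<integral>x. sextic a b c (q x) \<partial>M) \<le> (\<integral>x. sextic a b c (p x) \<partial>M) + (\<integral>x. D_sextic a b c (q x) \<bullet> (q x - p x) \<partial>M)"
proof -
  note int = integrable_sextic[OF fin p, of a b c] integrable_sextic[OF fin q, of a b c]
    integrable_D_sextic_inner[OF fin p r, of a b c] integrable_D_sextic_inner[OF fin q r, of a b c]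
  have "(\<integral>x. sextic a b c (p x) + D_sextic a b c (p x) \<bullet> (q x - p x) \<partial>M) \<le> (\<integral>x. sextic a b c (q x) \<partial>M)"
    by (intro integral_mono Bochner_Integration.integrable_add int sextic_tangent abc)
  then show "(\<integral>x. sextic a b c (p x) \<partial>M) + (\<integral>x. D_sextic a b c (p x) \<bullet> (q x - p x) \<partial>M) \<le> (\<integral>x. sextic a b c (q x) \<partial>M)"
    using int by simp
  have "sextic a b c (q x) - D_sextic a b c (q x) \<bullet> (q x - p x) \<le> sextic a b c (p x)" for x
    using sextic_tangent[OF abc, of "q x" "p x"] by (simp add: inner_diff_right)
  then have "(\<integral>x. sextic a b c (q x) - D_sextic a b c (q x) \<bullet> (q x - p x) \<partial>M) \<le> (\<integral>x. sextic a b c (p x) \<partial>M)"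
    by (intro integral_mono Bochner_Integration.integrable_diff int)
  then show "(\<integral>x. sextic a b c (q x) \<partial>M) \<le> (\<integral>x. sextic a b c (p x) \<partial>M) + (\<integral>x. D_sextic a b c (q x) \<bullet> (q x - p x) \<partial>M)"
    using int by simp
qed

theorem proposition4p2:
  fixes \<Omega> \<Gamma>\<^sub>D \<Gamma>\<^sub>N :: "(real^'d) set"
    and \<epsilon> \<rho>\<^sub>v \<alpha> \<beta> \<gamma> g T \<tau> :: real
    and N :: nat
    and \<rho> :: "real^'d \<Rightarrow> real"
    and \<Phi> :: "(real^'d \<Rightarrow> real) \<Rightarrow> (real^'d \<Rightarrow> real)"
    and P\<^sub>0 :: "real^'d \<Rightarrow> real^'d"
    and P :: "nat \<Rightarrow> real^'d \<Rightarrow> real^'d"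
  assumes "CARD('d) \<le> 3"
    and "open \<Omega>" and "connected \<Omega>" and "\<Omega> \<noteq> {}" and "bounded \<Omega>" and "lipschitz_boundary \<Omega>"
    and "frontier \<Omega> = \<Gamma>\<^sub>D \<union> \<Gamma>\<^sub>N" and "\<Gamma>\<^sub>D \<inter> \<Gamma>\<^sub>N = {}"
    and "\<Gamma>\<^sub>D \<in> sets (surface_measure \<Omega>)" and "emeasure (surface_measure \<Omega>) \<Gamma>\<^sub>D > 0"
    and "\<epsilon> > 0" and "\<rho>\<^sub>v > 0"
    and "\<rho> \<in> L2 (lebesgue_on \<Omega>)"
    and "P\<^sub>0 \<in> H10_vec \<Omega>"
    and "solution_operator \<Omega> \<Gamma>\<^sub>D \<epsilon> \<Phi>"
    and "(\<gamma> > 0 \<and> g > 0) \<or> (\<gamma> = 0 \<and> \<beta> > 0 \<and> g > 0)"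
    and "T > 0" and "N > 0" and "\<tau> = T / real N"
    and "\<forall>n\<le>N. P n \<in> H10_vec \<Omega>"
    and "P 0 = P\<^sub>0"
    and "\<forall>n<N. \<forall>Q\<in>H10_vec \<Omega>.
           \<rho>\<^sub>v / \<tau> * L2_inner (lebesgue_on \<Omega>) (\<lambda>x. P (Suc n) x - P n x) Q
           + g * grad_inner \<Omega> (P (Suc n)) Q
           + L2_inner (lebesgue_on \<Omega>) (\<lambda>x. DF_plus \<alpha> \<beta> \<gamma> (P (Suc n) x)) Q
           + L2_inner (lebesgue_on \<Omega>) (weak_gradient \<Omega> (potential \<Omega> \<Phi> \<rho> (P (Suc n)))) Q
           = L2_inner (lebesgue_on \<Omega>) (\<lambda>x. DF_minus \<alpha> \<beta> \<gamma> (P n x)) Q"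
  shows "\<forall>n<N. energy \<Omega> \<Phi> \<rho> \<epsilon> \<alpha> \<beta> \<gamma> g (P (Suc n)) \<le> energy \<Omega> \<Phi> \<rho> \<epsilon> \<alpha> \<beta> \<gamma> g (P n)"
proof (intro allI impI)
  fix n assume n: "n < N"
  note \<Omega> = \<open>open \<Omega>\<close> \<open>bounded \<Omega>\<close> and \<Phi> = \<open>solution_operator \<Omega> \<Gamma>\<^sub>D \<epsilon> \<Phi>\<close>
    and \<rho> = \<open>\<rho> \<in> L2 (lebesgue_on \<Omega>)\<close>
  let ?M = "lebesgue_on \<Omega>"
  let ?p = "P n" and ?q = "P (Suc n)"
  let ?D = "\<lambda>x. ?q x - ?p x"
  let ?V = "potential \<Omega> \<Phi> \<rho>"
  let ?G = "\<lambda>p. (L2_norm ?M (weak_gradient \<Omega> (?V p)))\<^sup>2"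
  let ?g = "\<lambda>p i. (L2_norm ?M (weak_gradient \<Omega> (\<lambda>x. p x $ i)))\<^sup>2"
  let ?Fp = "\<lambda>p. \<integral>x. F_plus \<alpha> \<beta> \<gamma> (p x) \<partial>?M" and ?Fm = "\<lambda>p. \<integral>x. F_minus \<alpha> \<beta> \<gamma> (p x) \<partial>?M"
  have fin: "finite_measure ?M"
    using \<Omega> by (intro finite_measure_lebesgue_on lmeasurable_open)
  have p: "?p \<in> H10_vec \<Omega>" and q: "?q \<in> H10_vec \<Omega>"
    using assms(20) n by auto
  then have D: "?D \<in> H10_vec \<Omega>"
    using H10_diff[OF \<Omega>] by (simp add: H10_vec_def)
  have H1: "(\<lambda>x. w x $ i) \<in> H1 \<Omega>" and m: "(\<lambda>x. w x $ i) \<in> borel_measurable ?M"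
    and L6: "integrable ?M (\<lambda>x. (w x $ i)^6)" if "w \<in> H10_vec \<Omega>" for w i
  proof -
    from that have w: "(\<lambda>x. w x $ i) \<in> H10 \<Omega>"
      by (simp add: H10_vec_def)
    then show H1: "(\<lambda>x. w x $ i) \<in> H1 \<Omega>"
      by (simp add: H10_def)
    show "(\<lambda>x. w x $ i) \<in> borel_measurable ?M"
      by (rule L2_measurable[OF H1_L2[OF H1]])
    show "integrable ?M (\<lambda>x. (w x $ i)^6)"
      by (rule H10_integrable_power6[OF assms(1) \<Omega> w])
  qed
  have V: "?V w \<in> H1 \<Omega>" if "w \<in> H10_vec \<Omega>" for w
  proof -
    have "(\<lambda>x. \<rho> x - weak_div \<Omega> w x) \<in> L2 ?M"
      by (intro L2_diff \<rho> weak_div_L2 H1 that)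
    with \<Phi> have "weak_solution \<Omega> \<Gamma>\<^sub>D \<epsilon> (\<lambda>x. \<rho> x - weak_div \<Omega> w x) (?V w)"
      unfolding solution_operator_def potential_def by blast
    then show ?thesis
      by (simp add: weak_solution_def V_D_def)
  qed
  have scheme: "\<rho>\<^sub>v / \<tau> * L2_inner ?M ?D ?D + g * grad_inner \<Omega> ?q ?D
      + L2_inner ?M (\<lambda>x. DF_plus \<alpha> \<beta> \<gamma> (?q x)) ?D + L2_inner ?M (weak_gradient \<Omega> (?V ?q)) ?D
      = L2_inner ?M (\<lambda>x. DF_minus \<alpha> \<beta> \<gamma> (?p x)) ?D"
    using assms(22) n D by blast
  have g: "g > 0"
    using assms(16) by auto
  have dissipation: "0 \<le> \<rho>\<^sub>v / \<tau> * L2_inner ?M ?D ?D"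
    using assms(12,17,18,19) by (simp add: L2_inner_def integral_nonneg_AE)
  have gradient: "(\<Sum>i\<in>UNIV. g / 2 * ?g ?q i) - (\<Sum>i\<in>UNIV. g / 2 * ?g ?p i) \<le> g * grad_inner \<Omega> ?q ?D"
  proof -
    have "(\<Sum>i\<in>UNIV. g / 2 * ?g ?q i) - (\<Sum>i\<in>UNIV. g / 2 * ?g ?p i) = g * (\<Sum>i\<in>UNIV. (?g ?q i - ?g ?p i) / 2)"
      by (simp add: sum_distrib_left right_diff_distrib sum_subtractf diff_divide_distrib)
    also have "\<dots> \<le> g * grad_inner \<Omega> ?q ?D"
      using g by (intro mult_left_mono grad_inner_diff_ge[OF \<Omega>] H1 p q) auto
    finally show ?thesis .
  qed
  have convex: "?Fp ?q \<le> ?Fp ?p + L2_inner ?M (\<lambda>x. DF_plus \<alpha> \<beta> \<gamma> (?q x)) ?D"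
    unfolding F_plus_def DF_plus_def L2_inner_def
    by (rule integral_sextic_tangent(2)[OF fin m[OF p] L6[OF p] m[OF q] L6[OF q] m[OF D] L6[OF D]])
      (simp_all add: pos_part_def)
  have concave: "?Fm ?p + L2_inner ?M (\<lambda>x. DF_minus \<alpha> \<beta> \<gamma> (?p x)) ?D \<le> ?Fm ?q"
    unfolding F_minus_def DF_minus_def L2_inner_def
    by (rule integral_sextic_tangent(1)[OF fin m[OF p] L6[OF p] m[OF q] L6[OF q] m[OF D] L6[OF D]])
      (simp_all add: neg_part_def)
  have field: "\<epsilon> / 2 * (?G ?q - ?G ?p) \<le> L2_inner ?M (weak_gradient \<Omega> (?V ?q)) ?D"
    by (rule potential_coupling_ge[OF \<Omega> \<Phi> \<rho> \<open>\<epsilon> > 0\<close> p q D])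
  have "energy \<Omega> \<Phi> \<rho> \<epsilon> \<alpha> \<beta> \<gamma> g w = \<epsilon> / 2 * ?G w + (?Fp w - ?Fm w) + (\<Sum>i\<in>UNIV. g / 2 * ?g w i)"
    if "w \<in> H10_vec \<Omega>" for w
    by (rule energy_eq[OF fin V[OF that] H1[OF that] L6[OF that]])
  from this[OF p] this[OF q]
  show "energy \<Omega> \<Phi> \<rho> \<epsilon> \<alpha> \<beta> \<gamma> g ?q \<le> energy \<Omega> \<Phi> \<rho> \<epsilon> \<alpha> \<beta> \<gamma> g ?p"
    using scheme dissipation gradient convex concave field by (simp add: right_diff_distrib)
qed

end
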